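(* Let $\mathcal{L}_i$ be a multiplicity free commutative subspace lattice on a Hilbert space $\mathcal{H}_i$, $i=1,2$. Then the following statements are equivalent: (i) $\operatorname{Alg}(\mathcal{L}_1)$ and $\operatorname{Alg}(\mathcal{L}_2)$ are unitarily equivalent; (ii) $\operatorname{Alg}(\mathcal{L}_1)$ and $\operatorname{Alg}(\mathcal{L}_2)$ are (completely) isometrically isomorphic; (iii) $\operatorname{Alg}(\mathcal{L}_1)\otimes K(\mathcal{K})$ and $\operatorname{Alg}(\mathcal{L}_2)\otimes K(\mathcal{K})$ are (completely) isometrically isomorphic. Here the equivalence holds both when "isometrically isomorphic" and when "completely isometrically isomorphic" is read in (ii) and (iii).
   Context: $\mathcal{K}$ is a fixed nonzero separable Hilbert space (for instance $\ell^2(\mathbb{N})$) and $K(\mathcal{K})$ is the algebra of compact operators on it. The symbol $\otimes$ between operator algebras denotes the minimal (spatial, norm-closed) tensor product, so $\operatorname{Alg}(\mathcal{L}_i)\otimes K(\mathcal{K})\subset B(\mathcal{H}_i\otimes\mathcal{K})$. "(Completely) isometrically isomorphic" means that there is a surjective (completely) isometric algebra homomorphism. "Unitarily equivalent" means that there is a unitary $V:\mathcal{H}_2\to\mathcal{H}_1$ with $\operatorname{Alg}(\mathcal{L}_2)=V^*\operatorname{Alg}(\mathcal{L}_1)V$. A subspace lattice on $\mathcal{H}$ is a strongly closed collection of (orthogonal) projections in $B(\mathcal{H})$, closed under $\wedge$ and $\vee$, containing $0$ and $I$. A commutative subspace lattice (CSL) is a subspace lattice whose projections commute pairwise. For a subspace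 lattice $\mathcal{L}\subset B(\mathcal{H})$, $\operatorname{Alg}(\mathcal{L})$ is the algebra of all $T\in B(\mathcal{H})$ with $(I-P)TP=0$ for all $P\in\mathcal{L}$. A CSL $\mathcal{L}$ is multiplicity free if the von Neumann algebra $\mathcal{L}''$ generated by $\mathcal{L}$ is a maximal abelian self-adjoint subalgebra of $B(\mathcal{H})$. *)

theory Defs
  imports "HOL-Analysis.Analysis"
begin

section \<open>Complex Hilbert spaces\<close>

class complex_normed_vector = real_normed_vector +
  fixes scaleC :: "complex \<Rightarrow> 'a \<Rightarrow> 'a"  (infixr "*\<^sub>C" 75)
  assumes scaleC_add_right: "c *\<^sub>C (x + y) = c *\<^sub>C x + c *\<^sub>C y"
    and scaleC_add_left: "(c + d) *\<^sub>C x = c *\<^sub>C x + d *\<^sub>C x"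
    and scaleC_scaleC: "c *\<^sub>C d *\<^sub>C x = (c * d) *\<^sub>C x"
    and scaleR_scaleC: "r *\<^sub>R x = complex_of_real r *\<^sub>C x"
    and norm_scaleC: "norm (c *\<^sub>C x) = cmod c * norm x"

text \<open>The inner product is linear in the first argument.\<close>

class complex_inner = complex_normed_vector +
  fixes cinner :: "'a \<Rightarrow> 'a \<Rightarrow> complex"
  assumes cinner_commute: "cinner x y = cnj (cinner y x)"
    and cinner_add_left: "cinner (x + y) z = cinner x z + cinner y z"
    and cinner_scaleC_left: "cinner (c *\<^sub>C x) y = c * cinner x y"
    and cinner_self: "cinner x x = complex_of_real ((norm x)\<^sup>2)"

class chilbert_space = complex_inner + complete_space

global_interpretation complex_vector:
  vector_space "scaleC :: complex \<Rightarrow> 'a \<Rightarrow> 'a::complex_normed_vector"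
  defines csubspace = complex_vector.subspace
    and cspan = complex_vector.span
proof
  fix x :: 'a
  show "1 *\<^sub>C x = x"
    using scaleR_scaleC[of 1 x] by simp
qed (simp_all add: scaleC_add_right scaleC_add_left scaleC_scaleC)

abbreviation clinear ::
  "('a::complex_normed_vector \<Rightarrow> 'b::complex_normed_vector) \<Rightarrow> bool" where
  "clinear \<equiv> Vector_Spaces.linear scaleC scaleC"

definition cbilinear ::
  "('a::complex_normed_vector \<Rightarrow> 'b::complex_normed_vector \<Rightarrow> 'c::complex_normed_vector)
    \<Rightarrow> bool" where
  "cbilinear f \<longleftrightarrow> (\<forall>x. clinear (f x)) \<and> (\<forall>y. clinear (\<lambda>x. f x y))"


section \<open>Bounded operators\<close>

text \<open>
  The library type of bounded operators consists of the real-linear ones. Its norm is the operator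
  norm, and the space of bounded complex-linear operators is carved out as a subset.
\<close>

lemma bounded_linear_scaleC: "bounded_linear (\<lambda>x. c *\<^sub>C (x :: 'a::complex_normed_vector))"
  by (rule bounded_linear_intro[where K = "cmod c"])
     (simp_all add: scaleC_add_right scaleR_scaleC scaleC_scaleC norm_scaleC mult.commute)

instantiation blinfun :: (real_normed_vector, complex_normed_vector) complex_normed_vector
begin

lift_definition scaleC_blinfun :: "complex \<Rightarrow> ('a \<Rightarrow>\<^sub>L 'b) \<Rightarrow> ('a \<Rightarrow>\<^sub>L 'b)"
  is "\<lambda>c T x. c *\<^sub>C T x"
  by (rule bounded_linear_compose[OF bounded_linear_scaleC])

instance
proof
  fix c d :: complex and r :: real and S T :: "'a \<Rightarrow>\<^sub>L 'b"
  show "c *\<^sub>C (S + T) = c *\<^sub>C S + c *\<^sub>C T"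
    by transfer (simp add: scaleC_add_right)
  show "(c + d) *\<^sub>C T = c *\<^sub>C T + d *\<^sub>C T"
    by transfer (simp add: scaleC_add_left)
  show "c *\<^sub>C d *\<^sub>C T = (c * d) *\<^sub>C T"
    by transfer (simp add: scaleC_scaleC)
  show "r *\<^sub>R T = complex_of_real r *\<^sub>C T"
    by transfer (simp add: scaleR_scaleC)
  have le: "norm (c *\<^sub>C T) \<le> cmod c * norm T" for c and T :: "'a \<Rightarrow>\<^sub>L 'b"
    by (rule norm_blinfun_bound)
       (simp_all add: scaleC_blinfun.rep_eq norm_scaleC mult.assoc mult_left_mono norm_blinfun)
  show "norm (c *\<^sub>C T) = cmod c * norm T"
  proof (cases "c = 0")
    case True
    then show ?thesis using le[of 0 T] by simp
  next
    case False
    have "inverse c *\<^sub>C c *\<^sub>C T = T"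
      using False by transfer simp
    then have "norm T \<le> inverse (cmod c) * norm (c *\<^sub>C T)"
      using le[of "inverse c" "c *\<^sub>C T"] by (simp add: norm_inverse)
    then have "cmod c * norm T \<le> norm (c *\<^sub>C T)"
      using False by (simp add: field_simps)
    then show ?thesis using le[of c T] by simp
  qed
qed

end

definition bounded_ops :: "('a::complex_normed_vector \<Rightarrow>\<^sub>L 'b::complex_normed_vector) set" where
  "bounded_ops = {T. clinear (blinfun_apply T)}"

definition is_adjoint ::
  "('a::complex_inner \<Rightarrow>\<^sub>L 'b::complex_inner) \<Rightarrow> ('b \<Rightarrow>\<^sub>L 'a) \<Rightarrow> bool" where
  "is_adjoint T S \<longleftrightarrow> (\<forall>x y. cinner (T x) y = cinner x (S y))"

definition compact_ops :: "('a::complex_normed_vector \<Rightarrow>\<^sub>L 'b::complex_normed_vector) set" where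
  "compact_ops = {T \<in> bounded_ops. compact (closure (blinfun_apply T ` cball 0 1))}"

definition commutant :: "('a::complex_normed_vector \<Rightarrow>\<^sub>L 'a) set \<Rightarrow> ('a \<Rightarrow>\<^sub>L 'a) set" where
  "commutant S = {T \<in> bounded_ops. \<forall>A\<in>S. T o\<^sub>L A = A o\<^sub>L T}"

definition abelian_selfadjoint_subalgebra ::
  "('a::complex_inner \<Rightarrow>\<^sub>L 'a) set \<Rightarrow> bool" where
  "abelian_selfadjoint_subalgebra M \<longleftrightarrow>
     M \<subseteq> bounded_ops \<and> csubspace M \<and>
     (\<forall>S\<in>M. \<forall>T\<in>M. S o\<^sub>L T \<in> M \<and> S o\<^sub>L T = T o\<^sub>L S) \<and>
     (\<forall>T\<in>M. \<exists>S\<in>M. is_adjoint T S)"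

definition masa :: "('a::complex_inner \<Rightarrow>\<^sub>L 'a) set \<Rightarrow> bool" where
  "masa M \<longleftrightarrow> abelian_selfadjoint_subalgebra M \<and>
     (\<forall>N. abelian_selfadjoint_subalgebra N \<and> M \<subseteq> N \<longrightarrow> N = M)"


section \<open>Subspace lattices\<close>

definition projections :: "('a::complex_inner \<Rightarrow>\<^sub>L 'a) set" where
  "projections = {P \<in> bounded_ops. P o\<^sub>L P = P \<and> is_adjoint P P}"

text \<open>
  A projection is determined by its range; the ranges of the meet and the join of two projections
  are the intersection and the closed linear sum of their ranges.
\<close>

definition subspace_lattice :: "('a::chilbert_space \<Rightarrow>\<^sub>L 'a) set \<Rightarrow> bool" where
  "subspace_lattice L \<longleftrightarrow>
     L \<subseteq> projections \<and> closedin strong_operator_topology L \<and>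
     0 \<in> L \<and> id_blinfun \<in> L \<and>
     (\<forall>P\<in>L. \<forall>Q\<in>L.
        (\<exists>R\<in>L. range (blinfun_apply R) = range (blinfun_apply P) \<inter> range (blinfun_apply Q)) \<and>
        (\<exists>R\<in>L. range (blinfun_apply R) = closure {P x + Q y | x y. True}))"

definition CSL :: "('a::chilbert_space \<Rightarrow>\<^sub>L 'a) set \<Rightarrow> bool" where
  "CSL L \<longleftrightarrow> subspace_lattice L \<and> (\<forall>P\<in>L. \<forall>Q\<in>L. P o\<^sub>L Q = Q o\<^sub>L P)"

definition multiplicity_free :: "('a::chilbert_space \<Rightarrow>\<^sub>L 'a) set \<Rightarrow> bool" where
  "multiplicity_free L \<longleftrightarrow> masa (commutant (commutant L))"

definition Alg :: "('a::chilbert_space \<Rightarrow>\<^sub>L 'a) set \<Rightarrow> ('a \<Rightarrow>\<^sub>L 'a) set" where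
  "Alg L = {T \<in> bounded_ops. \<forall>P\<in>L. (id_blinfun - P) o\<^sub>L T o\<^sub>L P = 0}"


section \<open>Tensor products\<close>

text \<open>
  The Hilbert space tensor product is determined up to a unique unitary compatible with elementary
  tensors; \<open>hilbert_tensor t\<close> says that the codomain of \<open>t\<close>, with \<open>t x y\<close> as the
  elementary tensor of \<open>x\<close> and \<open>y\<close>, is a realization of it.
\<close>

definition hilbert_tensor ::
  "('a::chilbert_space \<Rightarrow> 'b::chilbert_space \<Rightarrow> 'c::chilbert_space) \<Rightarrow> bool" where
  "hilbert_tensor t \<longleftrightarrow>
     cbilinear t \<and>
     (\<forall>x y x' y'. cinner (t x y) (t x' y') = cinner x x' * cinner y y') \<and>
     closure (cspan {t x y | x y. True}) = UNIV"

definition is_op_tensor ::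
  "('a::chilbert_space \<Rightarrow> 'b::chilbert_space \<Rightarrow> 'c::chilbert_space)
    \<Rightarrow> ('a \<Rightarrow>\<^sub>L 'a) \<Rightarrow> ('b \<Rightarrow>\<^sub>L 'b) \<Rightarrow> ('c \<Rightarrow>\<^sub>L 'c) \<Rightarrow> bool" where
  "is_op_tensor t S T R \<longleftrightarrow> R \<in> bounded_ops \<and> (\<forall>x y. R (t x y) = t (S x) (T y))"

definition min_tensor ::
  "('a::chilbert_space \<Rightarrow> 'b::chilbert_space \<Rightarrow> 'c::chilbert_space)
    \<Rightarrow> ('a \<Rightarrow>\<^sub>L 'a) set \<Rightarrow> ('b \<Rightarrow>\<^sub>L 'b) set \<Rightarrow> ('c \<Rightarrow>\<^sub>L 'c) set" where
  "min_tensor t A B = closure (cspan {R. \<exists>S\<in>A. \<exists>T\<in>B. is_op_tensor t S T R})"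


section \<open>Equivalences of operator algebras\<close>

definition unitarily_equivalent ::
  "('a::chilbert_space \<Rightarrow>\<^sub>L 'a) set \<Rightarrow> ('b::chilbert_space \<Rightarrow>\<^sub>L 'b) set \<Rightarrow> bool" where
  "unitarily_equivalent A B \<longleftrightarrow>
     (\<exists>(V :: 'b \<Rightarrow>\<^sub>L 'a) (W :: 'a \<Rightarrow>\<^sub>L 'b).
        V \<in> bounded_ops \<and> W \<in> bounded_ops \<and> is_adjoint V W \<and>
        V o\<^sub>L W = id_blinfun \<and> W o\<^sub>L V = id_blinfun \<and>
        B = {W o\<^sub>L T o\<^sub>L V | T. T \<in> A})"

definition algebra_hom_on ::
  "('a::complex_normed_vector \<Rightarrow>\<^sub>L 'a) set
    \<Rightarrow> (('a \<Rightarrow>\<^sub>L 'a) \<Rightarrow> ('b::complex_normed_vector \<Rightarrow>\<^sub>L 'b)) \<Rightarrow> bool" where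
  "algebra_hom_on A \<phi> \<longleftrightarrow>
     (\<forall>S\<in>A. \<forall>T\<in>A. \<phi> (S + T) = \<phi> S + \<phi> T) \<and>
     (\<forall>c. \<forall>T\<in>A. \<phi> (c *\<^sub>C T) = c *\<^sub>C \<phi> T) \<and>
     (\<forall>S\<in>A. \<forall>T\<in>A. \<phi> (S o\<^sub>L T) = \<phi> S o\<^sub>L \<phi> T)"

text \<open>
  The norm of the operator on the \<open>n\<close>-fold Hilbert space direct sum given by an \<open>n\<close> by \<open>n\<close>
  matrix of operators; only the entries with indices below \<open>n\<close> matter.
\<close>

definition matrix_norm ::
  "nat \<Rightarrow> (nat \<Rightarrow> nat \<Rightarrow> ('a::complex_normed_vector \<Rightarrow>\<^sub>L 'a)) \<Rightarrow> real" where
  "matrix_norm n T =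
     (SUP x \<in> {x :: nat \<Rightarrow> 'a. L2_set (\<lambda>j. norm (x j)) {..<n} \<le> 1}.
        L2_set (\<lambda>i. norm (\<Sum>j<n. T i j (x j))) {..<n})"

definition isometric_on ::
  "('a::complex_normed_vector \<Rightarrow>\<^sub>L 'a) set
    \<Rightarrow> (('a \<Rightarrow>\<^sub>L 'a) \<Rightarrow> ('b::complex_normed_vector \<Rightarrow>\<^sub>L 'b)) \<Rightarrow> bool" where
  "isometric_on A \<phi> \<longleftrightarrow> (\<forall>T\<in>A. norm (\<phi> T) = norm T)"

definition completely_isometric_on ::
  "('a::complex_normed_vector \<Rightarrow>\<^sub>L 'a) set
    \<Rightarrow> (('a \<Rightarrow>\<^sub>L 'a) \<Rightarrow> ('b::complex_normed_vector \<Rightarrow>\<^sub>L 'b)) \<Rightarrow> bool" where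
  "completely_isometric_on A \<phi> \<longleftrightarrow>
     (\<forall>n T. (\<forall>i<n. \<forall>j<n. T i j \<in> A) \<longrightarrow>
        matrix_norm n (\<lambda>i j. \<phi> (T i j)) = matrix_norm n T)"

definition isometrically_isomorphic ::
  "('a::complex_normed_vector \<Rightarrow>\<^sub>L 'a) set \<Rightarrow> ('b::complex_normed_vector \<Rightarrow>\<^sub>L 'b) set \<Rightarrow> bool"
  where
  "isometrically_isomorphic A B \<longleftrightarrow>
     (\<exists>\<phi>. algebra_hom_on A \<phi> \<and> \<phi> ` A = B \<and> isometric_on A \<phi>)"

definition completely_isometrically_isomorphic ::
  "('a::complex_normed_vector \<Rightarrow>\<^sub>L 'a) set \<Rightarrow> ('b::complex_normed_vector \<Rightarrow>\<^sub>L 'b) set \<Rightarrow> bool"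
  where
  "completely_isometrically_isomorphic A B \<longleftrightarrow>
     (\<exists>\<phi>. algebra_hom_on A \<phi> \<and> \<phi> ` A = B \<and> completely_isometric_on A \<phi>)"

end

theory Submission
  imports Defs
begin

text \<open>
  The diagonal \<open>D = Alg(L) \<inter> Alg(L)*\<close> of a multiplicity free CSL algebra is the maximal abelian
  algebra \<open>L'\<close>. An isometric isomorphism maps contractive idempotents to contractive idempotents,
  that is, projections to projections, and it preserves self-adjointness because \<open>h\<close> is self-adjoint
  iff \<open>\<parallel>1 + ith\<parallel>\<^sup>2 \<le> 1 + O(t\<^sup>2)\<close>. So an isomorphism of the algebras restricts to a *-isomorphism
  \<open>\<theta>\<close> of their diagonals matching the invariant projections. For the stabilized algebras,
  \<open>D \<otimes> 1\<close> acts as the central multipliers of \<open>D \<otimes> K\<close>, and \<open>\<theta>\<close> is determined by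
  \<open>\<phi>((d \<otimes> 1) a) = (\<theta>(d) \<otimes> 1) \<phi>(a)\<close>.

  A *-isomorphism of maximal abelian algebras is implemented by a unitary \<open>V\<close>, on nonseparable
  spaces too: a maximal set of pairs \<open>(u, v)\<close> satisfying \<open>\<langle>d u, u'\<rangle> = \<langle>\<theta>(d) v, v'\<rangle>\<close> pairwise is the
  graph of such a \<open>V\<close>. A proper maximal graph could be enlarged, since the projection onto the closure
  of \<open>{(d x, \<theta>(d) y)}\<close> has a nonzero off-diagonal corner, whose polar decomposition supplies a new
  pair. As \<open>Alg(L)\<close> is determined by its invariant projections, \<open>V\<close> carries \<open>Alg(L\<^sub>1)\<close> to
  \<open>Alg(L\<^sub>2)\<close>. Conversely, \<open>V \<otimes> 1\<close> conjugates the stabilized algebras completely isometrically.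
\<close>

section \<open>Complex inner products\<close>

text \<open>Little structure is given at the start. An isomorphism is not assumed to respect
  adjoints or to be weakly continuous. The spaces may be nonseparable, so a diagonal may have no
  cyclic vector. A stabilized algebra usually has no unit, so d \<otimes> 1 is not among the
  arguments of \<phi>. Hence self-adjointness is tested relative to a projection e, by the norm of e
  + itm, which works in every corner. Identities between stabilized operators are tested after
  multiplication by 1 \<otimes> |u><v|, and the matching of diagonals is a relation that can be
  reversed together with \<phi>.

  The corner of the projection is nonzero for the following reason. The vector y is taken in the
  range of \<theta> of the support of x, so d x = 0 forces \<theta>(d) y = 0. If the corner killed
  x, some d would bring d x close to x and \<theta>(d) y close to 0. Replacing these d by spectral
  projections makes a countable product converge on y, and this yields a projection s in the first
  diagonal with s x = 0 whose image fixes a nonzero vector that \<theta>(s) has to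
  annihilate.\<close>

lemma scaleC_simps [simp]:
  "1 *\<^sub>C x = (x::'a::complex_normed_vector)" "0 *\<^sub>C x = 0" "c *\<^sub>C (0::'a) = 0"
  "- 1 *\<^sub>C x = - x"
  by simp_all

lemma scaleC_minus_right: "c *\<^sub>C (- x) = - (c *\<^sub>C (x::'a::complex_normed_vector))"
  and scaleC_minus_left: "(- c) *\<^sub>C x = - (c *\<^sub>C (x::'a::complex_normed_vector))"
  and scaleC_diff_right: "c *\<^sub>C (x - y) = c *\<^sub>C x - c *\<^sub>C (y::'a::complex_normed_vector)"
  by (simp_all add: complex_vector.scale_right_diff_distrib)

lemma cinner_add_right: "cinner x (y + z) = cinner x y + cinner x (z::'a::complex_inner)"
  by (metis cinner_add_left cinner_commute complex_cnj_add)

lemma cinner_scaleC_right: "cinner x (c *\<^sub>C y) = cnj c * cinner x (y::'a::complex_inner)"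
  by (metis cinner_scaleC_left cinner_commute complex_cnj_mult)

lemma cinner_zero [simp]: "cinner 0 x = 0" "cinner x (0::'a::complex_inner) = 0"
  using cinner_scaleC_left[of 0 0 x] cinner_scaleC_right[of x 0 0] by auto

lemma cinner_minus: "cinner (- x) y = - cinner x y" "cinner x (- y) = - cinner x (y::'a::complex_inner)"
  using cinner_scaleC_left[of "-1" x y] cinner_scaleC_right[of x "-1" y] by auto

lemma cinner_diff: "cinner (x - z) y = cinner x y - cinner z y"
    "cinner x (y - z) = cinner x y - cinner x (z::'a::complex_inner)"
  using cinner_add_left[of x "-z" y] cinner_add_right[of x y "-z"] by (auto simp: cinner_minus)

lemmas cinner_simps = cinner_add_left cinner_add_right cinner_scaleC_left cinner_scaleC_right
  cinner_minus cinner_diff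

lemma norm_add_square:
  "(norm (x + y))\<^sup>2 = (norm x)\<^sup>2 + 2 * Re (cinner x y) + (norm (y::'a::complex_inner))\<^sup>2"
proof -
  have "complex_of_real ((norm (x + y))\<^sup>2) = cinner (x + y) (x + y)"
    by (simp add: cinner_self)
  also have "\<dots> = cinner x x + cinner y y + (cinner x y + cnj (cinner x y))"
    by (simp add: cinner_simps cinner_commute[of y x] algebra_simps)
  also have "\<dots> = complex_of_real ((norm x)\<^sup>2 + 2 * Re (cinner x y) + (norm y)\<^sup>2)"
    by (simp add: cinner_self complex_add_cnj)
  finally show ?thesis
    using of_real_eq_iff by blast
qed

lemma norm_diff_square:
  "(norm (x - y))\<^sup>2 = (norm x)\<^sup>2 - 2 * Re (cinner x y) + (norm (y::'a::complex_inner))\<^sup>2"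
  using norm_add_square[of x "-y"] by (simp add: cinner_minus)

lemma cinner_eq_0_commute: "cinner x y = 0 \<longleftrightarrow> cinner y (x::'a::complex_inner) = 0"
  by (metis cinner_commute complex_cnj_zero)

lemma cinner_self_eq_0 [simp]: "cinner x x = 0 \<longleftrightarrow> x = (0::'a::complex_inner)"
  by (simp add: cinner_self)

lemma cinner_ext: "(\<And>z. cinner x z = cinner y z) \<Longrightarrow> x = (y::'a::complex_inner)"
  by (metis cinner_diff(1) cinner_self_eq_0 right_minus_eq)

lemma Cauchy_Schwarz_cinner: "cmod (cinner x y) \<le> norm x * norm (y::'a::complex_inner)"
proof (cases "y = 0")
  case False
  define c where "c = cinner x y / complex_of_real ((norm y)\<^sup>2)"
  have "0 \<le> (norm (x - c *\<^sub>C y))\<^sup>2" by simp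
  also have "\<dots> = (norm x)\<^sup>2 - 2 * Re (cnj c * cinner x y) + (cmod c)\<^sup>2 * (norm y)\<^sup>2"
    by (simp add: norm_diff_square cinner_simps norm_scaleC power_mult_distrib)
  also have "cnj c * cinner x y = complex_of_real ((cmod (cinner x y))\<^sup>2 / (norm y)\<^sup>2)"
    by (simp add: c_def complex_norm_square mult.commute[of "cnj _"] del: of_real_power)
  also have "(cmod c)\<^sup>2 * (norm y)\<^sup>2 = (cmod (cinner x y))\<^sup>2 / (norm y)\<^sup>2"
    using False by (simp add: c_def norm_divide power_divide norm_power) (simp add: power2_eq_square power4_eq_xxxx)
  finally have "(cmod (cinner x y))\<^sup>2 / (norm y)\<^sup>2 \<le> (norm x)\<^sup>2" by simp
  then have "(cmod (cinner x y))\<^sup>2 \<le> (norm x * norm y)\<^sup>2"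
    using False by (simp add: field_simps power_mult_distrib)
  then show ?thesis by (rule power2_le_imp_le) simp
qed simp

text \<open>Moving x along y by the coefficient <x,y>/||y||^2 lowers ||x||^2 by |<x,y>|^2/||y||^2,
  so minimality leaves no room for a nonzero inner product. It serves nearest points and, later,
  contractive idempotents.\<close>

lemma orthogonal_if_norm_minimal:
  fixes x y :: "'a::complex_inner"
  assumes "\<And>c. norm x \<le> norm (x - c *\<^sub>C y)"
  shows "cinner x y = 0"
proof (cases "y = 0")
  case False
  define c where "c = cinner x y / complex_of_real ((norm y)\<^sup>2)"
  have "(norm x)\<^sup>2 \<le> (norm (x - c *\<^sub>C y))\<^sup>2" using assms by (intro power_mono) auto
  also have "\<dots> = (norm x)\<^sup>2 - 2 * Re (cnj c * cinner x y) + (cmod c)\<^sup>2 * (norm y)\<^sup>2"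
    by (simp add: norm_diff_square cinner_simps norm_scaleC power_mult_distrib)
  also have "cnj c * cinner x y = complex_of_real ((cmod (cinner x y))\<^sup>2 / (norm y)\<^sup>2)"
    by (simp add: c_def complex_norm_square mult.commute[of "cnj _"] del: of_real_power)
  also have "(cmod c)\<^sup>2 * (norm y)\<^sup>2 = (cmod (cinner x y))\<^sup>2 / (norm y)\<^sup>2"
    using False by (simp add: c_def norm_divide power_divide norm_power) (simp add: power2_eq_square power4_eq_xxxx)
  finally have "(cmod (cinner x y))\<^sup>2 / (norm y)\<^sup>2 \<le> 0" by simp
  then show ?thesis using False by (simp add: divide_le_0_iff)
qed simp

lemma bounded_bilinear_cinner: "bounded_bilinear (cinner :: 'a::complex_inner \<Rightarrow> 'a \<Rightarrow> complex)"
  by standard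
    (auto simp: cinner_simps scaleR_scaleC scaleR_conv_of_real intro!: exI[of _ 1] Cauchy_Schwarz_cinner)

lemmas tendsto_cinner [tendsto_intros] = bounded_bilinear.tendsto[OF bounded_bilinear_cinner]
lemmas continuous_cinner [continuous_intros] =
  bounded_bilinear.continuous_on[OF bounded_bilinear_cinner]

lemma closed_orthogonal: "closed {x. cinner x (y::'a::complex_inner) = 0}"
  by (intro closed_Collect_eq continuous_intros)

lemma parallelogram_law:
  "(norm (x + y))\<^sup>2 + (norm (x - y))\<^sup>2 = 2 * (norm x)\<^sup>2 + 2 * (norm (y::'a::complex_inner))\<^sup>2"
  by (simp add: norm_add_square norm_diff_square)

text \<open>Expanding F at x + y and at x + iy gives F x y + F y x = 0 and F y x - F x y = 0.
  Besides self-adjointness, it later handles the passage from |u><u| to |u><v|.\<close>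

lemma polarization:
  fixes F :: "'a::complex_normed_vector \<Rightarrow> 'a \<Rightarrow> complex"
  assumes "\<And>x y z. F (x + y) z = F x z + F y z" "\<And>x y z. F z (x + y) = F z x + F z y"
    and "\<And>c x y. F (c *\<^sub>C x) y = c * F x y" "\<And>c x y. F x (c *\<^sub>C y) = cnj c * F x y"
    and "\<And>x. F x x = 0"
  shows "F x y = 0"
proof -
  have "F x y + F y x = F (x + y) (x + y)"
    by (simp only: assms(1,2)) (simp add: assms(5))
  then have "F x y + F y x = 0" by (simp only: assms(5))
  moreover have "\<i> * (F y x - F x y) = F (x + \<i> *\<^sub>C y) (x + \<i> *\<^sub>C y)"
    by (simp only: assms(1-4)) (simp add: assms(5) algebra_simps)
  then have "F y x - F x y = 0" by (simp only: assms(5)) simp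
  ultimately show ?thesis by algebra
qed


section \<open>Bounded complex-linear operators\<close>

lemma bounded_opsI:
  fixes T :: "'a::complex_normed_vector \<Rightarrow>\<^sub>L 'b::complex_normed_vector"
  shows "(\<And>c x. T (c *\<^sub>C x) = c *\<^sub>C T x) \<Longrightarrow> T \<in> bounded_ops"
  by (simp add: bounded_ops_def Vector_Spaces.linear_iff blinfun.add_right
      complex_vector.vector_space_axioms)

lemma bounded_ops_scaleC:
  fixes T :: "'a::complex_normed_vector \<Rightarrow>\<^sub>L 'b::complex_normed_vector"
  shows "T \<in> bounded_ops \<Longrightarrow> T (c *\<^sub>C x) = c *\<^sub>C T x"
  by (simp add: bounded_ops_def Vector_Spaces.linear_iff)

lemma ex_bounded_op:
  assumes "\<And>x y. f (x + y) = f x + f y" "\<And>c x. f (c *\<^sub>C x) = c *\<^sub>C f x"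
    and "\<And>x. norm (f x) \<le> K * norm x"
  obtains T where "T \<in> bounded_ops" "\<And>x. blinfun_apply T x = f x"
proof -
  have "bounded_linear f"
    using assms by (intro bounded_linear_intro[where K = K]) (auto simp: scaleR_scaleC mult.commute)
  then have *: "blinfun_apply (Blinfun f) = f" by (rule bounded_linear_Blinfun_apply)
  show thesis
    by (rule that[of "Blinfun f"]) (auto simp: * assms intro!: bounded_opsI)
qed

lemma bounded_ops_simps [simp]:
  "0 \<in> bounded_ops" "id_blinfun \<in> bounded_ops"
  "S \<in> bounded_ops \<Longrightarrow> T \<in> bounded_ops \<Longrightarrow> S + T \<in> bounded_ops"
  "S \<in> bounded_ops \<Longrightarrow> T \<in> bounded_ops \<Longrightarrow> S - T \<in> bounded_ops"
  "S \<in> bounded_ops \<Longrightarrow> - S \<in> bounded_ops"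
  "S \<in> bounded_ops \<Longrightarrow> c *\<^sub>C S \<in> bounded_ops"
  "S \<in> bounded_ops \<Longrightarrow> r *\<^sub>R S \<in> bounded_ops"
  by (auto intro!: bounded_opsI simp: blinfun.zero_left blinfun.add_left blinfun.diff_left
      blinfun.minus_left bounded_ops_scaleC scaleC_add_right scaleC_diff_right
      scaleC_minus_right scaleC_blinfun.rep_eq scaleR_scaleC scaleC_scaleC mult.commute)

lemma bounded_ops_compose [simp]:
  "S \<in> bounded_ops \<Longrightarrow> T \<in> bounded_ops \<Longrightarrow> S o\<^sub>L T \<in> bounded_ops"
  by (auto intro!: bounded_opsI simp: bounded_ops_scaleC)

lemmas op_apply = blinfun.zero_left blinfun.add_left blinfun.diff_left blinfun.minus_left
  scaleC_blinfun.rep_eq blinfun.scaleR_left blinfun_apply_blinfun_compose id_blinfun.rep_eq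
  blinfun.add_right blinfun.diff_right blinfun.minus_right blinfun.zero_right

lemma
  fixes A B :: "'b::real_normed_vector \<Rightarrow>\<^sub>L 'c::real_normed_vector" and S T :: "'a::real_normed_vector \<Rightarrow>\<^sub>L 'b"
    and E :: "'d::real_normed_vector \<Rightarrow>\<^sub>L 'a"
  shows compose_add: "A o\<^sub>L (S + T) = (A o\<^sub>L S) + (A o\<^sub>L T)" "(A + B) o\<^sub>L S = (A o\<^sub>L S) + (B o\<^sub>L S)"
  and compose_diff: "A o\<^sub>L (S - T) = (A o\<^sub>L S) - (A o\<^sub>L T)" "(A - B) o\<^sub>L S = (A o\<^sub>L S) - (B o\<^sub>L S)"
  and compose_minus: "A o\<^sub>L (- T) = - (A o\<^sub>L T)" "(- A) o\<^sub>L T = - (A o\<^sub>L T)"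
  and compose_scaleR: "A o\<^sub>L (r *\<^sub>R T) = r *\<^sub>R (A o\<^sub>L T)" "(r *\<^sub>R A) o\<^sub>L T = r *\<^sub>R (A o\<^sub>L T)"
  and compose_assoc: "(A o\<^sub>L S) o\<^sub>L E = A o\<^sub>L (S o\<^sub>L E)"
  and compose_zero: "A o\<^sub>L (0 :: 'a \<Rightarrow>\<^sub>L 'b) = 0" "(0 :: 'b \<Rightarrow>\<^sub>L 'c) o\<^sub>L S = 0"
  and compose_id: "A o\<^sub>L id_blinfun = A" "id_blinfun o\<^sub>L A = A"
  by (auto intro!: blinfun_eqI simp: op_apply blinfun.scaleR_right)

lemma compose_scaleC: "(c *\<^sub>C A) o\<^sub>L (C::'a::real_normed_vector \<Rightarrow>\<^sub>L 'b::real_normed_vector) = c *\<^sub>C (A o\<^sub>L C)"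
  by (auto intro!: blinfun_eqI simp: op_apply)

lemma compose_scaleC_right: "A \<in> bounded_ops \<Longrightarrow> A o\<^sub>L (c *\<^sub>C C) = c *\<^sub>C (A o\<^sub>L C)"
  by (auto intro!: blinfun_eqI simp: op_apply bounded_ops_scaleC)

text \<open>\<open>min_tensor\<close> takes its closure in the type of real-linear operators; this
  keeps the limits complex-linear.\<close>

lemma closed_bounded_ops:
  "closed (bounded_ops :: ('a::complex_normed_vector \<Rightarrow>\<^sub>L 'b::complex_normed_vector) set)"
proof -
  have eq: "(bounded_ops :: ('a \<Rightarrow>\<^sub>L 'b) set) = (\<Inter>c. \<Inter>x. {T. blinfun_apply T (c *\<^sub>C x) - c *\<^sub>C (blinfun_apply T x) = 0})"
    by (auto intro: bounded_opsI simp: bounded_ops_scaleC)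
  have cl: "closed {T::'a \<Rightarrow>\<^sub>L 'b. blinfun_apply T (c *\<^sub>C x) - c *\<^sub>C (blinfun_apply T x) = 0}" for c x
    by (intro closed_Collect_eq continuous_intros
        bounded_linear.continuous_on[OF bounded_linear_scaleC])
  show ?thesis unfolding eq by (intro closed_INT ballI cl)
qed


section \<open>Products\<close>

instantiation prod :: (complex_normed_vector, complex_normed_vector) complex_normed_vector
begin
definition scaleC_prod: "c *\<^sub>C p = (c *\<^sub>C fst p, c *\<^sub>C snd p)"
instance
  by standard (auto simp: scaleC_prod scaleC_add_right scaleC_add_left scaleC_scaleC scaleR_scaleC
      norm_Pair norm_scaleC power_mult_distrib real_sqrt_mult prod_eq_iff
      simp flip: distrib_left)
end

instantiation prod :: (complex_inner, complex_inner) complex_inner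
begin
definition cinner_prod: "cinner p q = cinner (fst p) (fst q) + cinner (snd p) (snd q)"
instance
proof
  fix x y z :: "'a \<times> 'b" and c
  show "cinner x y = cnj (cinner y x)"
    by (simp add: cinner_prod) (metis cinner_commute)
  show "cinner x x = complex_of_real ((norm x)\<^sup>2)"
    by (cases x) (simp add: cinner_prod cinner_self norm_Pair)
qed (auto simp: cinner_prod cinner_simps scaleC_prod algebra_simps)
end

instance prod :: (chilbert_space, chilbert_space) chilbert_space ..

lemma fst_snd_scaleC [simp]: "fst (c *\<^sub>C p) = c *\<^sub>C fst p" "snd (c *\<^sub>C p) = c *\<^sub>C snd p"
  by (simp_all add: scaleC_prod)


section \<open>Orthogonal projections and adjoints\<close>

lemma csubspaceI:
  assumes "0 \<in> M" "\<And>x y. x \<in> M \<Longrightarrow> y \<in> M \<Longrightarrow> x + y \<in> M" "\<And>c x. x \<in> M \<Longrightarrow> c *\<^sub>C x \<in> M"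
  shows "csubspace M"
  using assms by (auto intro: complex_vector.subspaceI)

lemma csubspaceD:
  assumes "csubspace M"
  shows "0 \<in> M" "x \<in> M \<Longrightarrow> y \<in> M \<Longrightarrow> x + y \<in> M" "x \<in> M \<Longrightarrow> c *\<^sub>C x \<in> M"
    "x \<in> M \<Longrightarrow> y \<in> M \<Longrightarrow> x - y \<in> M" "x \<in> M \<Longrightarrow> - x \<in> M" "x \<in> M \<Longrightarrow> r *\<^sub>R x \<in> M"
  using assms unfolding scaleR_scaleC
  by (auto simp: complex_vector.subspace_0 complex_vector.subspace_add complex_vector.subspace_scale
      complex_vector.subspace_diff complex_vector.subspace_neg)

lemma csubspace_closure:
  assumes "csubspace (M::'a::complex_normed_vector set)"
  shows "csubspace (closure M)"
proof (rule csubspaceI)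
  show "0 \<in> closure M" using csubspaceD(1)[OF assms] closure_subset by blast
next
  fix x y assume "x \<in> closure M" "y \<in> closure M"
  then obtain f g where "\<And>n. f n \<in> M" "f \<longlonglongrightarrow> x" "\<And>n. g n \<in> M" "g \<longlonglongrightarrow> y"
    unfolding closure_sequential by metis
  then show "x + y \<in> closure M" unfolding closure_sequential
    by (intro exI[of _ "\<lambda>n. f n + g n"]) (auto intro!: tendsto_intros csubspaceD(2)[OF assms])
next
  fix x c assume "x \<in> closure M"
  then obtain f where "\<And>n. f n \<in> M" "f \<longlonglongrightarrow> x"
    unfolding closure_sequential by metis
  then show "c *\<^sub>C x \<in> closure M" unfolding closure_sequential
    by (intro exI[of _ "\<lambda>n. c *\<^sub>C f n"])
      (auto intro!: csubspaceD(3)[OF assms] bounded_linear.tendsto[OF bounded_linear_scaleC])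
qed

lemma ex_nearest_point:
  fixes M :: "'a::chilbert_space set"
  assumes M: "csubspace M" and cl: "closed M"
  shows "\<exists>m\<in>M. \<forall>y\<in>M. norm (x - m) \<le> norm (x - y)"
proof -
  define d where "d = (INF y\<in>M. norm (x - y))"
  have bdd: "bdd_below ((\<lambda>y. norm (x - y)) ` M)" by (rule bdd_belowI[of _ 0]) auto
  have dle: "d \<le> norm (x - y)" if "y \<in> M" for y
    unfolding d_def using that bdd by (intro cINF_lower) auto
  have d0: "0 \<le> d" unfolding d_def using csubspaceD(1)[OF M] by (intro cINF_greatest) auto
  have "\<exists>y\<in>M. norm (x - y) < d + 1 / Suc n" for n
  proof -
    have "d < d + 1 / Suc n" by simp
    then show ?thesis unfolding d_def
      using cINF_less_iff[OF _ bdd, of "d + 1 / Suc n"] csubspaceD(1)[OF M] unfolding d_def by blast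
  qed
  then obtain f where fM: "\<And>n. f n \<in> M" and f: "\<And>n. norm (x - f n) < d + 1 / Suc n" by metis
  \<comment> \<open>With e = 1/(N+1) \<le> 1 one has (d + e)^2 \<le> d^2 + 2(d+1)e. Two such bounds,
    doubled by the parallelogram law, exceed 4d^2 by at most 8(d+1)e, and the midpoint contributes
    at least 4d^2.\<close>
  have est: "(norm (f i - f j))\<^sup>2 \<le> 8 * (d + 1) * (1 / Suc N)" if "N \<le> i" "N \<le> j" for i j N
  proof -
    define e where "e = 1 / real (Suc N)"
    have e: "0 \<le> e" "e \<le> 1" by (auto simp: e_def)
    have sq: "(norm (x - f k))\<^sup>2 \<le> d\<^sup>2 + 2 * (d + 1) * e" if "N \<le> k" for k
    proof -
      have "1 / real (Suc k) \<le> 1 / Suc N" using that by (simp add: divide_simps)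
      then have "norm (x - f k) \<le> d + e" using f[of k] unfolding e_def by linarith
      then have "(norm (x - f k))\<^sup>2 \<le> (d + e)\<^sup>2" by (intro power_mono) auto
      also have "\<dots> = d\<^sup>2 + 2 * d * e + e * e"
        by (simp add: power2_eq_square algebra_simps)
      also have "\<dots> \<le> d\<^sup>2 + 2 * d * e + 2 * e"
        using mult_left_le[OF e(2,1)] e(1) by simp
      also have "\<dots> = d\<^sup>2 + 2 * (d + 1) * e" by (simp add: algebra_simps)
      finally show ?thesis by simp
    qed
    define m where "m = (1/2) *\<^sub>R (f i + f j)"
    have "m \<in> M" unfolding m_def using fM by (intro csubspaceD[OF M])
    then have "d \<le> norm (x - m)" by (rule dle)
    then have "d\<^sup>2 \<le> (norm (x - m))\<^sup>2" using d0 by (intro power_mono)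
    moreover have "(x - f i) + (x - f j) = 2 *\<^sub>R (x - m)"
      unfolding m_def by (simp add: scaleR_2 algebra_simps)
    then have "(norm ((x - f i) + (x - f j)))\<^sup>2 = 4 * (norm (x - m))\<^sup>2"
      by (simp add: power_mult_distrib)
    moreover have "(norm ((x - f i) - (x - f j)))\<^sup>2 = (norm (f i - f j))\<^sup>2"
      by (simp add: norm_minus_commute)
    ultimately show ?thesis
      using parallelogram_law[of "x - f i" "x - f j"] sq[OF that(1)] sq[OF that(2)]
      unfolding e_def by linarith
  qed
  have "Cauchy f"
  proof (rule metric_CauchyI)
    fix e :: real assume "0 < e"
    then have "0 < e\<^sup>2 / (8 * (d + 1))" using d0 by simp
    then obtain N where N: "1 / real (Suc N) < e\<^sup>2 / (8 * (d + 1))"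
      using nat_approx_posE by blast
    have "norm (f i - f j) < e" if "N \<le> i" "N \<le> j" for i j
    proof (rule power2_less_imp_less)
      have "8 * (d + 1) * (1 / Suc N) < e\<^sup>2"
        using N d0 by (simp add: field_simps)
      then show "(norm (f i - f j))\<^sup>2 < e\<^sup>2" using est[OF that] by linarith
    qed (use \<open>0 < e\<close> in simp)
    then show "\<exists>N. \<forall>i\<ge>N. \<forall>j\<ge>N. dist (f i) (f j) < e" by (auto simp: dist_norm)
  qed
  then obtain m where m: "f \<longlonglongrightarrow> m" by (metis Cauchy_convergent_iff convergent_def)
  have "m \<in> M" using cl fM m by (metis closed_sequentially)
  moreover have "norm (x - m) \<le> norm (x - y)" if "y \<in> M" for y
  proof -
    have "(\<lambda>n. norm (x - f n)) \<longlonglongrightarrow> norm (x - m)" using m by (intro tendsto_intros)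
    moreover have "(\<lambda>n. d + 1 / Suc n) \<longlonglongrightarrow> d + 0"
      by (intro tendsto_intros LIMSEQ_Suc[OF lim_1_over_n])
    ultimately have "norm (x - m) \<le> d + 0"
      using f by (intro LIMSEQ_le[of _ _ "\<lambda>n. d + 1 / Suc n"]) (auto intro: less_imp_le)
    then show ?thesis using dle[OF that] by simp
  qed
  ultimately show ?thesis by blast
qed

lemma ex_orthogonal_decomposition:
  fixes M :: "'a::chilbert_space set"
  assumes M: "csubspace M" and cl: "closed M"
  shows "\<exists>m\<in>M. \<forall>y\<in>M. cinner (x - m) y = 0"
proof -
  obtain m where m: "m \<in> M" "\<And>y. y \<in> M \<Longrightarrow> norm (x - m) \<le> norm (x - y)"
    using ex_nearest_point[OF assms] by blast
  have "cinner (x - m) y = 0" if y: "y \<in> M" for y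
  proof (rule orthogonal_if_norm_minimal)
    fix c
    have "m + c *\<^sub>C y \<in> M" using m(1) y by (intro csubspaceD[OF M])
    then show "norm (x - m) \<le> norm (x - m - c *\<^sub>C y)" using m(2)[of "m + c *\<^sub>C y"] by (simp add: algebra_simps)
  qed
  with m(1) show ?thesis by blast
qed

lemma ex_projection:
  fixes M :: "'a::chilbert_space set"
  assumes M: "csubspace M" and cl: "closed M"
  obtains P where "P \<in> projections" "range (blinfun_apply P) = M" "\<And>x. x \<in> M \<Longrightarrow> P x = x"
    "\<And>x. P x \<in> M" "\<And>x y. y \<in> M \<Longrightarrow> cinner (x - P x) y = 0"
proof -
  obtain p where pM: "\<And>x. p x \<in> M" and p: "\<And>x y. y \<in> M \<Longrightarrow> cinner (x - p x) y = 0"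
    using ex_orthogonal_decomposition[OF assms] by metis
  \<comment> \<open>Orthogonality of x - m to M determines m in M, so linearity of \<open>p\<close>
    amounts to checking this condition for the candidate values.\<close>
  have uniq: "p x = m" if "m \<in> M" "\<And>y. y \<in> M \<Longrightarrow> cinner (x - m) y = 0" for x m
  proof -
    have "p x - m \<in> M" using pM that by (intro csubspaceD(4)[OF M])
    moreover have "cinner (p x - m) z = cinner (x - m) z - cinner (x - p x) z" for z
      by (simp add: cinner_simps)
    ultimately have "cinner (p x - m) (p x - m) = 0"
      using p[of "p x - m" x] that(2)[of "p x - m"] by simp
    then show ?thesis by simp
  qed
  have add: "p (x + y) = p x + p y" for x y
  proof (rule uniq)
    fix z assume "z \<in> M"
    then show "cinner (x + y - (p x + p y)) z = 0"
      using p[of z x] p[of z y] by (simp add: cinner_simps algebra_simps)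
  qed (use pM in \<open>intro csubspaceD[OF M]\<close>)
  have scale: "p (c *\<^sub>C x) = c *\<^sub>C p x" for c x
  proof (rule uniq)
    fix z assume "z \<in> M"
    then show "cinner (c *\<^sub>C x - c *\<^sub>C p x) z = 0"
      using p[of z x] by (simp add: cinner_simps)
  qed (use pM in \<open>intro csubspaceD[OF M]\<close>)
  have bnd: "norm (p x) \<le> 1 * norm x" for x
  proof -
    have "(norm x)\<^sup>2 = (norm ((x - p x) + p x))\<^sup>2" by simp
    also have "\<dots> = (norm (x - p x))\<^sup>2 + (norm (p x))\<^sup>2"
      by (subst norm_add_square) (simp add: p[OF pM])
    finally have "(norm (p x))\<^sup>2 \<le> (norm x)\<^sup>2" by simp
    then have "norm (p x) \<le> norm x" by (rule power2_le_imp_le) simp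
    then show ?thesis by simp
  qed
  obtain P where P: "P \<in> bounded_ops" "\<And>x. blinfun_apply P x = p x"
    using ex_bounded_op[OF add scale bnd] by blast
  have id: "p x = x" if "x \<in> M" for x using that by (intro uniq) auto
  have "cinner (p x) y = cinner x (p y)" for x y
  proof -
    have "cinner (p x) (p y) = cinner x (p y)" using p[of "p y" x] pM by (simp add: cinner_simps)
    moreover have "cinner (p x) y = cinner (p x) (p y)"
      using p[of "p x" y] pM cinner_eq_0_commute[of "y - p y" "p x"] by (simp add: cinner_simps)
    ultimately show ?thesis by simp
  qed
  then have "P \<in> projections"
    unfolding projections_def is_adjoint_def using P pM id
    by (auto intro!: blinfun_eqI simp: op_apply)
  moreover have "range (blinfun_apply P) = M"
  proof
    show "range (blinfun_apply P) \<subseteq> M" using P(2) pM by auto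
    show "M \<subseteq> range (blinfun_apply P)" using P(2) id by (metis rangeI subsetI)
  qed
  ultimately show thesis using P id pM p by (intro that[of P]) simp_all
qed

lemma Riesz_representation:
  fixes f :: "'a::chilbert_space \<Rightarrow> complex"
  assumes add: "\<And>x y. f (x + y) = f x + f y" and scale: "\<And>c x. f (c *\<^sub>C x) = c * f x"
    and bound: "\<And>x. cmod (f x) \<le> K * norm x"
  obtains z where "\<And>x. f x = cinner x z"
proof (cases "\<forall>x. f x = 0")
  case True
  then show ?thesis using that[of 0] by simp
next
  case False
  then obtain x0 where x0: "f x0 \<noteq> 0" by blast
  have "bounded_linear f"
    using add scale bound
    by (intro bounded_linear_intro[where K = K]) (auto simp: scaleR_scaleC mult.commute scaleR_conv_of_real)
  then have "continuous_on UNIV f" by (rule linear_continuous_on)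
  then have "closed {x. f x = 0}" by (intro closed_Collect_eq continuous_on_const)
  moreover have f0: "f 0 = 0" using scale[of 0 0] by simp
  have "csubspace {x. f x = 0}" by (rule csubspaceI) (auto simp: add scale f0)
  ultimately obtain m where m: "f m = 0" "\<And>y. f y = 0 \<Longrightarrow> cinner (x0 - m) y = 0"
    using ex_orthogonal_decomposition[of "{x. f x = 0}" x0] by auto
  define e where "e = x0 - m"
  have fe: "f e = f x0"
    using add[of e m] m(1) by (simp add: e_def)
  then have e0: "e \<noteq> 0" using x0 f0 by auto
  show ?thesis
  proof (rule that[of "(cnj (f e) / complex_of_real ((norm e)\<^sup>2)) *\<^sub>C e"])
    fix x
    define y where "y = x + (- (f x / f e)) *\<^sub>C e"
    have "f y = 0" unfolding y_def add scale using fe x0 by simp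
    then have "cinner e y = 0" using m(2) unfolding e_def by simp
    then have "cinner y e = 0" by (simp add: cinner_eq_0_commute)
    then have "cinner x e = (f x / f e) * complex_of_real ((norm e)\<^sup>2)"
      unfolding y_def by (simp add: cinner_simps cinner_self del: of_real_power)
    then show "f x = cinner x ((cnj (f e) / complex_of_real ((norm e)\<^sup>2)) *\<^sub>C e)"
      using e0 fe x0 by (simp add: cinner_scaleC_right)
  qed
qed

lemma ex_adjoint:
  fixes T :: "'a::chilbert_space \<Rightarrow>\<^sub>L 'b::complex_inner"
  assumes T: "T \<in> bounded_ops"
  obtains S where "S \<in> bounded_ops" "is_adjoint T S"
proof -
  have "\<exists>z. \<forall>x. cinner (T x) y = cinner x z" for y
  proof -
    have "cmod (cinner (T x) y) \<le> (norm T * norm y) * norm x" for x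
    proof -
      have "cmod (cinner (T x) y) \<le> norm (T x) * norm y" by (rule Cauchy_Schwarz_cinner)
      also have "\<dots> \<le> (norm T * norm x) * norm y" by (intro mult_right_mono norm_blinfun) auto
      finally show ?thesis by (simp add: mult_ac)
    qed
    then obtain z where "\<And>x. cinner (T x) y = cinner x z"
      using Riesz_representation[of "\<lambda>x. cinner (T x) y" "norm T * norm y"]
      by (auto simp: op_apply cinner_simps bounded_ops_scaleC[OF T])
    then show ?thesis by blast
  qed
  then obtain s where s: "\<And>x y. cinner (T x) y = cinner x (s y)" by metis
  have s': "cinner (s y) x = cinner y (T x)" for x y by (metis s cinner_commute)
  have bnd: "norm (s y) \<le> norm T * norm y" for y
  proof (cases "s y = 0")
    case False
    have "(norm (s y))\<^sup>2 = cmod (cinner (s y) (s y))" by (simp add: cinner_self norm_power)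
    also have "\<dots> = cmod (cinner (T (s y)) y)" by (simp add: s)
    also have "\<dots> \<le> norm (T (s y)) * norm y" by (rule Cauchy_Schwarz_cinner)
    also have "\<dots> \<le> (norm T * norm (s y)) * norm y" by (intro mult_right_mono norm_blinfun) auto
    finally show ?thesis using False by (simp add: power2_eq_square mult_ac)
  qed simp
  have add: "s (x + y) = s x + s y" and scale: "s (c *\<^sub>C x) = c *\<^sub>C s x" for x y c
    by (rule cinner_ext, simp add: s' cinner_simps)+
  obtain S where "S \<in> bounded_ops" "\<And>x. blinfun_apply S x = s x"
    using ex_bounded_op[OF add scale bnd] by blast
  then show thesis using that[of S] s by (simp add: is_adjoint_def)
qed

lemma is_adjoint_commute: "is_adjoint T S \<longleftrightarrow> is_adjoint S T"
  unfolding is_adjoint_def by (metis cinner_commute)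

lemma is_adjointD: "is_adjoint T S \<Longrightarrow> cinner (T x) y = cinner x (S y)"
    "is_adjoint T S \<Longrightarrow> cinner (S y) x = cinner y (T x)"
  by (meson is_adjoint_def is_adjoint_commute)+

lemma is_adjoint_unique: "is_adjoint T S \<Longrightarrow> is_adjoint T S' \<Longrightarrow> S = S'"
  by (rule blinfun_eqI, rule cinner_ext) (metis is_adjointD(2))

text \<open>An adjoint forces complex linearity, because T(cx) and c T x have the same inner
  products with all vectors.\<close>

lemma is_adjoint_bounded_ops:
  assumes "is_adjoint T S" shows "T \<in> bounded_ops" "S \<in> bounded_ops"
proof -
  show "T \<in> bounded_ops" by (rule bounded_opsI, rule cinner_ext)
      (simp add: is_adjointD[OF assms] cinner_simps)
  show "S \<in> bounded_ops" by (rule bounded_opsI, rule cinner_ext)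
      (simp add: is_adjointD[OF assms] cinner_simps)
qed

lemma is_adjoint_compose: "is_adjoint T S \<Longrightarrow> is_adjoint T' S' \<Longrightarrow> is_adjoint (T o\<^sub>L T') (S' o\<^sub>L S)"
  and is_adjoint_add: "is_adjoint A B \<Longrightarrow> is_adjoint A' B' \<Longrightarrow> is_adjoint (A + A') (B + B')"
  and is_adjoint_diff: "is_adjoint A B \<Longrightarrow> is_adjoint A' B' \<Longrightarrow> is_adjoint (A - A') (B - B')"
  and is_adjoint_scaleC: "is_adjoint A B \<Longrightarrow> is_adjoint (c *\<^sub>C A) (cnj c *\<^sub>C B)"
  and is_adjoint_scaleR: "is_adjoint A B \<Longrightarrow> is_adjoint (r *\<^sub>R A) (r *\<^sub>R B)"
  and is_adjoint_id: "is_adjoint id_blinfun id_blinfun"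
  and is_adjoint_0: "is_adjoint 0 0"
  by (auto simp: is_adjoint_def op_apply cinner_simps scaleR_scaleC)

lemma is_adjoint_selfI:
  assumes T: "T \<in> bounded_ops" and real: "\<And>x. Im (cinner (T x) x) = 0"
  shows "is_adjoint T T"
  unfolding is_adjoint_def
proof (intro allI)
  fix x y
  define F where "F = (\<lambda>x y. cinner (T x) y - cinner x (T y))"
  have "F x y = 0"
  proof (rule polarization[of F])
    fix x
    have "cinner x (T x) = cnj (cinner (T x) x)" by (rule cinner_commute)
    then show "F x x = 0" using real[of x] by (simp add: F_def complex_eq_iff)
  qed (auto simp: F_def op_apply cinner_simps bounded_ops_scaleC[OF T] algebra_simps)
  then show "cinner (T x) y = cinner x (T y)" by (simp add: F_def)
qed

text \<open>Most later arguments control self-adjoint operators only. The formulas for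
  \<open>h\<close> and \<open>k\<close> are exported so that membership in a complex subspace
  containing T and S can be read off.\<close>

lemma selfadjoint_parts:
  fixes T S :: "'a::complex_inner \<Rightarrow>\<^sub>L 'a"
  assumes "is_adjoint T S"
  obtains h k where "is_adjoint h h" "is_adjoint k k" "T = h + \<i> *\<^sub>C k" "S = h - \<i> *\<^sub>C k"
    "h = (1/2) *\<^sub>C (T + S)" "k = (- \<i> / 2) *\<^sub>C (T - S)"
proof -
  define h where "h = (1/2) *\<^sub>C (T + S)"
  define k where "k = (- \<i> / 2) *\<^sub>C (T - S)"
  have "is_adjoint h (cnj (1/2) *\<^sub>C (S + T))" unfolding h_def
    using assms is_adjoint_commute by (intro is_adjoint_scaleC is_adjoint_add) blast+
  then have h: "is_adjoint h h" by (simp add: h_def add.commute)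
  have "is_adjoint k (cnj (- \<i> / 2) *\<^sub>C (S - T))" unfolding k_def
    using assms is_adjoint_commute by (intro is_adjoint_scaleC is_adjoint_diff) blast+
  then have k: "is_adjoint k k" by (simp add: k_def scaleC_diff_right scaleC_minus_left)
  have "h + \<i> *\<^sub>C k = T"
    by (simp add: h_def k_def scaleC_scaleC scaleC_diff_right scaleC_add_right)
      (simp flip: scaleC_add_left)
  moreover have "h - \<i> *\<^sub>C k = S"
    by (simp add: h_def k_def scaleC_scaleC scaleC_diff_right scaleC_add_right)
      (simp flip: scaleC_add_left)
  ultimately show thesis using that[OF h k] h_def k_def by metis
qed

lemma projectionsD:
  assumes "P \<in> projections"
  shows "P \<in> bounded_ops" "P o\<^sub>L P = P" "is_adjoint P P" "P (P x) = P x"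
  using assms unfolding projections_def by (auto simp flip: blinfun_apply_blinfun_compose)

lemma projectionsI: "P o\<^sub>L P = P \<Longrightarrow> is_adjoint P P \<Longrightarrow> P \<in> projections"
  unfolding projections_def using is_adjoint_bounded_ops by auto

lemma projections_complement:
  assumes "P \<in> projections" shows "id_blinfun - P \<in> projections"
  using projectionsD[OF assms]
  by (intro projectionsI is_adjoint_diff is_adjoint_id) (auto simp: compose_diff compose_id)

lemma norm_projection: assumes P: "P \<in> projections" shows "norm (P x) \<le> norm x"
proof -
  have "cinner (P x) (x - P x) = 0"
    using is_adjointD(1)[OF projectionsD(3)[OF P], of x "x - P x"]
    by (simp add: op_apply projectionsD[OF P])
  then have "(norm (P x + (x - P x)))\<^sup>2 = (norm (P x))\<^sup>2 + (norm (x - P x))\<^sup>2"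
    by (subst norm_add_square) simp
  then have "(norm (P x))\<^sup>2 \<le> (norm x)\<^sup>2" by simp
  then show ?thesis by (rule power2_le_imp_le) simp
qed

text \<open>Extension by continuity from a dense domain, phrased for a linear relation: the bound
  makes the relation single-valued and survives closure, so no map on the domain has to be shown
  well defined beforehand.\<close>

lemma ex_bounded_op_graph:
  fixes G :: "('a::{complex_normed_vector, complete_space} \<times> 'b::{complex_normed_vector, complete_space}) set"
  assumes G: "csubspace G" and bound: "\<And>u v. (u, v) \<in> G \<Longrightarrow> norm v \<le> C * norm u"
    and dense: "closure (fst ` G) = UNIV"
  obtains R where "R \<in> bounded_ops" "\<And>u v. (u, v) \<in> G \<Longrightarrow> blinfun_apply R u = v"
proof -
  let ?H = "closure G"
  have H: "csubspace ?H" by (rule csubspace_closure[OF G])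
  have bH: "norm v \<le> C * norm u" if "(u, v) \<in> ?H" for u v
  proof -
    have "closed {p :: 'a \<times> 'b. norm (snd p) \<le> C * norm (fst p)}"
      by (intro closed_Collect_le continuous_intros)
    then have "?H \<subseteq> {p. norm (snd p) \<le> C * norm (fst p)}"
      using bound by (intro closure_minimal) auto
    then show ?thesis using that by auto
  qed
  have ex: "\<exists>v. (u, v) \<in> ?H" for u
  proof -
    have "u \<in> closure (fst ` G)" using dense by simp
    then obtain f where f: "\<And>n. f n \<in> fst ` G" and lim: "f \<longlonglongrightarrow> u"
      unfolding closure_sequential by metis
    then have "\<forall>n. \<exists>v. (f n, v) \<in> G" by (metis imageE prod.collapse)
    then obtain g where g: "\<And>n. (f n, g n) \<in> G" by metis
    have cau: "Cauchy f" using lim by (rule LIMSEQ_imp_Cauchy)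
    have "Cauchy g"
    proof (rule metric_CauchyI)
      fix e :: real assume "0 < e"
      \<comment> \<open>\<open>C\<close> carries no sign, hence |C| + 1 as a positive Lipschitz
        constant.\<close>
      then have "0 < e / (\<bar>C\<bar> + 1)" by (simp add: add_nonneg_pos)
      then obtain N where N: "\<And>m n. m \<ge> N \<Longrightarrow> n \<ge> N \<Longrightarrow> dist (f m) (f n) < e / (\<bar>C\<bar> + 1)"
        using metric_CauchyD[OF cau] by blast
      have "dist (g m) (g n) < e" if "m \<ge> N" "n \<ge> N" for m n
      proof -
        have "(f m - f n, g m - g n) \<in> G" using csubspaceD(4)[OF G g[of m] g[of n]] by simp
        then have "norm (g m - g n) \<le> C * norm (f m - f n)" by (rule bound)
        also have "\<dots> \<le> (\<bar>C\<bar> + 1) * norm (f m - f n)" by (intro mult_right_mono) auto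
        also have "\<dots> < e" using N[OF that] by (simp add: dist_norm field_simps add_nonneg_pos)
        finally show ?thesis by (simp add: dist_norm)
      qed
      then show "\<exists>N. \<forall>m\<ge>N. \<forall>n\<ge>N. dist (g m) (g n) < e" by blast
    qed
    then obtain v where "g \<longlonglongrightarrow> v" by (metis Cauchy_convergent_iff convergent_def)
    then have "(\<lambda>n. (f n, g n)) \<longlonglongrightarrow> (u, v)" using lim by (intro tendsto_Pair)
    then show ?thesis using g unfolding closure_sequential
      by (intro exI[of _ v] exI[of _ "\<lambda>n. (f n, g n)"]) auto
  qed
  then obtain r where r: "\<And>u. (u, r u) \<in> ?H" by metis
  have uniq: "r u = v" if "(u, v) \<in> ?H" for u v
    using bH[of 0 "r u - v"] csubspaceD(4)[OF H r[of u] that] by simp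
  obtain R where "R \<in> bounded_ops" "\<And>x. blinfun_apply R x = r x"
  proof (rule ex_bounded_op[of r C])
    show "r (x + y) = r x + r y" for x y
      using csubspaceD(2)[OF H r[of x] r[of y]] by (intro uniq) simp
    show "r (c *\<^sub>C x) = c *\<^sub>C r x" for c x
      using csubspaceD(3)[OF H r[of x], of c] by (intro uniq) (simp add: scaleC_prod)
  qed (use bH r in auto)
  then show thesis using that[of R] uniq closure_subset by (metis subsetD)
qed

section \<open>Square roots\<close>

instance chilbert_space \<subseteq> banach ..

text \<open>Positivity at the vector x - bx gives ||bx||^2 \<le> <bx,x>, and then ||x - bx||^2 =
  ||x||^2 - 2<bx,x> + ||bx||^2 \<le> ||x||^2.\<close>

lemma norm_id_minus_le_1:
  fixes b :: "'a::complex_inner \<Rightarrow>\<^sub>L 'a"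
  assumes b: "is_adjoint b b" and pos: "\<And>x. 0 \<le> Re (cinner (b x) x)" and le: "norm b \<le> 1"
  shows "norm (id_blinfun - b) \<le> 1"
proof (rule norm_blinfun_bound)
  fix x
  have "0 \<le> Re (cinner (b (x - b x)) (x - b x))" by (rule pos)
  also have "\<dots> = Re (cinner (b x) x) - 2 * (norm (b x))\<^sup>2 + Re (cinner (b (b x)) (b x))"
    using is_adjointD(1)[OF b, of "b x" x]
    by (simp add: op_apply cinner_simps cinner_self)
  also have "Re (cinner (b (b x)) (b x)) \<le> norm (b (b x)) * norm (b x)"
    using Cauchy_Schwarz_cinner[of "b (b x)" "b x"] complex_Re_le_cmod order_trans by blast
  also have "\<dots> \<le> (1 * norm (b x)) * norm (b x)"
    using norm_blinfun[of b "b x"] mult_right_mono[OF le norm_ge_zero[of "b x"]]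
    by (intro mult_right_mono) auto
  finally have "(norm (b x))\<^sup>2 \<le> Re (cinner (b x) x)" by (simp add: power2_eq_square)
  moreover have "Re (cinner x (b x)) = Re (cinner (b x) x)"
    using cinner_commute[of x "b x"] by simp
  moreover have "0 \<le> (norm (b x))\<^sup>2" by simp
  ultimately have "(norm (x - b x))\<^sup>2 \<le> (norm x)\<^sup>2"
    unfolding norm_diff_square by linarith
  then have "norm (x - b x) \<le> norm x" by (rule power2_le_imp_le) simp
  then show "norm ((id_blinfun - b) x) \<le> 1 * norm x" by (simp add: op_apply)
qed simp

text \<open>A fixed point of y \<mapsto> (a + y^2)/2 satisfies (1 - y)^2 = 1 - a. The iteration from
  0 is dominated, increment by increment, by the scalar iteration s \<mapsto> (1 + s^2)/2, which
  increases and stays below 1. All iterates are polynomials in a, so whatever commutes with a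
  commutes with the limit.\<close>

lemma ex_sqrt_id_minus:
  fixes a :: "'a::chilbert_space \<Rightarrow>\<^sub>L 'a"
  assumes a: "is_adjoint a a" and le: "norm a \<le> 1"
  obtains y where "is_adjoint y y" "norm y \<le> 1" "(id_blinfun - y) o\<^sub>L (id_blinfun - y) = id_blinfun - a"
    "\<And>b. b o\<^sub>L a = a o\<^sub>L b \<Longrightarrow> b o\<^sub>L y = y o\<^sub>L b"
proof -
  define f where "f = (\<lambda>y. (1/2) *\<^sub>R (a + (y o\<^sub>L y)))"
  define y where "y n = (f ^^ n) 0" for n
  define s where "s n = ((\<lambda>t::real. (1/2) * (1 + t * t)) ^^ n) 0" for n
  have y: "y 0 = 0" "y (Suc n) = (1/2) *\<^sub>R (a + (y n o\<^sub>L y n))" for n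
    by (auto simp: y_def f_def)
  have s: "s 0 = 0" "s (Suc n) = (1/2) * (1 + s n * s n)" for n
    by (auto simp: s_def)
  have s01: "0 \<le> s n \<and> s n \<le> 1" for n
  proof (induction n)
    case (Suc n)
    then have "s n * s n \<le> 1" "0 \<le> s n * s n" by (auto intro: mult_le_one)
    then show ?case by (simp add: s)
  qed (simp add: s)
  have sinc: "s n \<le> s (Suc n)" for n
  proof -
    have "0 \<le> (1 - s n) * (1 - s n)" by simp
    then show ?thesis by (simp add: s algebra_simps)
  qed
  have ny: "norm (y n) \<le> s n" for n
  proof (induction n)
    case (Suc n)
    have "norm (a + (y n o\<^sub>L y n)) \<le> norm a + norm (y n o\<^sub>L y n)" by (rule norm_triangle_ineq)
    also have "norm (y n o\<^sub>L y n) \<le> norm (y n) * norm (y n)" by (rule norm_blinfun_compose)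
    also have "\<dots> \<le> s n * s n" using Suc s01[of n] by (intro mult_mono) auto
    finally show ?case using le by (simp add: y s)
  qed (simp add: y s)
  have step: "norm (y (Suc n) - y n) \<le> s (Suc n) - s n" for n
  proof (induction n)
    case 0
    show ?case using le by (simp add: y s compose_zero)
  next
    case (Suc n)
    let ?d = "y (Suc n) - y n"
    have "y (Suc (Suc n)) - y (Suc n) = (1/2) *\<^sub>R ((y (Suc n) o\<^sub>L y (Suc n)) - (y n o\<^sub>L y n))"
      by (simp only: y(2)[of "Suc n"] y(2)[of n] flip: scaleR_diff_right) simp
    also have "(y (Suc n) o\<^sub>L y (Suc n)) - (y n o\<^sub>L y n) = (y (Suc n) o\<^sub>L ?d) + (?d o\<^sub>L y n)"
      by (simp only: compose_diff) simp
    finally have "norm (y (Suc (Suc n)) - y (Suc n)) = (1/2) * norm ((y (Suc n) o\<^sub>L ?d) + (?d o\<^sub>L y n))"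
      by simp
    also have "norm ((y (Suc n) o\<^sub>L ?d) + (?d o\<^sub>L y n))
        \<le> norm (y (Suc n)) * norm ?d + norm ?d * norm (y n)"
      by (intro order_trans[OF norm_triangle_ineq] add_mono norm_blinfun_compose)
    also have "\<dots> \<le> s (Suc n) * (s (Suc n) - s n) + (s (Suc n) - s n) * s n"
      using Suc ny s01 sinc[of n] by (intro add_mono mult_mono) auto
    finally show ?case by (simp add: s(2)[of "Suc n"] algebra_simps) (simp add: s(2)[of n] algebra_simps)
  qed
  have dist: "norm (y (n + k) - y n) \<le> s (n + k) - s n" for n k
  proof (induction k)
    case (Suc k)
    have "norm (y (n + Suc k) - y n) \<le> norm (y (Suc (n + k)) - y (n + k)) + norm (y (n + k) - y n)"
      using norm_triangle_ineq[of "y (Suc (n + k)) - y (n + k)" "y (n + k) - y n"] by simp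
    then show ?case using step[of "n + k"] Suc by simp
  qed simp
  have "incseq s" using sinc by (rule incseq_SucI)
  then have "convergent s" using s01 by (metis incseq_convergent convergentI)
  then have cs: "Cauchy s" by (rule convergent_Cauchy)
  have "Cauchy y"
  proof (rule CauchyI')
    fix e :: real assume "0 < e"
    then obtain N where N: "\<And>m n. m \<ge> N \<Longrightarrow> n \<ge> N \<Longrightarrow> dist (s m) (s n) < e"
      using metric_CauchyD[OF cs] by blast
    have "norm (y m - y n) < e" if mn: "N \<le> m" "m < n" for m n
    proof -
      obtain k where "n = m + k" using mn(2) by (metis less_imp_add_positive)
      then show ?thesis
        using N[of n m] mn dist[of m k] by (simp add: dist_real_def norm_minus_commute)
    qed
    then show "\<exists>M. \<forall>m\<ge>M. \<forall>n>m. dist (y m) (y n) < e" by (auto simp: dist_norm)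
  qed
  then obtain z where z: "y \<longlonglongrightarrow> z" by (metis Cauchy_convergent_iff convergent_def)
  have comm: "b o\<^sub>L y n = y n o\<^sub>L b" if b: "b o\<^sub>L a = a o\<^sub>L b" for b n
  proof (induction n)
    case (Suc n)
    have "b o\<^sub>L (y n o\<^sub>L y n) = (y n o\<^sub>L y n) o\<^sub>L b"
      by (metis Suc compose_assoc)
    then show ?case using b by (simp add: y compose_add compose_scaleR)
  qed (simp add: y compose_zero)
  have adj: "is_adjoint (y n) (y n)" for n
    by (induction n) (auto simp: y is_adjoint_0 intro!: is_adjoint_scaleR is_adjoint_add a is_adjoint_compose)
  note tc = bounded_bilinear.tendsto[OF bounded_bilinear_blinfun_compose]
  have "(\<lambda>n. y (Suc n)) \<longlonglongrightarrow> (1/2) *\<^sub>R (a + (z o\<^sub>L z))"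
    unfolding y by (intro tendsto_intros tc z)
  then have "z = (1/2) *\<^sub>R (a + (z o\<^sub>L z))" using LIMSEQ_Suc[OF z] LIMSEQ_unique by blast
  then have "2 *\<^sub>R z = 2 *\<^sub>R ((1/2) *\<^sub>R (a + (z o\<^sub>L z)))" by (rule arg_cong)
  then have "2 *\<^sub>R z = a + (z o\<^sub>L z)" by simp
  then have zz: "z o\<^sub>L z = z + z - a" by (simp add: scaleR_2 algebra_simps)
  show thesis
  proof (rule that[of z])
    show "(id_blinfun - z) o\<^sub>L (id_blinfun - z) = id_blinfun - a"
      by (simp only: compose_diff compose_id zz) simp
    show "b o\<^sub>L z = z o\<^sub>L b" if "b o\<^sub>L a = a o\<^sub>L b" for b
    proof -
      have "(\<lambda>n. b o\<^sub>L y n) \<longlonglongrightarrow> (b o\<^sub>L z)" "(\<lambda>n. y n o\<^sub>L b) \<longlonglongrightarrow> (z o\<^sub>L b)"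
        by (intro tc z tendsto_const)+
      then show ?thesis using comm[OF that] LIMSEQ_unique by force
    qed
    have "(\<lambda>n. norm (y n)) \<longlonglongrightarrow> norm z" by (intro tendsto_intros z)
    then show "norm z \<le> 1" using ny s01 by (intro LIMSEQ_le_const2) (auto intro: order_trans)
    show "is_adjoint z z"
      unfolding is_adjoint_def
    proof (intro allI)
      fix u v
      have "(\<lambda>n. cinner (y n u) v) \<longlonglongrightarrow> cinner (z u) v" "(\<lambda>n. cinner u (y n v)) \<longlonglongrightarrow> cinner u (z v)"
        by (intro tendsto_intros z)+
      then show "cinner (z u) v = cinner u (z v)"
        using is_adjointD(1)[OF adj] LIMSEQ_unique by force
    qed
  qed
qed

lemma ex_sqrt:
  fixes h :: "'a::chilbert_space \<Rightarrow>\<^sub>L 'a"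
  assumes h: "is_adjoint h h" and pos: "\<And>x. 0 \<le> Re (cinner (h x) x)"
  obtains k where "is_adjoint k k" "k o\<^sub>L k = h" "\<And>x. 0 \<le> Re (cinner (k x) x)"
    "\<And>b. b o\<^sub>L h = h o\<^sub>L b \<Longrightarrow> b o\<^sub>L k = k o\<^sub>L b"
proof -
  \<comment> \<open>Dividing by c makes h a positive contraction, and the summand 1 covers h = 0.
    Then 1 - h/c has norm at most 1, and its fixed point y gives the root sqrt(c)(1 - y), positive
    because ||y|| \<le> 1.\<close>
  define c where "c = norm h + 1"
  define b where "b = (1 / c) *\<^sub>R h"
  have c: "0 < c" by (simp add: c_def add_nonneg_pos)
  have b: "is_adjoint b b" unfolding b_def by (intro is_adjoint_scaleR h)
  have bpos: "0 \<le> Re (cinner (b x) x)" for x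
    using pos[of x] c by (simp add: b_def op_apply scaleR_scaleC cinner_simps)
  have "norm b \<le> 1" using c by (simp add: b_def c_def field_simps)
  then have "norm (id_blinfun - b) \<le> 1" using b bpos by (intro norm_id_minus_le_1)
  then obtain y where y: "is_adjoint y y" "norm y \<le> 1"
    "(id_blinfun - y) o\<^sub>L (id_blinfun - y) = id_blinfun - (id_blinfun - b)"
    "\<And>e. e o\<^sub>L (id_blinfun - b) = (id_blinfun - b) o\<^sub>L e \<Longrightarrow> e o\<^sub>L y = y o\<^sub>L e"
    using ex_sqrt_id_minus[of "id_blinfun - b"] b is_adjoint_diff[OF is_adjoint_id] by metis
  define k where "k = sqrt c *\<^sub>R (id_blinfun - y)"
  show thesis
  proof (rule that[of k])
    show "is_adjoint k k" unfolding k_def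
      by (intro is_adjoint_scaleR is_adjoint_diff is_adjoint_id y)
    have "k o\<^sub>L k = (sqrt c * sqrt c) *\<^sub>R ((id_blinfun - y) o\<^sub>L (id_blinfun - y))"
      by (simp only: k_def compose_scaleR scaleR_scaleR)
    also have "\<dots> = h" using c by (simp add: y(3) b_def)
    finally show "k o\<^sub>L k = h" .
    fix x
    have "Re (cinner (y x) x) \<le> norm (y x) * norm x"
      using Cauchy_Schwarz_cinner complex_Re_le_cmod order_trans by blast
    also have "\<dots> \<le> (norm y * norm x) * norm x" by (intro mult_right_mono norm_blinfun) auto
    also have "\<dots> \<le> (1 * norm x) * norm x" using y(2) by (intro mult_right_mono) auto
    finally show "0 \<le> Re (cinner (k x) x)" using c
      by (simp add: k_def op_apply scaleR_scaleC cinner_simps cinner_self power2_eq_square)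
  next
    fix e assume "e o\<^sub>L h = h o\<^sub>L e"
    then have "e o\<^sub>L (id_blinfun - b) = (id_blinfun - b) o\<^sub>L e"
      by (simp add: b_def compose_diff compose_id compose_scaleR)
    then show "e o\<^sub>L k = k o\<^sub>L e"
      using y(4) by (simp add: k_def compose_diff compose_id compose_scaleR)
  qed
qed


section \<open>Maximal abelian algebras\<close>

text \<open>The working form of maximality: an operator enters D by commuting with D.\<close>

definition max_abelian :: "('a::chilbert_space \<Rightarrow>\<^sub>L 'a) set \<Rightarrow> bool" where
  "max_abelian D \<longleftrightarrow> commutant D = D \<and> (\<forall>T\<in>D. \<exists>S\<in>D. is_adjoint T S)"

lemma commutantD: "T \<in> commutant S \<Longrightarrow> T \<in> bounded_ops" "T \<in> commutant S \<Longrightarrow> A \<in> S \<Longrightarrow> T o\<^sub>L A = A o\<^sub>L T"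
  by (auto simp: commutant_def)

lemma commutant_antimono: "A \<subseteq> B \<Longrightarrow> commutant B \<subseteq> commutant A"
  by (auto simp: commutant_def)

lemma subset_commutant2: "A \<subseteq> bounded_ops \<Longrightarrow> A \<subseteq> commutant (commutant A)"
  by (auto simp: commutant_def)

lemma commutant_closed:
  assumes A: "A \<subseteq> bounded_ops"
  shows "0 \<in> commutant A" "id_blinfun \<in> commutant A"
    "S \<in> commutant A \<Longrightarrow> T \<in> commutant A \<Longrightarrow> S + T \<in> commutant A"
    "S \<in> commutant A \<Longrightarrow> T \<in> commutant A \<Longrightarrow> S - T \<in> commutant A"
    "S \<in> commutant A \<Longrightarrow> - S \<in> commutant A"
    "S \<in> commutant A \<Longrightarrow> c *\<^sub>C S \<in> commutant A"
    "S \<in> commutant A \<Longrightarrow> r *\<^sub>R S \<in> commutant A"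
    "S \<in> commutant A \<Longrightarrow> T \<in> commutant A \<Longrightarrow> S o\<^sub>L T \<in> commutant A"
proof -
  assume S: "S \<in> commutant A" and T: "T \<in> commutant A"
  show "S o\<^sub>L T \<in> commutant A" unfolding commutant_def
  proof (intro CollectI conjI ballI)
    fix B assume "B \<in> A"
    then show "(S o\<^sub>L T) o\<^sub>L B = B o\<^sub>L (S o\<^sub>L T)"
      using commutantD(2)[OF S] commutantD(2)[OF T] by (metis compose_assoc)
  qed (use S T in \<open>auto simp: commutant_def\<close>)
qed (use A in \<open>auto simp: commutant_def compose_add compose_diff compose_minus compose_scaleR
    compose_id compose_zero compose_scaleC compose_scaleC_right subset_eq\<close>)

lemma commutant_selfadjoint:
  assumes "\<And>T. T \<in> A \<Longrightarrow> \<exists>S\<in>A. is_adjoint T S" and "T \<in> commutant A" and "is_adjoint T S"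
  shows "S \<in> commutant A"
  unfolding commutant_def
proof (intro CollectI conjI ballI)
  show "S \<in> bounded_ops" using assms(3) is_adjoint_bounded_ops by blast
  fix B assume "B \<in> A"
  then obtain C where C: "C \<in> A" "is_adjoint B C" using assms(1) by blast
  have "is_adjoint (T o\<^sub>L C) (B o\<^sub>L S)" "is_adjoint (C o\<^sub>L T) (S o\<^sub>L B)"
    using C(2) assms(3) by (auto intro!: is_adjoint_compose simp: is_adjoint_commute[of C])
  then show "S o\<^sub>L B = B o\<^sub>L S"
    using commutantD(2)[OF assms(2) C(1)] is_adjoint_unique by metis
qed

text \<open>Taking commutants of A \<subseteq> A' gives A'' \<subseteq> A', so elements of A'',
  which commute with A', commute with one another. This supplies the competing algebras in the
  maximality argument.\<close>

lemma abelian_selfadjoint_commutant2: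
  fixes A :: "('a::chilbert_space \<Rightarrow>\<^sub>L 'a) set"
  assumes A: "A \<subseteq> commutant A" and adj: "\<And>T. T \<in> A \<Longrightarrow> \<exists>S\<in>A. is_adjoint T S"
  shows "abelian_selfadjoint_subalgebra (commutant (commutant A))"
proof -
  have Ab: "A \<subseteq> bounded_ops" "commutant A \<subseteq> bounded_ops" using A by (auto simp: commutant_def)
  have sub: "commutant (commutant A) \<subseteq> commutant A" using A by (rule commutant_antimono)
  have adj': "\<exists>S\<in>commutant B. is_adjoint T S"
    if "T \<in> commutant B" and "\<And>T. T \<in> B \<Longrightarrow> \<exists>S\<in>B. is_adjoint T S" for B and T :: "'a \<Rightarrow>\<^sub>L 'a"
    using that commutant_selfadjoint[of B] ex_adjoint[OF commutantD(1)[OF that(1)]] by metis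
  have "\<exists>S\<in>commutant (commutant A). is_adjoint T S" if "T \<in> commutant (commutant A)" for T
    using adj'[OF that] adj'[OF _ adj] by blast
  then show ?thesis
    unfolding abelian_selfadjoint_subalgebra_def
    using commutant_closed[OF Ab(2)] sub
    by (auto intro!: csubspaceI simp: subset_eq commutantD)
qed

text \<open>A self-adjoint h commuting with L commutes with M = L'', so adjoining h to M and taking
  the double commutant gives an abelian self-adjoint algebra. Maximality of M puts h into M. Real
  and imaginary parts then give L' = L''.\<close>

lemma multiplicity_free_max_abelian:
  assumes L: "CSL L" and mf: "multiplicity_free L"
  shows "max_abelian (commutant L)"
proof -
  let ?M = "commutant (commutant L)"
  have Lp: "L \<subseteq> projections" using L by (auto simp: CSL_def subspace_lattice_def)
  then have Lb: "L \<subseteq> bounded_ops" by (auto simp: projections_def)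
  have Lad: "\<exists>S\<in>L. is_adjoint T S" if "T \<in> L" for T
    using Lp that projectionsD(3) by blast
  have "L \<subseteq> commutant L" using L Lb by (auto simp: commutant_def CSL_def)
  then have M1: "?M \<subseteq> commutant L" by (rule commutant_antimono)
  have masa: "masa ?M" using mf by (simp add: multiplicity_free_def)
  have adj: "\<exists>S\<in>commutant L. is_adjoint T S" if "T \<in> commutant L" for T
    using that commutant_selfadjoint[OF Lad] ex_adjoint[OF commutantD(1)[OF that]] by metis
  have Mad: "\<exists>S\<in>?M. is_adjoint T S" if "T \<in> ?M" for T
    using masa that by (auto simp: masa_def abelian_selfadjoint_subalgebra_def)
  have self: "h \<in> ?M" if h: "h \<in> commutant L" "is_adjoint h h" for h
  proof -
    let ?A = "insert h ?M"
    have comm: "h o\<^sub>L m = m o\<^sub>L h" if "m \<in> ?M" for m using that h(1) commutantD(2) by metis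
    have "?A \<subseteq> commutant ?A"
    proof -
      have "h \<in> commutant ?A" using h comm by (auto simp: commutant_def[of ?A] commutantD)
      moreover have "m \<in> commutant ?A" if m: "m \<in> ?M" for m
        using comm[OF m] commutantD[OF m] M1 by (auto simp: commutant_def[of ?A])
      ultimately show ?thesis by blast
    qed
    moreover from this have "?A \<subseteq> commutant (commutant ?A)"
      by (intro subset_commutant2) (auto simp: commutant_def)
    moreover have "\<exists>S\<in>?A. is_adjoint T S" if "T \<in> ?A" for T using that h(2) Mad by blast
    ultimately have "commutant (commutant ?A) = ?M"
      using masa abelian_selfadjoint_commutant2[of ?A] unfolding masa_def by blast
    then show ?thesis using \<open>?A \<subseteq> commutant (commutant ?A)\<close> by blast
  qed
  have "commutant L \<subseteq> ?M"
  proof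
    fix T assume T: "T \<in> commutant L"
    then obtain S where S: "S \<in> commutant L" "is_adjoint T S" using adj by blast
    note cl = commutant_closed[OF Lb]
    obtain h k where hk: "is_adjoint h h" "is_adjoint k k" "T = h + \<i> *\<^sub>C k"
      "h = (1/2) *\<^sub>C (T + S)" "k = (- \<i> / 2) *\<^sub>C (T - S)" using selfadjoint_parts[OF S(2)] by metis
    have "h \<in> ?M" "k \<in> ?M"
      by (intro self hk, simp add: hk(4) T S(1) cl) (intro self hk, simp add: hk(5) T S(1) cl)
    moreover have "commutant L \<subseteq> bounded_ops" by (auto simp: commutant_def)
    note cl' = commutant_closed[OF this]
    ultimately show "T \<in> ?M" unfolding hk(3) using cl' by metis
  qed
  with M1 adj show ?thesis unfolding max_abelian_def by auto
qed

section \<open>Projections and square roots inside a maximal abelian algebra\<close>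

locale max_abelian_algebra =
  fixes D :: "('a::chilbert_space \<Rightarrow>\<^sub>L 'a) set"
  assumes max_abelian: "max_abelian D"
begin

lemma commutant_eq: "commutant D = D"
  using max_abelian by (simp add: max_abelian_def)

lemma bounded: "T \<in> D \<Longrightarrow> T \<in> bounded_ops"
  using commutantD(1) commutant_eq by blast

lemma subset_bounded: "D \<subseteq> bounded_ops"
  using bounded by blast

lemmas closed_under = commutant_closed[OF subset_bounded, unfolded commutant_eq]

lemma commute: "S \<in> D \<Longrightarrow> T \<in> D \<Longrightarrow> S o\<^sub>L T = T o\<^sub>L S"
  using commutantD(2)[of S D T] commutant_eq by simp

lemma memI: "T \<in> bounded_ops \<Longrightarrow> (\<And>d. d \<in> D \<Longrightarrow> T o\<^sub>L d = d o\<^sub>L T) \<Longrightarrow> T \<in> D"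
  using commutant_eq by (auto simp: commutant_def)

lemma ex_adj: assumes "T \<in> D" obtains S where "S \<in> D" "is_adjoint T S"
  using max_abelian assms unfolding max_abelian_def by blast

lemma commute_apply: "S \<in> D \<Longrightarrow> T \<in> D \<Longrightarrow> S (T x) = T (S x)"
  using commute by (metis blinfun_apply_blinfun_compose)

lemma sqrt_mem:
  assumes "h \<in> D" "is_adjoint h h" "\<And>x. 0 \<le> Re (cinner (h x) x)"
  obtains k where "k \<in> D" "is_adjoint k k" "k o\<^sub>L k = h" "\<And>x. 0 \<le> Re (cinner (k x) x)"
proof -
  obtain k where k: "is_adjoint k k" "k o\<^sub>L k = h" "\<And>x. 0 \<le> Re (cinner (k x) x)"
    "\<And>b. b o\<^sub>L h = h o\<^sub>L b \<Longrightarrow> b o\<^sub>L k = k o\<^sub>L b"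
    using ex_sqrt[OF assms(2,3)] by metis
  moreover have "k \<in> D"
  proof (rule memI)
    show "k \<in> bounded_ops" using k(1) is_adjoint_bounded_ops by blast
    show "k o\<^sub>L d = d o\<^sub>L k" if "d \<in> D" for d
      using k(4)[of d] commute[OF that assms(1)] by simp
  qed
  ultimately show thesis using that by blast
qed

text \<open>D is closed under adjoints, so invariance of the range under d and under its adjoint
  gives PdP = dP and PdP = Pd. Hence P commutes with D, and maximality puts it into D.\<close>

lemma invariant_projection:
  assumes P: "P \<in> projections" and inv: "\<And>d x. d \<in> D \<Longrightarrow> P x = x \<Longrightarrow> P (d x) = d x"
  shows "P \<in> D"
proof (rule memI)
  show "P \<in> bounded_ops" using P projectionsD by blast
  have PdP: "P o\<^sub>L (d o\<^sub>L P) = d o\<^sub>L P" if "d \<in> D" for d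
    using inv[OF that] by (auto intro!: blinfun_eqI simp: op_apply projectionsD(4)[OF P])
  fix d assume d: "d \<in> D"
  then obtain e where e: "e \<in> D" "is_adjoint d e" by (rule ex_adj)
  have "is_adjoint (P o\<^sub>L (e o\<^sub>L P)) ((P o\<^sub>L d) o\<^sub>L P)" "is_adjoint (e o\<^sub>L P) (P o\<^sub>L d)"
    using e(2) P by (auto intro!: is_adjoint_compose simp: projectionsD is_adjoint_commute[of e])
  then have "(P o\<^sub>L d) o\<^sub>L P = P o\<^sub>L d"
    using is_adjoint_unique PdP[OF e(1)] by metis
  then show "P o\<^sub>L d = d o\<^sub>L P" using PdP[OF d] by (simp add: compose_assoc)
qed

lemma ex_invariant_projection:
  assumes "csubspace M" "closed M" "\<And>d x. d \<in> D \<Longrightarrow> x \<in> M \<Longrightarrow> d x \<in> M"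
  obtains P where "P \<in> D" "P \<in> projections" "\<And>x. x \<in> M \<Longrightarrow> P x = x" "\<And>x. P x \<in> M"
    "\<And>x y. y \<in> M \<Longrightarrow> cinner (x - P x) y = 0"
proof -
  obtain P where P: "P \<in> projections" "\<And>x. x \<in> M \<Longrightarrow> P x = x" "\<And>x. P x \<in> M"
    "\<And>x y. y \<in> M \<Longrightarrow> cinner (x - P x) y = 0"
    using ex_projection[OF assms(1,2)] by metis
  moreover have "P \<in> D" by (rule invariant_projection[OF P(1)]) (metis P(2,3) assms(3))
  ultimately show thesis using that by blast
qed

text \<open>\<open>q\<close> projects onto the kernel of |g| + g, the part where g \<le> 0. The two
  signs are certified by squares of self-adjoint elements of D, because algebraic identities of this
  kind are preserved by an isomorphism about which no order property is known.\<close>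

lemma spectral_splitting:
  assumes g: "g \<in> D" "is_adjoint g g"
  obtains q k l where "q \<in> D" "q \<in> projections" "k \<in> D" "is_adjoint k k" "l \<in> D" "is_adjoint l l"
    "k o\<^sub>L k = g o\<^sub>L (id_blinfun - q)" "l o\<^sub>L l = - (g o\<^sub>L q)"
proof -
  have "0 \<le> Re (cinner ((g o\<^sub>L g) x) x)" for x
    using is_adjointD(1)[OF g(2), of "g x" x] by (simp add: op_apply cinner_self)
  then obtain m where m: "m \<in> D" "is_adjoint m m" "m o\<^sub>L m = g o\<^sub>L g" "\<And>x. 0 \<le> Re (cinner (m x) x)"
    using sqrt_mem[of "g o\<^sub>L g"] g closed_under is_adjoint_compose[OF g(2) g(2)] by metis
  let ?M = "{x. blinfun_apply (m + g) x = 0}"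
  have "closed ?M" by (intro closed_Collect_eq continuous_intros)
  moreover have mg: "m + g \<in> D" using m g closed_under by blast
  have "csubspace ?M"
    using bounded_ops_scaleC[OF bounded[OF mg]]
    by (intro csubspaceI) (auto simp: blinfun.add_right)
  moreover have "d x \<in> ?M" if "d \<in> D" "x \<in> ?M" for d x
    using commute_apply[OF mg that(1), of x] that(2) by (simp add: blinfun.zero_right)
  ultimately obtain q where q: "q \<in> D" "q \<in> projections" "\<And>x. x \<in> ?M \<Longrightarrow> q x = x" "\<And>x. q x \<in> ?M"
    using ex_invariant_projection[of ?M] by metis
  have gq: "g (q x) = - m (q x)" for x
    using q(4)[of x] by (simp add: op_apply eq_neg_iff_add_eq_0 add.commute)
  \<comment> \<open>(m + g)(m - g) = m^2 - g^2 = 0 places the range of m - g in the kernel, where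
    \<open>q\<close> is the identity.\<close>
  have mq: "q (m x - g x) = m x - g x" for x
  proof (rule q(3))
    have "m (m x) = g (g x)" using m(3) by (metis blinfun_apply_blinfun_compose)
    then show "m x - g x \<in> ?M"
      using commute_apply[OF m(1) g(1), of x] by (simp add: op_apply)
  qed
  have r: "id_blinfun - q \<in> D" "id_blinfun - q \<in> projections"
    using q closed_under projections_complement by auto
  have pos: "0 \<le> Re (cinner ((m o\<^sub>L r) x) x)" "is_adjoint (m o\<^sub>L r) (m o\<^sub>L r)"
    if "r \<in> D" "r \<in> projections" for r x
  proof -
    have "m o\<^sub>L r = r o\<^sub>L (m o\<^sub>L r)"
      using commute[OF m(1) that(1)] projectionsD(2)[OF that(2)] by (metis compose_assoc)
    then have "cinner ((m o\<^sub>L r) x) x = cinner (m (r x)) (r x)"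
      using is_adjointD(1)[OF projectionsD(3)[OF that(2)]] by (metis blinfun_apply_blinfun_compose)
    then show "0 \<le> Re (cinner ((m o\<^sub>L r) x) x)" using m(4) by simp
    show "is_adjoint (m o\<^sub>L r) (m o\<^sub>L r)"
      using is_adjoint_compose[OF m(2) projectionsD(3)[OF that(2)]] commute[OF m(1) that(1)] by simp
  qed
  obtain k where k: "k \<in> D" "is_adjoint k k" "k o\<^sub>L k = m o\<^sub>L (id_blinfun - q)"
    using sqrt_mem[of "m o\<^sub>L (id_blinfun - q)"] pos[OF r] closed_under(8)[OF m(1) r(1)] by metis
  obtain l where l: "l \<in> D" "is_adjoint l l" "l o\<^sub>L l = m o\<^sub>L q"
    using sqrt_mem[of "m o\<^sub>L q"] pos[OF q(1,2)] closed_under(8)[OF m(1) q(1)] by metis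
  have "m (q x) = q (m x)" "g (q x) = q (g x)" for x
    using commute_apply q m g by blast+
  then have "m o\<^sub>L (id_blinfun - q) = g o\<^sub>L (id_blinfun - q)"
    using mq by (auto intro!: blinfun_eqI simp: op_apply algebra_simps)
  moreover have "m o\<^sub>L q = - (g o\<^sub>L q)"
    using gq by (auto intro!: blinfun_eqI simp: op_apply)
  ultimately show thesis using that[of q k l] q k l by simp
qed

end

section \<open>Isomorphisms of maximal abelian algebras are spatial\<close>

lemma blinfun_eq_dense:
  assumes "closure S = UNIV" and "\<And>x. x \<in> S \<Longrightarrow> blinfun_apply A x = blinfun_apply B x"
  shows "A = B"
proof (rule blinfun_eqI)
  fix x
  have "closed {x. blinfun_apply A x = blinfun_apply B x}"
    by (intro closed_Collect_eq continuous_intros)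
  then have "closure S \<subseteq> {x. blinfun_apply A x = blinfun_apply B x}"
    using assms(2) by (intro closure_minimal) auto
  then show "A x = B x" using assms(1) by blast
qed

lemma csubspace_image:
  fixes f :: "'a::complex_normed_vector \<Rightarrow> 'b::complex_normed_vector"
  assumes M: "csubspace M" and add: "\<And>x y. f (x + y) = f x + f y"
    and scale: "\<And>c x. f (c *\<^sub>C x) = c *\<^sub>C f x"
  shows "csubspace (f ` M)"
proof (rule csubspaceI)
  show "0 \<in> f ` M" using scale[of 0 0] csubspaceD(1)[OF M] by force
  fix x y assume "x \<in> f ` M" "y \<in> f ` M"
  then show "x + y \<in> f ` M" using csubspaceD(2)[OF M] by (auto simp flip: add)
next
  fix c x assume "x \<in> f ` M"
  then show "c *\<^sub>C x \<in> f ` M" using csubspaceD(3)[OF M] by (auto simp flip: scale)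
qed

locale max_abelian_iso =
  D1: max_abelian_algebra D1 + D2: max_abelian_algebra D2
  for D1 :: "('a::chilbert_space \<Rightarrow>\<^sub>L 'a) set" and D2 :: "('b::chilbert_space \<Rightarrow>\<^sub>L 'b) set" +
  fixes \<theta> :: "('a \<Rightarrow>\<^sub>L 'a) \<Rightarrow> ('b \<Rightarrow>\<^sub>L 'b)"
  assumes bij: "bij_betw \<theta> D1 D2"
    and add: "d \<in> D1 \<Longrightarrow> e \<in> D1 \<Longrightarrow> \<theta> (d + e) = \<theta> d + \<theta> e"
    and scale: "d \<in> D1 \<Longrightarrow> \<theta> (c *\<^sub>C d) = c *\<^sub>C \<theta> d"
    and mult: "d \<in> D1 \<Longrightarrow> e \<in> D1 \<Longrightarrow> \<theta> (d o\<^sub>L e) = \<theta> d o\<^sub>L \<theta> e"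
    and adjoint: "d \<in> D1 \<Longrightarrow> e \<in> D1 \<Longrightarrow> is_adjoint d e \<Longrightarrow> is_adjoint (\<theta> d) (\<theta> e)"
begin

lemma mem: "d \<in> D1 \<Longrightarrow> \<theta> d \<in> D2"
  using bij bij_betwE by blast

lemma inj: "d \<in> D1 \<Longrightarrow> e \<in> D1 \<Longrightarrow> \<theta> d = \<theta> e \<Longrightarrow> d = e"
  using bij by (auto simp: bij_betw_def inj_on_def)

lemma surj: assumes "e \<in> D2" obtains d where "d \<in> D1" "\<theta> d = e"
  using bij assms by (auto simp: bij_betw_def)

lemma zero: "\<theta> 0 = 0"
  using scale[of 0 0] D1.closed_under by simp

lemma diff: "d \<in> D1 \<Longrightarrow> e \<in> D1 \<Longrightarrow> \<theta> (d - e) = \<theta> d - \<theta> e"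
  using add[of "d - e" e] D1.closed_under by simp

lemma one: "\<theta> id_blinfun = id_blinfun"
proof -
  obtain d where d: "d \<in> D1" "\<theta> d = id_blinfun" using surj D2.closed_under(2) by blast
  then show ?thesis using mult[OF D1.closed_under(2) d(1)] by (simp add: compose_id)
qed

lemma projection: assumes "p \<in> D1" "p \<in> projections" shows "\<theta> p \<in> projections"
  using mult[of p p] adjoint[of p p] assms projectionsD[of p] by (intro projectionsI) auto

lemma mult_apply: "d \<in> D1 \<Longrightarrow> e \<in> D1 \<Longrightarrow> \<theta> (d o\<^sub>L e) x = \<theta> d (\<theta> e x)"
  using mult by simp

text \<open>
  Spectral truncation: for \<open>q\<close> the spectral projection of \<open>d*d\<close> for \<open>[1/4, \<infinity>)\<close>,
  \<open>d\<close> has norm at most \<open>1/2\<close> off \<open>q\<close> and is bounded below by \<open>1/2\<close> on \<open>q\<close>.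
\<close>

lemma ex_truncating_projection:
  assumes d: "d \<in> D1" and dx: "norm (x - d x) \<le> \<epsilon>" and dy: "norm (\<theta> d y) \<le> \<epsilon>"
  obtains q where "q \<in> D1" "q \<in> projections" "norm (x - q x) \<le> 2 * \<epsilon>" "norm (\<theta> q y) \<le> 2 * \<epsilon>"
proof -
  obtain e where e: "e \<in> D1" "is_adjoint d e" using d by (rule D1.ex_adj)
  define g where "g = (e o\<^sub>L d) - (1/4) *\<^sub>C id_blinfun"
  have ed: "is_adjoint (e o\<^sub>L d) (e o\<^sub>L d)"
    using e(2) is_adjoint_commute by (intro is_adjoint_compose) blast+
  have "cnj (1/4) = 1/4" by simp
  then have "is_adjoint ((1/4) *\<^sub>C id_blinfun) ((1/4) *\<^sub>C id_blinfun)"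
    using is_adjoint_scaleC[OF is_adjoint_id, of "1/4"] by metis
  then have gadj: "is_adjoint g g" unfolding g_def using ed by (intro is_adjoint_diff)
  have gD: "g \<in> D1" unfolding g_def using e d by (intro D1.closed_under)
  obtain p k l where p: "p \<in> D1" "p \<in> projections" and k: "k \<in> D1" "is_adjoint k k"
    and l: "l \<in> D1" "is_adjoint l l"
    and kk: "k o\<^sub>L k = g o\<^sub>L (id_blinfun - p)" and ll: "l o\<^sub>L l = - (g o\<^sub>L p)"
    using D1.spectral_splitting[OF gD gadj] by metis
  define q where "q = id_blinfun - p"
  have q: "q \<in> D1" "q \<in> projections"
    unfolding q_def using p D1.closed_under projections_complement by auto
  \<comment> \<open>On the range of \<open>p\<close> the element \<open>g\<close> is minus a square,
    so \<open>d\<close> shrinks \<open>p x\<close> to at most half its length. Hence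
    \<open>p x - d (p x)\<close>, whose norm is at most \<epsilon>, is at least half as long as
    \<open>p x\<close>.\<close>
  have "norm (p x) \<le> 2 * \<epsilon>"
  proof -
    have "g (p x) = - l (l x)"
      using ll by (metis blinfun.minus_left blinfun_apply_blinfun_compose minus_equation_iff)
    moreover have "g (p x) = p (g (p x))"
      using D1.commute_apply[OF p(1) gD] projectionsD(4)[OF p(2)] by metis
    ultimately have "cinner (g (p x)) (p x) = - cinner (l (l x)) x"
      using is_adjointD(1)[OF projectionsD(3)[OF p(2)]] by (metis cinner_minus(1))
    also have "\<dots> = - complex_of_real ((norm (l x))\<^sup>2)"
      using is_adjointD(1)[OF l(2), of "l x" x] by (simp add: cinner_self)
    moreover have "cinner (g (p x)) (p x)
        = complex_of_real ((norm (d (p x)))\<^sup>2) - complex_of_real ((norm (p x))\<^sup>2) / 4"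
      using is_adjointD(2)[OF e(2), of "d (p x)" "p x"]
      by (simp add: g_def op_apply cinner_simps cinner_self)
    ultimately have "complex_of_real ((norm (d (p x)))\<^sup>2 - (norm (p x))\<^sup>2 / 4)
        = complex_of_real (- (norm (l x))\<^sup>2)" by simp
    then have "(norm (d (p x)))\<^sup>2 - (norm (p x))\<^sup>2 / 4 = - (norm (l x))\<^sup>2"
      using of_real_eq_iff by blast
    moreover have "0 \<le> (norm (l x))\<^sup>2" by simp
    ultimately have "(norm (d (p x)))\<^sup>2 \<le> (norm (p x))\<^sup>2 / 4" by linarith
    then have "(norm (d (p x)))\<^sup>2 \<le> (norm (p x) / 2)\<^sup>2" by (simp add: power_divide)
    then have "norm (d (p x)) \<le> norm (p x) / 2" by (rule power2_le_imp_le) simp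
    moreover have "norm (p (x - d x)) \<le> \<epsilon>" using norm_projection[OF p(2)] dx order_trans by blast
    moreover have "p (x - d x) = p x - d (p x)"
      using D1.commute_apply[OF p(1) d] by (simp add: op_apply)
    ultimately show ?thesis using norm_triangle_ineq2[of "p x" "d (p x)"] by simp
  qed
  \<comment> \<open>Positivity of \<open>g\<close> on \<open>q\<close> crosses over to the other
    algebra as the identity k^2 = gq with \<open>k\<close> self-adjoint.\<close>
  moreover have "norm (\<theta> q y) \<le> 2 * \<epsilon>"
  proof -
    let ?q = "\<theta> q" and ?k = "\<theta> k"
    have Q: "?q \<in> projections" using projection q by blast
    have "\<theta> g (?q y) = ?k (?k y)"
      using kk gD q(1) k(1) by (metis mult_apply q_def)
    moreover have "\<theta> g (?q y) = ?q (\<theta> g (?q y))"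
      using D2.commute_apply[OF mem[OF q(1)] mem[OF gD]] projectionsD(4)[OF Q] by metis
    ultimately have "cinner (\<theta> g (?q y)) (?q y) = cinner (?k (?k y)) y"
      using is_adjointD(1)[OF projectionsD(3)[OF Q]] by metis
    also have "\<dots> = complex_of_real ((norm (?k y))\<^sup>2)"
      using is_adjointD(1)[OF adjoint[OF k(1,1,2)], of "?k y" y] by (simp add: cinner_self)
    moreover have \<theta>g: "\<theta> g = (\<theta> e o\<^sub>L \<theta> d) - (1/4) *\<^sub>C id_blinfun"
      unfolding g_def using e d D1.closed_under by (simp add: diff mult scale one)
    have "cinner (\<theta> g (?q y)) (?q y)
        = complex_of_real ((norm (\<theta> d (?q y)))\<^sup>2) - complex_of_real ((norm (?q y))\<^sup>2) / 4"
      using is_adjointD(2)[OF adjoint[OF d e], of "\<theta> d (?q y)" "?q y"]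
      by (simp add: \<theta>g op_apply cinner_simps cinner_self)
    ultimately have "complex_of_real ((norm (\<theta> d (?q y)))\<^sup>2 - (norm (?q y))\<^sup>2 / 4)
        = complex_of_real ((norm (?k y))\<^sup>2)" by simp
    then have "(norm (\<theta> d (?q y)))\<^sup>2 - (norm (?q y))\<^sup>2 / 4 = (norm (?k y))\<^sup>2"
      using of_real_eq_iff by blast
    moreover have "0 \<le> (norm (?k y))\<^sup>2" by simp
    ultimately have "(norm (?q y))\<^sup>2 / 4 \<le> (norm (\<theta> d (?q y)))\<^sup>2" by linarith
    then have "(norm (?q y) / 2)\<^sup>2 \<le> (norm (\<theta> d (?q y)))\<^sup>2" by (simp add: power_divide)
    then have "norm (?q y) / 2 \<le> norm (\<theta> d (?q y))" by (rule power2_le_imp_le) simp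
    also have "\<theta> d (?q y) = ?q (\<theta> d y)" using D2.commute_apply mem q d by blast
    also have "norm (?q (\<theta> d y)) \<le> \<epsilon>" using norm_projection[OF Q] dy order_trans by blast
    finally show ?thesis by simp
  qed
  ultimately show thesis using that[of q] q by (simp add: q_def op_apply)
qed

text \<open>
  Automatic normality of the purely algebraic \<open>\<theta>\<close>. The projections \<open>q n\<close> converge to \<open>1\<close> at \<open>x\<close>,
  while the product \<open>z\<close> of the \<open>1 - \<theta> (q n)\<close> applied to \<open>y\<close> is nonzero. The projection onto the joint
  kernel of the \<open>\<theta> (q n)\<close> belongs to \<open>D2\<close>, and its preimage under \<open>\<theta>\<close> annihilates \<open>x\<close> but its image
  fixes \<open>z\<close>.
\<close>

lemma not_singular:
  assumes y0: "y \<noteq> 0" and ac: "\<And>d. d \<in> D1 \<Longrightarrow> blinfun_apply d x = 0 \<Longrightarrow> \<theta> d y = 0"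
    and sing: "\<And>\<epsilon>. 0 < \<epsilon> \<Longrightarrow> \<exists>d\<in>D1. norm (x - blinfun_apply d x) \<le> \<epsilon> \<and> norm (\<theta> d y) \<le> \<epsilon>"
  shows False
proof -
  \<comment> \<open>The errors c/2^n sum to 2c, half the norm of y, which keeps the limit
    \<open>z\<close> away from 0.\<close>
  define c where "c = norm y / 4"
  have c: "0 < c" using y0 by (simp add: c_def)
  have "\<exists>q. q \<in> D1 \<and> q \<in> projections \<and> norm (x - q x) \<le> c * (1/2) ^ n \<and> norm (\<theta> q y) \<le> c * (1/2) ^ n" for n
  proof -
    have "0 < c * (1/2) ^ n / 2" using c by simp
    then obtain d where d: "d \<in> D1" "norm (x - d x) \<le> c * (1/2) ^ n / 2" "norm (\<theta> d y) \<le> c * (1/2) ^ n / 2"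
      using sing by blast
    obtain q where "q \<in> D1" "q \<in> projections" "norm (x - q x) \<le> 2 * (c * (1/2) ^ n / 2)"
      "norm (\<theta> q y) \<le> 2 * (c * (1/2) ^ n / 2)"
      using ex_truncating_projection[OF d] by metis
    then show ?thesis by auto
  qed
  then obtain q where q: "\<And>n. q n \<in> D1" "\<And>n. q n \<in> projections"
    and qx: "\<And>n. norm (x - q n x) \<le> c * (1/2) ^ n" and qy: "\<And>n. norm (\<theta> (q n) y) \<le> c * (1/2) ^ n"
    by metis
  define r where "r n = \<theta> (q n)" for n
  have r: "r n \<in> D2" "r n \<in> projections" for n
    using q mem projection by (auto simp: r_def)
  define w where "w n = rec_nat id_blinfun (\<lambda>n u. (id_blinfun - r n) o\<^sub>L u) n" for n
  have w: "w 0 = id_blinfun" "w (Suc n) = (id_blinfun - r n) o\<^sub>L w n" for n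
    by (simp_all add: w_def)
  have wD: "w n \<in> D2" for n
    by (induction n) (auto simp: w intro: D2.closed_under r)
  have wn: "norm (w n u) \<le> norm u" for n u
  proof (induction n)
    case (Suc n)
    have "norm ((id_blinfun - r n) (w n u)) \<le> norm (w n u)"
      by (rule norm_projection[OF projections_complement[OF r(2)]])
    then show ?case using Suc by (simp add: w)
  qed (simp add: w op_apply)
  have rw: "r k (w n u) = 0" if "k < n" for k n u
    using that
  proof (induction n)
    case (Suc n)
    show ?case
    proof (cases "k = n")
      case True
      then show ?thesis by (simp add: w op_apply projectionsD(4)[OF r(2)])
    next
      case False
      then have "r k (w n u) = 0" using Suc by simp
      moreover have "r k (r n (w n u)) = r n (r k (w n u))" by (rule D2.commute_apply[OF r(1) r(1)])
      ultimately show ?thesis by (simp add: w op_apply)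
    qed
  qed simp
  \<comment> \<open>\<open>a n\<close> is what the n-th factor removes from \<open>w n y\<close>.
    Commuting \<open>r n\<close> past the contraction \<open>w n\<close> bounds it by the norm of
    \<open>r n y\<close>.\<close>
  define a where "a n = r n (w n y)" for n
  have na: "norm (a n) \<le> c * (1/2) ^ n" for n
  proof -
    have "a n = w n (r n y)" unfolding a_def using D2.commute_apply[OF r(1) wD] .
    then show ?thesis using wn[of n "r n y"] qy[of n] by (simp add: r_def)
  qed
  have sums: "(\<lambda>n. c * (1/2) ^ n) sums (c * 2)"
    using sums_mult[OF geometric_sums[of "1/2 :: real"], of c] by simp
  have suma: "summable (\<lambda>n. norm (a n))"
    using na by (intro summable_comparison_test'[OF sums_summable[OF sums], of 0]) auto
  define z where "z = y - suminf a"
  have wsum: "w n y = y - (\<Sum>i<n. a i)" for n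
    by (induction n) (simp_all add: w a_def blinfun.diff_left algebra_simps)
  have lim: "(\<lambda>n. w n y) \<longlonglongrightarrow> z"
    unfolding wsum z_def by (intro tendsto_intros summable_LIMSEQ summable_norm_cancel[OF suma])
  have z0: "z \<noteq> 0"
  proof
    assume "z = 0"
    then have "norm y = norm (suminf a)" by (simp add: z_def)
    also have "\<dots> \<le> (\<Sum>n. norm (a n))" by (rule summable_norm[OF suma])
    also have "\<dots> \<le> c * 2" using suminf_le[OF na suma sums_summable[OF sums]] sums_unique[OF sums] by simp
    finally show False using y0 by (simp add: c_def)
  qed
  have tb: "(\<lambda>n. T (w n y)) \<longlonglongrightarrow> T z" for T :: "'b \<Rightarrow>\<^sub>L 'b" by (intro tendsto_intros lim)
  have rz: "r k z = 0" for k
  proof -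
    have "\<forall>\<^sub>F n in sequentially. r k (w n y) = 0"
      using rw by (intro eventually_sequentiallyI[of "Suc k"]) auto
    then have "(\<lambda>n. r k (w n y)) \<longlonglongrightarrow> 0" by (rule tendsto_eventually)
    then show ?thesis by (rule LIMSEQ_unique[OF tb])
  qed
  \<comment> \<open>\<open>w n\<close> commutes with \<open>\<theta> d\<close>, so the annihilation
    property of y passes to every \<open>w n y\<close> and to the limit.\<close>
  have acz: "\<theta> d z = 0" if "d \<in> D1" "d x = 0" for d
  proof -
    have "\<theta> d (w n y) = 0" for n
      using ac[OF that] D2.commute_apply[OF mem[OF that(1)] wD[of n], of y] by (simp add: blinfun.zero_right)
    then have "(\<lambda>n. \<theta> d (w n y)) \<longlonglongrightarrow> 0" by simp
    then show ?thesis by (rule LIMSEQ_unique[OF tb])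
  qed
  define Z where "Z = {v. \<forall>n. r n v = 0}"
  have "Z = (\<Inter>n. {v. r n v = 0})" by (auto simp: Z_def)
  then have Z1: "closed Z" by (simp only:) (intro closed_INT ballI closed_Collect_eq continuous_intros)
  have Z2: "csubspace Z" unfolding Z_def
    by (intro csubspaceI)
      (simp_all add: blinfun.zero_right blinfun.add_right bounded_ops_scaleC[OF D2.bounded[OF r(1)]])
  have Z3: "d v \<in> Z" if "d \<in> D2" "v \<in> Z" for d v
    using that D2.commute_apply[OF r(1) that(1)] by (simp add: Z_def blinfun.zero_right)
  obtain S where S: "S \<in> D2" "\<And>v. v \<in> Z \<Longrightarrow> S v = v" "\<And>v. S v \<in> Z"
    using D2.ex_invariant_projection[OF Z2 Z1 Z3] by metis
  obtain s where s: "s \<in> D1" "\<theta> s = S" using S(1) by (rule surj)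
  \<comment> \<open>\<open>\<theta>\<close> sends this product to \<open>r n\<close> after
    \<open>S\<close>, which is 0 because the range of \<open>S\<close> lies in the joint kernel.
    Injectivity brings the relation back, so only the bounded operator \<open>s\<close> has to be
    taken to a limit, never \<open>\<theta>\<close>.\<close>
  have sq: "s (q n u) = 0" for n u
  proof -
    have "\<theta> (q n o\<^sub>L s) = 0"
      using S(3) by (auto intro!: blinfun_eqI simp: mult[OF q(1) s(1)] s(2) Z_def simp flip: r_def)
    then have "q n o\<^sub>L s = 0" using inj[of "q n o\<^sub>L s" 0] zero q s D1.closed_under by metis
    then show ?thesis using D1.commute_apply[OF s(1) q(1)]
      by (metis blinfun.zero_left blinfun_apply_blinfun_compose)
  qed
  have "(\<lambda>n. q n x) \<longlonglongrightarrow> x"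
  proof (rule Lim_transform_bound[where g = "\<lambda>n. c * (1/2) ^ n", THEN LIM_zero_cancel[where l = x]])
    show "\<forall>\<^sub>F n in sequentially. norm (q n x - x) \<le> norm (c * (1/2) ^ n)"
      using qx c by (intro always_eventually) (auto simp: norm_minus_commute)
    show "(\<lambda>n. c * (1/2) ^ n) \<longlonglongrightarrow> 0"
      using sums_summable[OF sums] by (rule summable_LIMSEQ_zero)
  qed
  then have "(\<lambda>n. s (q n x)) \<longlonglongrightarrow> s x" by (intro tendsto_intros)
  then have "s x = 0" using sq LIMSEQ_unique tendsto_const by (metis (no_types, lifting) ext)
  then have "S z = 0" using acz s by blast
  then show False using S(2)[of z] rz z0 by (simp add: Z_def)
qed

text \<open>These pairs are what enlarges a non-maximal graph in the spatial implementation. The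
  demand p x = x makes it possible to look for them in the orthogonal complement of what is already
  covered.\<close>

lemma ex_matching_vectors:
  assumes p: "p \<in> D1" "p \<in> projections" "p \<noteq> 0"
  obtains x y where "x \<noteq> 0" "p x = x" "\<theta> p y = y" "\<And>d. d \<in> D1 \<Longrightarrow> cinner (d x) x = cinner (\<theta> d y) y"
proof -
  obtain x where x: "x \<noteq> 0" "p x = x"
    using p(3) projectionsD(4)[OF p(2)] by (metis blinfun.zero_left blinfun_eqI)
  let ?X = "(\<lambda>d. blinfun_apply d x) ` D1"
  have X: "csubspace ?X"
  proof (rule csubspaceI)
    show "0 \<in> ?X" using D1.closed_under(1) by (intro image_eqI[of _ _ 0]) auto
    fix u v assume "u \<in> ?X" "v \<in> ?X"
    then obtain d e where "d \<in> D1" "e \<in> D1" "u = d x" "v = e x" by blast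
    then show "u + v \<in> ?X"
      using D1.closed_under by (intro image_eqI[of _ _ "d + e"]) (auto simp: op_apply)
  next
    fix c u assume "u \<in> ?X"
    then obtain d where "d \<in> D1" "u = d x" by blast
    then show "c *\<^sub>C u \<in> ?X"
      using D1.closed_under by (intro image_eqI[of _ _ "c *\<^sub>C d"]) (auto simp: op_apply)
  qed
  have "e u \<in> closure ?X" if "e \<in> D1" "u \<in> closure ?X" for e u
  proof -
    have "blinfun_apply e ` closure ?X \<subseteq> closure ?X"
    proof (rule image_closure_subset)
      show "blinfun_apply e ` ?X \<subseteq> closure ?X"
      proof
        fix v assume "v \<in> blinfun_apply e ` ?X"
        then obtain d where d: "d \<in> D1" "v = (e o\<^sub>L d) x" by auto
        have "v \<in> ?X"
          unfolding d(2) by (rule imageI[OF D1.closed_under(8)[OF that(1) d(1)]])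
        then show "v \<in> closure ?X" by (rule subsetD[OF closure_subset])
      qed
    qed (auto intro: continuous_intros)
    then show ?thesis using that(2) by blast
  qed
  \<comment> \<open>\<open>px\<close> is the support of x: it fixes x, and d x = 0 makes d vanish on
    its range. A vector y in the range of \<open>\<theta> px\<close> therefore satisfies
    \<open>\<theta> d y = 0\<close> whenever d x = 0.\<close>
  then obtain px where px: "px \<in> D1" "px \<in> projections" "\<And>u. u \<in> closure ?X \<Longrightarrow> px u = u"
    "\<And>u. px u \<in> closure ?X"
    using D1.ex_invariant_projection[of "closure ?X"] csubspace_closure[OF X] by (metis closed_closure)
  have xX: "x \<in> closure ?X"
    using D1.closed_under(2) closure_subset[of ?X] by (metis id_blinfun.rep_eq image_eqI subsetD)
  have "px \<noteq> 0" using px(3)[OF xX] x(1) by auto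
  then have "\<theta> px \<noteq> 0" using inj[OF px(1) D1.closed_under(1)] zero by auto
  then obtain y where y: "y \<noteq> 0" "\<theta> px y = y"
    using projectionsD(4)[OF projection[OF px(1,2)]] by (metis blinfun.zero_left blinfun_eqI)
  have ac: "\<theta> d y = 0" if d: "d \<in> D1" "d x = 0" for d
  proof -
    have "d u = 0" if "u \<in> closure ?X" for u
    proof -
      have "closed {u. d u = 0}" by (intro closed_Collect_eq continuous_intros)
      moreover have "?X \<subseteq> {u. d u = 0}"
        using D1.commute_apply[OF d(1)] d(2) by (auto simp: blinfun.zero_right)
      ultimately show ?thesis using that closure_minimal by blast
    qed
    then have "d o\<^sub>L px = 0" using px(4) by (auto intro: blinfun_eqI)
    then have "\<theta> d (\<theta> px y) = 0" using mult_apply[OF d(1) px(1), of y] zero by simp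
    then show ?thesis by (simp add: y)
  qed
  \<comment> \<open>The diagonal action of D1 on the direct sum. The closed orbit \<open>?K\<close>
    of (x, y) is invariant under the action and its adjoints, so the projection \<open>E\<close>
    commutes with it and its corner \<open>T\<close> intertwines d with
    \<open>\<theta> d\<close>.\<close>
  define \<Delta> where "\<Delta> d z = (blinfun_apply d (fst z), blinfun_apply (\<theta> d) (snd z))" for d and z :: "'a \<times> 'b"
  let ?B = "(\<lambda>d. \<Delta> d (x, y)) ` D1"
  let ?K = "closure ?B"
  have K0: "csubspace ?B"
  proof (rule csubspaceI)
    show "0 \<in> ?B" using D1.closed_under(1) by (intro image_eqI[of _ _ 0]) (auto simp: \<Delta>_def zero zero_prod_def)
    fix u v assume "u \<in> ?B" "v \<in> ?B"
    then obtain d e where "d \<in> D1" "e \<in> D1" "u = \<Delta> d (x, y)" "v = \<Delta> e (x, y)" by blast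
    then show "u + v \<in> ?B"
      using D1.closed_under by (intro image_eqI[of _ _ "d + e"]) (auto simp: \<Delta>_def op_apply add)
  next
    fix c u assume "u \<in> ?B"
    then obtain d where "d \<in> D1" "u = \<Delta> d (x, y)" by blast
    then show "c *\<^sub>C u \<in> ?B"
      using D1.closed_under
      by (intro image_eqI[of _ _ "c *\<^sub>C d"]) (auto simp: \<Delta>_def op_apply scale scaleC_prod)
  qed
  obtain E where E: "E \<in> projections" "\<And>z. z \<in> ?K \<Longrightarrow> E z = z" "\<And>z. E z \<in> ?K"
    "\<And>z w. w \<in> ?K \<Longrightarrow> cinner (z - E z) w = 0"
    using ex_projection[OF csubspace_closure[OF K0] closed_closure] by metis
  have \<Delta>K: "\<Delta> d z \<in> ?K" if "d \<in> D1" "z \<in> ?K" for d z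
  proof -
    have "\<Delta> d ` ?K \<subseteq> ?K"
    proof (rule image_closure_subset)
      show "continuous_on ?K (\<Delta> d)" unfolding \<Delta>_def by (intro continuous_intros)
      show "\<Delta> d ` ?B \<subseteq> ?K"
      proof
        fix v assume "v \<in> \<Delta> d ` ?B"
        then obtain e where "e \<in> D1" "v = \<Delta> d (\<Delta> e (x, y))" by auto
        then have "v = \<Delta> (d o\<^sub>L e) (x, y)" "d o\<^sub>L e \<in> D1"
          using that(1) D1.closed_under(8) by (auto simp: \<Delta>_def mult)
        then have "v \<in> ?B" by blast
        then show "v \<in> ?K" by (rule subsetD[OF closure_subset])
      qed
    qed simp
    then show ?thesis using that(2) by blast
  qed
  have E\<Delta>: "E (\<Delta> d z) = \<Delta> d (E z)" if d: "d \<in> D1" for d z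
  proof -
    obtain e where e: "e \<in> D1" "is_adjoint d e" using d by (rule D1.ex_adj)
    have \<Delta>adj: "cinner (\<Delta> d u) v = cinner u (\<Delta> e v)" for u v
      using is_adjointD(1)[OF e(2)] is_adjointD(1)[OF adjoint[OF d e]] by (simp add: \<Delta>_def cinner_prod)
    let ?v = "E (\<Delta> d z) - \<Delta> d (E z)"
    have vK: "?v \<in> ?K" using E(3) \<Delta>K[OF d E(3)] by (intro csubspaceD(4)[OF csubspace_closure[OF K0]])
    have "\<Delta> d z - \<Delta> d (E z) = \<Delta> d (z - E z)" by (simp add: \<Delta>_def op_apply)
    then have "cinner (\<Delta> d z - \<Delta> d (E z)) ?v = 0"
      using \<Delta>adj E(4)[OF \<Delta>K[OF e(1) vK]] by simp
    moreover have "cinner (\<Delta> d z - E (\<Delta> d z)) ?v = 0" using E(4)[OF vK] .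
    ultimately have "cinner ?v ?v = 0" by (simp add: cinner_diff(1))
    then show ?thesis by simp
  qed
  define T where "T u = snd (E (u, 0))" for u
  have Tadd: "T (u + u') = T u + T u'" for u u'
    using blinfun.add_right[of E "(u, 0)" "(u', 0)"] by (simp add: T_def)
  have Tscale: "T (c *\<^sub>C u) = c *\<^sub>C T u" for c u
    using bounded_ops_scaleC[OF projectionsD(1)[OF E(1)], of c "(u, 0)"] by (simp add: T_def scaleC_prod)
  have Td: "T (d u) = \<theta> d (T u)" if "d \<in> D1" for d u
    using E\<Delta>[OF that, of "(u, 0)"] by (simp add: T_def \<Delta>_def blinfun.zero_right)
  \<comment> \<open>If T x = 0, then E(x, 0) = (w, 0), where x - w both lies in the cyclic subspace
    of x and is orthogonal to it. So w = x and (x, 0) belongs to the closed orbit, which is the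
    singular situation excluded above.\<close>
  have "T x \<noteq> 0"
  proof
    assume "T x = 0"
    then obtain w where w: "E (x, 0) = (w, 0)" unfolding T_def by (metis prod.collapse)
    have "fst ` ?K \<subseteq> closure ?X"
    proof (rule image_closure_subset)
      show "fst ` ?B \<subseteq> closure ?X" using closure_subset by (force simp: \<Delta>_def)
    qed (auto intro: continuous_intros)
    then have wX: "w \<in> closure ?X" using E(3)[of "(x, 0)"] w by force
    have "cinner (x - w) (d x) = 0" if "d \<in> D1" for d
    proof -
      have "\<Delta> d (x, y) \<in> ?K" by (rule subsetD[OF closure_subset imageI[OF that]])
      then show ?thesis using E(4)[of "\<Delta> d (x, y)" "(x, 0)"] by (simp add: w \<Delta>_def cinner_prod)
    qed
    then have "?X \<subseteq> {u. cinner u (x - w) = 0}" using cinner_eq_0_commute by blast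
    then have "closure ?X \<subseteq> {u. cinner u (x - w) = 0}" by (intro closure_minimal closed_orthogonal)
    moreover have "x - w \<in> closure ?X" using xX wX by (intro csubspaceD(4)[OF csubspace_closure[OF X]])
    ultimately have "w = x" by auto
    then have xK: "(x, 0) \<in> ?K" using E(3)[of "(x, 0)"] w by simp
    show False
    proof (rule not_singular[OF y(1) ac])
      fix \<epsilon> :: real assume "0 < \<epsilon>"
      then obtain d where d: "d \<in> D1" "dist (\<Delta> d (x, y)) (x, 0) < \<epsilon>"
        using xK unfolding closure_approachable by blast
      have "dist (d x) x < \<epsilon>" "dist (\<theta> d y) 0 < \<epsilon>"
        using dist_fst_le[of "\<Delta> d (x, y)" "(x, 0)"] dist_snd_le[of "\<Delta> d (x, y)" "(x, 0)"] d(2)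
        by (auto simp: \<Delta>_def)
      then show "\<exists>d\<in>D1. norm (x - blinfun_apply d x) \<le> \<epsilon> \<and> norm (\<theta> d y) \<le> \<epsilon>"
        using d(1) by (auto simp: dist_norm norm_minus_commute intro!: bexI[of _ d])
    qed
  qed
  have nT: "norm (fst (E (0, T u))) \<le> 1 * norm u" for u
  proof -
    have "norm (fst (E (0, T u))) \<le> norm (E (0, T u))" by (metis norm_fst_le prod.collapse)
    also have "\<dots> \<le> norm (0 :: 'a, T u)" by (rule norm_projection[OF E(1)])
    also have "\<dots> = norm (snd (E (u, 0)))" by (simp add: T_def norm_Pair)
    also have "\<dots> \<le> norm (E (u, 0))" by (metis norm_snd_le prod.collapse)
    also have "\<dots> \<le> norm (u, 0 :: 'b)" by (rule norm_projection[OF E(1)])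
    finally show ?thesis by (simp add: norm_Pair)
  qed
  have Hadd: "fst (E (0, T (u + u'))) = fst (E (0, T u)) + fst (E (0, T u'))" for u u'
    using blinfun.add_right[of E "(0, T u)" "(0, T u')"] by (simp add: Tadd)
  have Hscale: "fst (E (0, T (c *\<^sub>C u))) = c *\<^sub>C fst (E (0, T u))" for c u
    using bounded_ops_scaleC[OF projectionsD(1)[OF E(1)], of c "(0, T u)"] by (simp add: Tscale scaleC_prod)
  \<comment> \<open>\<open>H\<close> is T* T: since \<open>E\<close> is self-adjoint, the adjoint of
    the corner \<open>T\<close> is v \<mapsto> fst (E (0, v)).\<close>
  obtain H where H: "H \<in> bounded_ops" "\<And>u. blinfun_apply H u = fst (E (0, T u))"
    using ex_bounded_op[OF Hadd Hscale nT] by blast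
  have HT: "cinner (H u) u' = cinner (T u) (T u')" for u u'
    using is_adjointD(1)[OF projectionsD(3)[OF E(1)], of "(0, T u)" "(u', 0)"]
    by (simp add: H cinner_prod T_def[of u'])
  have "H \<in> D1"
  proof (rule D1.memI[OF H(1)])
    fix d assume d: "d \<in> D1"
    have "fst (E (0, T (d u))) = d (fst (E (0, T u)))" for u
      using E\<Delta>[OF d, of "(0, T u)"] by (simp add: \<Delta>_def blinfun.zero_right Td[OF d])
    then show "H o\<^sub>L d = d o\<^sub>L H" by (auto intro!: blinfun_eqI simp: H)
  qed
  moreover have Hadj: "is_adjoint H H"
    unfolding is_adjoint_def using HT by (metis cinner_commute)
  moreover have "0 \<le> Re (cinner (H u) u)" for u by (simp add: HT cinner_self)
  ultimately obtain k where k: "k \<in> D1" "is_adjoint k k" "k o\<^sub>L k = H"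
    using D1.sqrt_mem by metis
  \<comment> \<open>\<open>k\<close> is the absolute value of \<open>T\<close>. It lies in D1 and
    commutes with d, so <d k x, k x> = <H d x, x> = <T d x, T x>.\<close>
  have match: "cinner (d (k x)) (k x) = cinner (\<theta> d (T x)) (T x)" if d: "d \<in> D1" for d
  proof -
    have "cinner (d (k x)) (k x) = cinner (k (d (k x))) x" by (simp add: is_adjointD(1)[OF k(2)])
    also have "k (d (k x)) = H (d x)"
      using D1.commute_apply[OF k(1) d] k(3) by (metis blinfun_apply_blinfun_compose)
    also have "cinner (H (d x)) x = cinner (\<theta> d (T x)) (T x)" by (simp add: HT Td[OF d])
    finally show ?thesis .
  qed
  show thesis
  proof (rule that[of "k x" "T x"])
    show "k x \<noteq> 0"
      using match[OF D1.closed_under(2)] \<open>T x \<noteq> 0\<close> by (auto simp: one op_apply)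
    show "p (k x) = k x" using D1.commute_apply[OF p(1) k(1)] x(2) by simp
    show "\<theta> p (T x) = T x" using Td[OF p(1), of x] x(2) by simp
  qed (rule match)
qed

lemma ex_spatial_implementation:
  obtains V :: "'a \<Rightarrow>\<^sub>L 'b" and W :: "'b \<Rightarrow>\<^sub>L 'a" where "is_adjoint V W" "V o\<^sub>L W = id_blinfun"
    "W o\<^sub>L V = id_blinfun" "\<And>d. d \<in> D1 \<Longrightarrow> V o\<^sub>L d = \<theta> d o\<^sub>L V"
proof -
  \<comment> \<open>The case d = 1 says that u \<mapsto> v preserves inner products; the other d
    build in the intertwining with \<open>\<theta>\<close>.\<close>
  define ok where "ok = (\<lambda>(u, v) (u', v'). \<forall>d\<in>D1. cinner (blinfun_apply d u) u' = cinner (blinfun_apply (\<theta> d) v) v')"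
  have ok_sym: "ok z z' \<Longrightarrow> ok z' z" for z z'
  proof -
    assume "ok z z'"
    moreover obtain u v u' v' where z: "z = (u, v)" "z' = (u', v')" by (cases z, cases z') auto
    ultimately have *: "\<And>d. d \<in> D1 \<Longrightarrow> cinner (d u) u' = cinner (\<theta> d v) v'" by (auto simp: ok_def)
    have "cinner (d u') u = cinner (\<theta> d v') v" if d: "d \<in> D1" for d
    proof -
      obtain e where e: "e \<in> D1" "is_adjoint d e" using d by (rule D1.ex_adj)
      have "cinner (d u') u = cnj (cinner (e u) u')"
        by (metis cinner_commute is_adjointD(1)[OF e(2)])
      also have "\<dots> = cnj (cinner (\<theta> e v) v')" by (simp add: *[OF e(1)])
      also have "\<dots> = cinner (\<theta> d v') v"
        by (metis cinner_commute is_adjointD(1)[OF adjoint[OF d e]])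
      finally show ?thesis .
    qed
    then show "ok z' z" by (auto simp: ok_def z)
  qed
  define \<A> where "\<A> = {G. \<forall>z\<in>G. \<forall>z'\<in>G. ok z z'}"
  have "\<exists>G\<in>\<A>. \<forall>X\<in>\<A>. G \<subseteq> X \<longrightarrow> X = G"
  proof (rule subset_Zorn_nonempty)
    show "\<A> \<noteq> {}" by (auto simp: \<A>_def intro: exI[of _ "{}"])
    fix \<C> assume "\<C> \<noteq> {}" and ch: "subset.chain \<A> \<C>"
    have "ok z z'" if z: "z \<in> \<Union>\<C>" "z' \<in> \<Union>\<C>" for z z'
    proof -
      obtain X Y where "X \<in> \<C>" "Y \<in> \<C>" "z \<in> X" "z' \<in> Y" using z by blast
      moreover from this have "X \<subseteq> Y \<or> Y \<subseteq> X" "X \<in> \<A>" "Y \<in> \<A>"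
        using ch by (auto simp: subset_chain_def)
      ultimately show ?thesis unfolding \<A>_def by blast
    qed
    then show "\<Union>\<C> \<in> \<A>" by (auto simp: \<A>_def)
  qed
  then obtain G where GA: "G \<in> \<A>" and max: "\<And>X. X \<in> \<A> \<Longrightarrow> G \<subseteq> X \<Longrightarrow> X = G" by blast
  have ok: "ok z z'" if "z \<in> G" "z' \<in> G" for z z' using GA that by (auto simp: \<A>_def)
  \<comment> \<open>Maximality turns compatibility into membership, so linearity and invariance of
    \<open>G\<close> reduce to the corresponding properties of \<open>ok\<close>.\<close>
  have absorb: "z \<in> G" if "\<And>z'. z' \<in> G \<Longrightarrow> ok z z'" "ok z z" for z
  proof -
    have "insert z G \<in> \<A>" using that ok ok_sym by (auto simp: \<A>_def)
    then show ?thesis using max by blast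
  qed
  have okD: "cinner (d u) u' = cinner (\<theta> d v) v'" if "ok (u, v) (u', v')" "d \<in> D1" for u v u' v' d
    using that by (auto simp: ok_def)
  have ok_add: "ok (z1 + z2) z" if "ok z1 z" "ok z2 z" for z1 z2 z
    using that by (auto simp: ok_def op_apply cinner_simps split: prod.splits)
  have ok_scale: "ok (c *\<^sub>C z1) z" if "ok z1 z" for z1 z c
    using that D1.bounded D2.bounded[OF mem]
    by (auto simp: ok_def cinner_simps scaleC_prod bounded_ops_scaleC split: prod.splits)
  have G: "csubspace G"
  proof (rule csubspaceI)
    show "0 \<in> G" by (rule absorb) (auto simp: ok_def zero_prod_def blinfun.zero_right)
  next
    fix z z' assume z: "z \<in> G" "z' \<in> G"
    have 1: "ok (z + z') u" if "u \<in> G" for u by (intro ok_add ok z that)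
    show "z + z' \<in> G" using 1 ok_add[OF ok_sym[OF 1] ok_sym[OF 1], OF z] by (rule absorb)
  next
    fix c z assume z: "z \<in> G"
    have 1: "ok (c *\<^sub>C z) u" if "u \<in> G" for u by (intro ok_scale ok z that)
    show "c *\<^sub>C z \<in> G" using 1 ok_scale[OF ok_sym[OF 1], OF z] by (rule absorb)
  qed
  have inv: "(d u, \<theta> d v) \<in> G" if d: "d \<in> D1" and uv: "(u, v) \<in> G" for d u v
  proof -
    have *: "ok (d u, \<theta> d v) (u', v')" if "ok (u, v) (u', v')" for u' v'
    proof -
      have "cinner ((e o\<^sub>L d) u) u' = cinner (\<theta> (e o\<^sub>L d) v) v'" if "e \<in> D1" for e
        using \<open>ok (u, v) (u', v')\<close> D1.closed_under(8)[OF that d] by (rule okD)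
      then show ?thesis unfolding ok_def using mult d by auto
    qed
    show ?thesis
    proof (rule absorb)
      show "ok (d u, \<theta> d v) z'" if "z' \<in> G" for z' using *[of "fst z'" "snd z'"] ok[OF uv that] by simp
      show "ok (d u, \<theta> d v) (d u, \<theta> d v)" by (intro * ok_sym[OF *] ok uv)
    qed
  qed
  have iso: "cinner u u' = cinner v v'" if "(u, v) \<in> G" "(u', v') \<in> G" for u v u' v'
    using okD[OF ok[OF that] D1.closed_under(2)] by (simp add: one)
  have norm_iso: "norm u = norm v" if "(u, v) \<in> G" for u v
  proof -
    have "complex_of_real ((norm u)\<^sup>2) = complex_of_real ((norm v)\<^sup>2)"
      using iso[OF that that] by (simp only: cinner_self)
    then show ?thesis by (simp only: of_real_eq_iff power2_eq_iff_nonneg norm_ge_zero)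
  qed
  have cfst: "csubspace (fst ` G)"
    using csubspace_image[OF G, of fst] by simp
  have csnd: "csubspace (snd ` G)"
    using csubspace_image[OF G, of snd] by simp
  have fst_inv: "d u \<in> closure (fst ` G)" if "d \<in> D1" "u \<in> closure (fst ` G)" for d u
  proof -
    have "blinfun_apply d ` closure (fst ` G) \<subseteq> closure (fst ` G)"
    proof (rule image_closure_subset)
      show "blinfun_apply d ` fst ` G \<subseteq> closure (fst ` G)"
        using inv[OF that(1)] closure_subset[of "fst ` G"] by force
    qed (auto intro: continuous_intros)
    then show ?thesis using that(2) by blast
  qed
  have snd_inv: "e v \<in> closure (snd ` G)" if ev: "e \<in> D2" "v \<in> closure (snd ` G)" for e v
  proof -
    obtain d where d: "d \<in> D1" "\<theta> d = e" using ev(1) by (rule surj)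
    have "blinfun_apply e ` closure (snd ` G) \<subseteq> closure (snd ` G)"
    proof (rule image_closure_subset)
      show "blinfun_apply e ` snd ` G \<subseteq> closure (snd ` G)"
        using inv[OF d(1)] closure_subset[of "snd ` G"] d(2) by force
    qed (auto intro: continuous_intros)
    then show ?thesis using ev(2) by blast
  qed
  have dense1: "closure (fst ` G) = UNIV"
  proof -
    obtain P where P: "P \<in> D1" "P \<in> projections" "\<And>u. u \<in> closure (fst ` G) \<Longrightarrow> P u = u"
      "\<And>u. P u \<in> closure (fst ` G)"
      using D1.ex_invariant_projection[OF csubspace_closure[OF cfst] closed_closure fst_inv] by metis
    have Pu: "P u = u" "\<theta> P v = v" if "(u, v) \<in> G" for u v
    proof -
      show 1: "P u = u" using P(3) that closure_subset by (metis fst_conv image_eqI subsetD)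
      have "(u, v) - (P u, \<theta> P v) \<in> G" using inv[OF P(1) that] that by (intro csubspaceD(4)[OF G])
      then have "(0, v - \<theta> P v) \<in> G" by (simp add: 1)
      then show "\<theta> P v = v" using norm_iso by fastforce
    qed
    \<comment> \<open>A matching pair found under 1 - P is compatible with all of \<open>G\<close>,
      since both inner products vanish: the components of \<open>G\<close> are fixed by
      \<open>P\<close> and \<open>\<theta> P\<close>, which kill the orbits of x and y. Absorbing
      the pair would force P x = x although P x = 0.\<close>
    have "id_blinfun - P = 0"
    proof (rule ccontr)
      assume ne: "id_blinfun - P \<noteq> 0"
      have p: "id_blinfun - P \<in> D1" "id_blinfun - P \<in> projections"
        using P D1.closed_under projections_complement by auto
      obtain x y where xy: "x \<noteq> 0" "(id_blinfun - P) x = x" "\<theta> (id_blinfun - P) y = y"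
        "\<And>d. d \<in> D1 \<Longrightarrow> cinner (d x) x = cinner (\<theta> d y) y"
        using ex_matching_vectors[OF p ne] by metis
      have Px: "P x = 0" using xy(2) by (simp add: op_apply)
      have Py: "\<theta> P y = 0" using xy(3) diff[OF D1.closed_under(2) P(1)] by (simp add: one op_apply)
      have "(x, y) \<in> G"
      proof (rule absorb)
        show "ok (x, y) (x, y)" using xy(4) by (auto simp: ok_def)
        fix z' assume "z' \<in> G"
        moreover obtain u v where z': "z' = (u, v)" by (cases z')
        ultimately have uv: "P u = u" "\<theta> P v = v" using Pu by auto
        have "cinner (d x) u = cinner (\<theta> d y) v" if d: "d \<in> D1" for d
        proof -
          have "cinner (d x) u = cinner (P (d x)) u"
            using is_adjointD(1)[OF projectionsD(3)[OF P(2)]] uv by metis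
          moreover have "P (d x) = 0" using D1.commute_apply[OF P(1) d] Px by (simp add: blinfun.zero_right)
          moreover have "cinner (\<theta> d y) v = cinner (\<theta> P (\<theta> d y)) v"
            using is_adjointD(1)[OF projectionsD(3)[OF projection[OF P(1,2)]]] uv by metis
          moreover have "\<theta> P (\<theta> d y) = 0"
            using D2.commute_apply[OF mem[OF P(1)] mem[OF d]] Py by (simp add: blinfun.zero_right)
          ultimately show ?thesis by simp
        qed
        then show "ok (x, y) z'" by (auto simp: ok_def z')
      qed
      then show False using Pu(1) Px xy(1) by metis
    qed
    then have "P u = u" for u by simp
    then show ?thesis using P(4) by (metis UNIV_eq_I)
  qed
  \<comment> \<open>No second enlargement argument is made. The projection onto the closure of the
    second components is \<open>\<theta> P\<close>; for (u, v) in \<open>G\<close> the pair (u - P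
    u, 0) is in \<open>G\<close>, so \<open>P\<close> is the identity on the dense first
    components.\<close>
  have dense2: "closure (snd ` G) = UNIV"
  proof -
    obtain Q where Q: "Q \<in> D2" "\<And>u. u \<in> closure (snd ` G) \<Longrightarrow> Q u = u" "\<And>u. Q u \<in> closure (snd ` G)"
      using D2.ex_invariant_projection[OF csubspace_closure[OF csnd] closed_closure snd_inv] by metis
    obtain P where P: "P \<in> D1" "\<theta> P = Q" using Q(1) by (rule surj)
    have "P u = id_blinfun u" if u: "u \<in> fst ` G" for u
    proof -
      obtain v where uv: "(u, v) \<in> G" using u by force
      then have "Q v = v" using Q(2) closure_subset by (metis snd_conv image_eqI subsetD)
      moreover have "(u, v) - (P u, \<theta> P v) \<in> G" using inv[OF P(1) uv] uv by (intro csubspaceD(4)[OF G])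
      ultimately have "(u - P u, 0) \<in> G" by (simp add: P)
      then show ?thesis using norm_iso by fastforce
    qed
    then have "P = id_blinfun" by (rule blinfun_eq_dense[OF dense1])
    then have "Q = id_blinfun" using P one by simp
    then show ?thesis using Q(3) by (metis UNIV_eq_I id_blinfun.rep_eq)
  qed
  have nV: "norm v \<le> 1 * norm u" if "(u, v) \<in> G" for u v using norm_iso[OF that] by simp
  obtain V where V: "V \<in> bounded_ops" "\<And>u v. (u, v) \<in> G \<Longrightarrow> blinfun_apply V u = v"
    using ex_bounded_op_graph[OF G nV dense1] by metis
  \<comment> \<open>The inverse comes from the transposed graph, on which the same norm identity
    holds.\<close>
  let ?G' = "prod.swap ` G"
  have "csubspace ?G'"
    by (intro csubspace_image[OF G]) (auto simp: scaleC_prod prod.swap_def)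
  moreover have "fst ` ?G' = snd ` G" by (simp add: image_image)
  moreover have "norm v \<le> 1 * norm u" if "(u, v) \<in> ?G'" for u v
  proof -
    have "(v, u) \<in> G" using that by auto
    then show ?thesis using norm_iso by fastforce
  qed
  ultimately obtain W where W: "W \<in> bounded_ops" "\<And>u v. (u, v) \<in> ?G' \<Longrightarrow> blinfun_apply W u = v"
    using ex_bounded_op_graph[of ?G' 1] dense2 by metis
  have W': "blinfun_apply W v = u" if "(u, v) \<in> G" for u v using W(2)[of v u] that by force
  show thesis
  proof (rule that[of V W])
    show "W o\<^sub>L V = id_blinfun"
      by (rule blinfun_eq_dense[OF dense1]) (auto simp: V W')
    show "V o\<^sub>L W = id_blinfun"
      by (rule blinfun_eq_dense[OF dense2]) (auto simp: V W')
    show "V o\<^sub>L d = \<theta> d o\<^sub>L V" if "d \<in> D1" for d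
      using V(2)[OF inv[OF that]] by (intro blinfun_eq_dense[OF dense1]) (auto simp: V)
    have 1: "cinner (V u) v' = cinner u u'" if "(u', v') \<in> G" for u u' v'
    proof -
      have "closed {u. cinner (V u) v' = cinner u u'}" by (intro closed_Collect_eq continuous_intros)
      moreover have "fst ` G \<subseteq> {u. cinner (V u) v' = cinner u u'}"
        using iso[OF _ that] V(2) by auto
      ultimately show ?thesis using dense1 closure_minimal by blast
    qed
    show "is_adjoint V W" unfolding is_adjoint_def
    proof (intro allI)
      fix u v
      have "closed {v. cinner (V u) v = cinner u (W v)}" by (intro closed_Collect_eq continuous_intros)
      moreover have "snd ` G \<subseteq> {v. cinner (V u) v = cinner u (W v)}"
        using 1 W' by auto
      ultimately show "cinner (V u) v = cinner u (W v)" using dense2 closure_minimal by blast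
    qed
  qed
qed

end

section \<open>Invariant projections\<close>

text \<open>Lat A, with closed invariant subspaces represented by their projections.\<close>

definition invariant_projections ::
  "('a::chilbert_space \<Rightarrow>\<^sub>L 'a) set \<Rightarrow> ('a \<Rightarrow>\<^sub>L 'a) set" where
  "invariant_projections A = {P \<in> projections. \<forall>T\<in>A. P o\<^sub>L (T o\<^sub>L P) = T o\<^sub>L P}"

lemma Alg_iff:
  "T \<in> Alg L \<longleftrightarrow> T \<in> bounded_ops \<and> (\<forall>P\<in>L. P o\<^sub>L (T o\<^sub>L P) = T o\<^sub>L P)"
  by (auto simp: Alg_def compose_assoc compose_diff compose_id)

locale multiplicity_free_csl =
  fixes L :: "('a::chilbert_space \<Rightarrow>\<^sub>L 'a) set"
  assumes CSL: "CSL L" and mf: "multiplicity_free L"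
begin

abbreviation "D \<equiv> commutant L"

sublocale D: max_abelian_algebra D
  by standard (rule multiplicity_free_max_abelian[OF CSL mf])

lemma L_projections: "P \<in> L \<Longrightarrow> P \<in> projections"
  using CSL by (auto simp: CSL_def subspace_lattice_def)

lemma L_subset_D: "P \<in> L \<Longrightarrow> P \<in> D"
  using CSL L_projections projectionsD(1) by (auto simp: commutant_def CSL_def)

lemma D_subset_Alg: assumes d: "d \<in> D" shows "d \<in> Alg L"
  unfolding Alg_iff
proof (intro conjI ballI)
  fix P assume P: "P \<in> L"
  have "P o\<^sub>L (d o\<^sub>L P) = (P o\<^sub>L P) o\<^sub>L d"
    using commutantD(2)[OF d P] by (simp add: compose_assoc)
  then show "P o\<^sub>L (d o\<^sub>L P) = d o\<^sub>L P"
    using commutantD(2)[OF d P] projectionsD(2)[OF L_projections[OF P]] by simp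
qed (use d in \<open>auto simp: commutant_def\<close>)

lemma Alg_id: "id_blinfun \<in> Alg L"
  using D_subset_Alg D.closed_under(2) by blast

lemma Alg_csubspace: "csubspace (Alg L)"
proof (rule csubspaceI)
  fix c T assume T: "T \<in> Alg L"
  have "P o\<^sub>L ((c *\<^sub>C T) o\<^sub>L P) = (c *\<^sub>C T) o\<^sub>L P" if "P \<in> L" for P
    using T that L_projections[OF that]
    by (simp add: Alg_iff compose_scaleC compose_scaleC_right projectionsD(1))
  then show "c *\<^sub>C T \<in> Alg L" using T by (simp add: Alg_iff)
qed (auto simp: Alg_iff compose_add compose_zero)

lemma Alg_closed: "closed (Alg L)"
proof -
  have eq: "Alg L = bounded_ops \<inter> (\<Inter>P\<in>L. {T. P o\<^sub>L (T o\<^sub>L P) = T o\<^sub>L P})"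
    by (auto simp: Alg_iff)
  show ?thesis unfolding eq
    by (intro closed_Int closed_bounded_ops closed_INT ballI closed_Collect_eq
        bounded_bilinear.continuous_on[OF bounded_bilinear_blinfun_compose]
        continuous_on_const continuous_on_id)
qed

lemma Alg_compose: assumes S: "S \<in> Alg L" and T: "T \<in> Alg L" shows "S o\<^sub>L T \<in> Alg L"
  unfolding Alg_iff
proof (intro conjI ballI)
  fix P assume "P \<in> L"
  then have "P o\<^sub>L (S o\<^sub>L P) = S o\<^sub>L P" "P o\<^sub>L (T o\<^sub>L P) = T o\<^sub>L P"
    using S T by (auto simp: Alg_iff)
  then show "P o\<^sub>L ((S o\<^sub>L T) o\<^sub>L P) = (S o\<^sub>L T) o\<^sub>L P" by (metis compose_assoc)
qed (use S T in \<open>auto simp: Alg_iff\<close>)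

text \<open>PTP = TP holds for T, and the adjoint of PSP = SP reads PTP = PT.\<close>

lemma diagonal_mem:
  assumes T: "T \<in> Alg L" and S: "S \<in> Alg L" and adj: "is_adjoint T S"
  shows "T \<in> D"
  unfolding commutant_def
proof (intro CollectI conjI ballI)
  fix P assume P: "P \<in> L"
  have Pp: "is_adjoint P P" using L_projections[OF P] projectionsD by blast
  have "P o\<^sub>L (S o\<^sub>L P) = S o\<^sub>L P" "P o\<^sub>L (T o\<^sub>L P) = T o\<^sub>L P"
    using S T P by (auto simp: Alg_iff)
  moreover have "is_adjoint (P o\<^sub>L (T o\<^sub>L P)) ((P o\<^sub>L S) o\<^sub>L P)"
    by (intro is_adjoint_compose Pp adj)
  moreover have "is_adjoint (P o\<^sub>L T) (S o\<^sub>L P)"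
    by (intro is_adjoint_compose Pp adj)
  ultimately show "T o\<^sub>L P = P o\<^sub>L T"
    by (metis compose_assoc is_adjoint_commute is_adjoint_unique)
qed (use T in \<open>simp add: Alg_iff\<close>)

lemma L_invariant: "P \<in> L \<Longrightarrow> P \<in> invariant_projections (Alg L)"
  using L_projections by (auto simp: invariant_projections_def Alg_iff)

end

text \<open>
  Only \<open>Alg (Lat (Alg L)) = Alg L\<close> is needed here, not Arveson's theorem that \<open>L\<close> is reflexive.
\<close>

lemma unitarily_equivalent_Alg:
  fixes L1 :: "('a::chilbert_space \<Rightarrow>\<^sub>L 'a) set" and L2 :: "('b::chilbert_space \<Rightarrow>\<^sub>L 'b) set"
    and R :: "('a \<Rightarrow>\<^sub>L 'a) \<Rightarrow> ('b \<Rightarrow>\<^sub>L 'b) \<Rightarrow> bool"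
  assumes "multiplicity_free_csl L1" and "multiplicity_free_csl L2"
    and dom: "\<And>d c. R d c \<Longrightarrow> d \<in> commutant L1 \<and> c \<in> commutant L2"
    and left_total: "\<And>d. d \<in> commutant L1 \<Longrightarrow> \<exists>c. R d c"
    and right_total: "\<And>c. c \<in> commutant L2 \<Longrightarrow> \<exists>d. R d c"
    and right_unique: "\<And>d c c'. R d c \<Longrightarrow> R d c' \<Longrightarrow> c = c'"
    and left_unique: "\<And>d d' c. R d c \<Longrightarrow> R d' c \<Longrightarrow> d = d'"
    and add: "\<And>d c d' c'. R d c \<Longrightarrow> R d' c' \<Longrightarrow> R (d + d') (c + c')"
    and scale: "\<And>d c a. R d c \<Longrightarrow> R (a *\<^sub>C d) (a *\<^sub>C c)"
    and mult: "\<And>d c d' c'. R d c \<Longrightarrow> R d' c' \<Longrightarrow> R (d o\<^sub>L d') (c o\<^sub>L c')"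
    and selfadjoint: "\<And>d c. R d c \<Longrightarrow> is_adjoint d d \<Longrightarrow> is_adjoint c c"
    and lat: "\<And>P Q. R P Q \<Longrightarrow>
      P \<in> invariant_projections (Alg L1) \<longleftrightarrow> Q \<in> invariant_projections (Alg L2)"
  shows "unitarily_equivalent (Alg L1) (Alg L2)"
proof -
  interpret A: multiplicity_free_csl L1 by fact
  interpret B: multiplicity_free_csl L2 by fact
  \<comment> \<open>The relational hypotheses cover the plain case, where \<open>R\<close> is the
    restriction of the isomorphism, and the stabilized case, where it is only described through its
    action as a multiplier.\<close>
  define \<theta> where "\<theta> d = (THE c. R d c)" for d
  have R\<theta>: "R d (\<theta> d)" if "d \<in> A.D" for d
    using left_total[OF that] right_unique unfolding \<theta>_def by (metis theI)
  have \<theta>: "\<theta> d = c" if "R d c" for d c using right_unique[OF R\<theta> that] dom[OF that] by blast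
  interpret I: max_abelian_iso A.D B.D \<theta>
  proof
    show "bij_betw \<theta> A.D B.D"
      unfolding bij_betw_def
    proof
      show "inj_on \<theta> A.D" using R\<theta> left_unique by (metis inj_onI)
      show "\<theta> ` A.D = B.D"
      proof
        show "\<theta> ` A.D \<subseteq> B.D" using R\<theta> dom by blast
        show "B.D \<subseteq> \<theta> ` A.D" using dom right_total \<theta> by (metis image_eqI subsetI)
      qed
    qed
    fix d e assume d: "d \<in> A.D" and e: "e \<in> A.D"
    show "\<theta> (d + e) = \<theta> d + \<theta> e" "\<theta> (d o\<^sub>L e) = \<theta> d o\<^sub>L \<theta> e"
      by (rule \<theta>[OF add[OF R\<theta>[OF d] R\<theta>[OF e]]], rule \<theta>[OF mult[OF R\<theta>[OF d] R\<theta>[OF e]]])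
    \<comment> \<open>Only self-adjoint elements are known to be preserved; an arbitrary adjoint
      pair is written as h + ik and h - ik.\<close>
    assume de: "is_adjoint d e"
    then obtain h k where hk: "is_adjoint h h" "is_adjoint k k" "d = h + \<i> *\<^sub>C k" "e = h - \<i> *\<^sub>C k"
      "h = (1/2) *\<^sub>C (d + e)" "k = (- \<i> / 2) *\<^sub>C (d - e)" by (rule selfadjoint_parts)
    have h: "h \<in> A.D" "k \<in> A.D" by (simp_all add: hk(5,6) d e A.D.closed_under)
    then have "is_adjoint (\<theta> h) (\<theta> h)" "is_adjoint (\<theta> k) (\<theta> k)" using selfadjoint R\<theta> hk by blast+
    moreover have "\<theta> d = \<theta> h + \<i> *\<^sub>C \<theta> k"
      unfolding hk(3) by (rule \<theta>[OF add[OF R\<theta>[OF h(1)] scale[OF R\<theta>[OF h(2)]]]])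
    moreover have "\<theta> e = \<theta> h + cnj \<i> *\<^sub>C \<theta> k"
    proof -
      have "e = h + cnj \<i> *\<^sub>C k" by (simp add: hk(4) scaleC_minus_left)
      then show ?thesis by (simp only:) (rule \<theta>[OF add[OF R\<theta>[OF h(1)] scale[OF R\<theta>[OF h(2)]]]])
    qed
    ultimately show "is_adjoint (\<theta> d) (\<theta> e)"
      by (simp only:) (intro is_adjoint_add is_adjoint_scaleC)
  next
    fix d c assume "d \<in> A.D"
    then show "\<theta> (c *\<^sub>C d) = c *\<^sub>C \<theta> d" by (rule \<theta>[OF scale[OF R\<theta>]])
  qed
  obtain V W where VW: "is_adjoint V W" "V o\<^sub>L W = id_blinfun" "W o\<^sub>L V = id_blinfun"
    and V: "\<And>d. d \<in> A.D \<Longrightarrow> V o\<^sub>L d = \<theta> d o\<^sub>L V"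
    using I.ex_spatial_implementation by metis
  have W: "d o\<^sub>L W = W o\<^sub>L \<theta> d" if "d \<in> A.D" for d
    using V[OF that] VW by (metis compose_assoc compose_id)
  have Vb: "V \<in> bounded_ops" "W \<in> bounded_ops" using VW(1) is_adjoint_bounded_ops by auto
  have 1: "V o\<^sub>L (T o\<^sub>L W) \<in> Alg L2" if T: "T \<in> Alg L1" for T
    unfolding Alg_iff
  proof (intro conjI ballI)
    fix Q assume Q: "Q \<in> L2"
    then obtain P where P: "R P Q" using right_total B.L_subset_D by blast
    then have PD: "P \<in> A.D" "\<theta> P = Q" using dom \<theta> by auto
    have "P \<in> invariant_projections (Alg L1)" using lat[OF P] B.L_invariant[OF Q] by blast
    then have inv: "P o\<^sub>L (T o\<^sub>L P) = T o\<^sub>L P" using T by (auto simp: invariant_projections_def)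
    have WQ: "W o\<^sub>L Q = P o\<^sub>L W" using W[OF PD(1)] PD(2) by simp
    have QV: "Q o\<^sub>L V = V o\<^sub>L P" using V[OF PD(1)] PD(2) by simp
    have "Q o\<^sub>L ((V o\<^sub>L (T o\<^sub>L W)) o\<^sub>L Q) = (Q o\<^sub>L V) o\<^sub>L (T o\<^sub>L (W o\<^sub>L Q))" by (simp add: compose_assoc)
    also have "\<dots> = V o\<^sub>L ((P o\<^sub>L (T o\<^sub>L P)) o\<^sub>L W)" by (simp only: WQ QV compose_assoc)
    also have "\<dots> = V o\<^sub>L (T o\<^sub>L (W o\<^sub>L Q))" by (simp only: inv WQ) (simp only: compose_assoc)
    finally show "Q o\<^sub>L ((V o\<^sub>L (T o\<^sub>L W)) o\<^sub>L Q) = (V o\<^sub>L (T o\<^sub>L W)) o\<^sub>L Q" by (simp add: compose_assoc)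
  qed (use Vb T in \<open>simp add: Alg_iff\<close>)
  have 2: "W o\<^sub>L (S o\<^sub>L V) \<in> Alg L1" if S: "S \<in> Alg L2" for S
    unfolding Alg_iff
  proof (intro conjI ballI)
    fix P assume P: "P \<in> L1"
    then have PD: "P \<in> A.D" by (rule A.L_subset_D)
    have "\<theta> P \<in> invariant_projections (Alg L2)" using lat[OF R\<theta>[OF PD]] A.L_invariant[OF P] by blast
    then have inv: "\<theta> P o\<^sub>L (S o\<^sub>L \<theta> P) = S o\<^sub>L \<theta> P" using S by (auto simp: invariant_projections_def)
    have "P o\<^sub>L ((W o\<^sub>L (S o\<^sub>L V)) o\<^sub>L P) = (P o\<^sub>L W) o\<^sub>L (S o\<^sub>L (V o\<^sub>L P))" by (simp add: compose_assoc)
    also have "\<dots> = W o\<^sub>L ((\<theta> P o\<^sub>L (S o\<^sub>L \<theta> P)) o\<^sub>L V)" by (simp only: W[OF PD] V[OF PD] compose_assoc)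
    also have "\<dots> = W o\<^sub>L (S o\<^sub>L (V o\<^sub>L P))" by (simp only: inv V[OF PD]) (simp only: compose_assoc)
    finally show "P o\<^sub>L ((W o\<^sub>L (S o\<^sub>L V)) o\<^sub>L P) = (W o\<^sub>L (S o\<^sub>L V)) o\<^sub>L P" by (simp add: compose_assoc)
  qed (use Vb S in \<open>simp add: Alg_iff\<close>)
  have 3: "S = V o\<^sub>L ((W o\<^sub>L (S o\<^sub>L V)) o\<^sub>L W)" for S
    using VW by (metis compose_assoc compose_id)
  have "Alg L2 = {V o\<^sub>L T o\<^sub>L W | T. T \<in> Alg L1}"
    unfolding compose_assoc using 1 2 3 by blast
  then show ?thesis unfolding unitarily_equivalent_def
    using VW Vb is_adjoint_commute by blast
qed


section \<open>Isometric isomorphisms preserve self-adjointness\<close>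

text \<open>As m lives in the corner of e, only z = e x matters, and (e + itm)z = z + itmz. The part
  of the squared norm linear in t is a multiple of Im <mz,z>; a bound quadratic in t forces it to
  vanish. A projection e in place of the identity makes the criterion usable without a unit.\<close>

lemma selfadjoint_if_norm_bound:
  fixes m :: "'a::complex_inner \<Rightarrow>\<^sub>L 'a"
  assumes e: "e \<in> projections" and m: "m \<in> bounded_ops" "e o\<^sub>L m = m" "m o\<^sub>L e = m"
    and bound: "\<And>t::real. (norm (e + (\<i> * t) *\<^sub>C m))\<^sup>2 \<le> 1 + t\<^sup>2 * K"
  shows "is_adjoint m m"
proof (rule is_adjoint_selfI[OF m(1)])
  fix x
  define z where "z = e x"
  have ez: "e z = z" by (simp add: z_def projectionsD(4)[OF e])
  have "cinner (m x) x = cinner (e (m (e x))) x"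
    using m(2,3) by (metis blinfun_apply_blinfun_compose)
  also have "\<dots> = cinner (m z) z"
    by (simp add: z_def is_adjointD(1)[OF projectionsD(3)[OF e]])
  finally have eq: "cinner (m x) x = cinner (m z) z" .
  define s where "s = Im (cinner (m z) z)"
  have t: "2 * t * s \<le> t\<^sup>2 * (K * (norm z)\<^sup>2)" for t :: real
  proof -
    \<comment> \<open>The sign of t is reversed so that the linear term becomes +2ts.\<close>
    let ?a = "e + (\<i> * (- t)) *\<^sub>C m"
    have "?a z = z + (\<i> * (- t)) *\<^sub>C m z" by (simp add: op_apply ez)
    have "(norm z)\<^sup>2 + 2 * Re (cinner z ((\<i> * (- t)) *\<^sub>C m z)) + (norm ((\<i> * (- t)) *\<^sub>C m z))\<^sup>2
        = (norm (?a z))\<^sup>2"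
      by (simp only: norm_add_square \<open>?a z = _\<close>)
    also have "\<dots> \<le> (norm ?a * norm z)\<^sup>2" by (intro power_mono norm_blinfun norm_ge_zero)
    also have "\<dots> \<le> (1 + t\<^sup>2 * K) * (norm z)\<^sup>2"
      using bound[of "-t"] unfolding power_mult_distrib
      by (intro mult_right_mono) auto
    finally have "2 * Re (cinner z ((\<i> * (- t)) *\<^sub>C m z)) + (norm ((\<i> * (- t)) *\<^sub>C m z))\<^sup>2
      \<le> t\<^sup>2 * (K * (norm z)\<^sup>2)" by (simp add: algebra_simps)
    moreover have "0 \<le> (norm ((\<i> * (- t)) *\<^sub>C m z))\<^sup>2" by simp
    moreover have "cinner z (m z) = cnj (cinner (m z) z)" by (rule cinner_commute)
    then have "Re (cinner z ((\<i> * (- t)) *\<^sub>C m z)) = t * s"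
      by (simp add: cinner_scaleC_right cinner_minus(2) s_def)
    ultimately show ?thesis by linarith
  qed
  have "s = 0"
  proof (rule ccontr)
    assume s: "s \<noteq> 0"
    \<comment> \<open>At t = s/M the inequality reads 2s^2/M \<le> s^2/M. M dominates K||z||^2 and
      is at least 1, so the quotient is meaningful.\<close>
    define M where "M = \<bar>K * (norm z)\<^sup>2\<bar> + 1"
    have M: "0 < M" "K * (norm z)\<^sup>2 \<le> M" by (auto simp: M_def)
    have "2 * (s / M) * s \<le> (s / M)\<^sup>2 * (K * (norm z)\<^sup>2)" by (rule t)
    also have "\<dots> \<le> (s / M)\<^sup>2 * M" using M by (intro mult_left_mono) auto
    also have "\<dots> = (s / M) * s" using M by (simp add: power2_eq_square)
    finally have "(s * s) / M \<le> 0" by simp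
    then show False using s M by (auto simp: divide_le_0_iff mult_le_0_iff)
  qed
  then show "Im (cinner (m x) x) = 0" by (simp add: eq s_def)
qed

text \<open><fx, gx> = <x, gx> is real, so the cross term with the factor it disappears and ||(f +
  itg)x||^2 = ||fx||^2 + t^2 ||gx||^2. Together with the preceding criterion this describes
  self-adjointness by norms alone, hence in a form that isometries preserve.\<close>

lemma norm_bound_if_selfadjoint:
  fixes g :: "'a::complex_inner \<Rightarrow>\<^sub>L 'a"
  assumes f: "f \<in> projections" and g: "is_adjoint g g" "f o\<^sub>L g = g"
  shows "(norm (f + (\<i> * complex_of_real t) *\<^sub>C g))\<^sup>2 \<le> 1 + t\<^sup>2 * (norm g)\<^sup>2"
proof -
  have "norm (f + (\<i> * complex_of_real t) *\<^sub>C g) \<le> sqrt (1 + t\<^sup>2 * (norm g)\<^sup>2)"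
  proof (rule norm_blinfun_bound)
    fix x
    have "cinner (f x) (g x) = cinner x (g x)"
      using is_adjointD(1)[OF projectionsD(3)[OF f]] g(2) by (metis blinfun_apply_blinfun_compose)
    also have "Im \<dots> = 0"
      using is_adjointD(1)[OF g(1), of x x] cinner_commute[of x "g x"] by (simp add: complex_eq_iff)
    finally have "Re (cinner (f x) ((\<i> * complex_of_real t) *\<^sub>C g x)) = 0"
      by (simp add: cinner_scaleC_right)
    then have "(norm ((f + (\<i> * complex_of_real t) *\<^sub>C g) x))\<^sup>2 = (norm (f x))\<^sup>2 + t\<^sup>2 * (norm (g x))\<^sup>2"
      by (simp add: op_apply norm_add_square norm_scaleC norm_mult power_mult_distrib)
    also have "\<dots> \<le> (norm x)\<^sup>2 + t\<^sup>2 * (norm g * norm x)\<^sup>2"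
      by (intro add_mono mult_left_mono power_mono norm_projection f norm_blinfun norm_ge_zero) simp
    also have "\<dots> = (1 + t\<^sup>2 * (norm g)\<^sup>2) * (norm x)\<^sup>2"
      by (simp add: algebra_simps power_mult_distrib)
    also have "\<dots> = (sqrt (1 + t\<^sup>2 * (norm g)\<^sup>2) * norm x)\<^sup>2"
      by (simp add: power_mult_distrib)
    finally show "norm ((f + (\<i> * complex_of_real t) *\<^sub>C g) x) \<le> sqrt (1 + t\<^sup>2 * (norm g)\<^sup>2) * norm x"
      by (rule power2_le_imp_le) simp
  qed simp
  then have "(norm (f + (\<i> * complex_of_real t) *\<^sub>C g))\<^sup>2 \<le> (sqrt (1 + t\<^sup>2 * (norm g)\<^sup>2))\<^sup>2"
    by (intro power_mono) auto
  then show ?thesis by simp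
qed

text \<open>For v in the kernel, fu is the image of fu - cv, so ||fu|| \<le> ||fu - cv|| for all c.
  Hence the range is orthogonal to the kernel.\<close>

lemma contractive_idempotent_projection:
  fixes f :: "'a::complex_inner \<Rightarrow>\<^sub>L 'a"
  assumes f: "f \<in> bounded_ops" "f o\<^sub>L f = f" "norm f \<le> 1"
  shows "f \<in> projections"
proof (rule projectionsI[OF f(2)])
  have ff: "f (f x) = f x" for x using f(2) by (metis blinfun_apply_blinfun_compose)
  have orth: "cinner (f u) v = 0" if v: "f v = 0" for u v
  proof (rule orthogonal_if_norm_minimal)
    fix c
    have "f (f u - c *\<^sub>C v) = f u" using v bounded_ops_scaleC[OF f(1)] by (simp add: op_apply ff)
    then have "norm (f u) \<le> norm f * norm (f u - c *\<^sub>C v)"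
      using norm_blinfun[of f "f u - c *\<^sub>C v"] by simp
    also have "\<dots> \<le> 1 * norm (f u - c *\<^sub>C v)" using f(3) by (intro mult_right_mono) auto
    finally show "norm (f u) \<le> norm (f u - c *\<^sub>C v)" by simp
  qed
  have "cinner (f x) (y - f y) = 0" "cinner (x - f x) (f y) = 0" for x y
    using orth[of "y - f y" x] orth[of "x - f x" y] cinner_eq_0_commute by (auto simp: op_apply ff)
  then show "is_adjoint f f" unfolding is_adjoint_def by (simp add: cinner_diff)
qed

text \<open>Surjectivity gives \<phi>(1) = 1, so the norm criterion relative to the identity carries
  self-adjoint elements both ways. They span the diagonals, which \<phi> therefore matches.\<close>

lemma unitarily_equivalent_if_isometrically_isomorphic:
  assumes L1: "multiplicity_free_csl L1" and L2: "multiplicity_free_csl L2"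
    and iso: "isometrically_isomorphic (Alg L1) (Alg L2)"
  shows "unitarily_equivalent (Alg L1) (Alg L2)"
proof -
  interpret A: multiplicity_free_csl L1 by fact
  interpret B: multiplicity_free_csl L2 by fact
  obtain \<phi> where hom: "algebra_hom_on (Alg L1) \<phi>" and surj: "\<phi> ` Alg L1 = Alg L2"
    and isom: "isometric_on (Alg L1) \<phi>"
    using iso unfolding isometrically_isomorphic_def by blast
  have add: "\<phi> (S + T) = \<phi> S + \<phi> T" and mult: "\<phi> (S o\<^sub>L T) = \<phi> S o\<^sub>L \<phi> T"
    if "S \<in> Alg L1" "T \<in> Alg L1" for S T
    using hom that by (auto simp: algebra_hom_on_def)
  have scale: "\<phi> (c *\<^sub>C S) = c *\<^sub>C \<phi> S" if "S \<in> Alg L1" for S c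
    using hom that by (auto simp: algebra_hom_on_def)
  have nrm: "norm (\<phi> S) = norm S" if "S \<in> Alg L1" for S
    using isom that by (auto simp: isometric_on_def)
  note Asub = csubspaceD[OF A.Alg_csubspace]
  have mem: "\<phi> S \<in> Alg L2" if "S \<in> Alg L1" for S using surj that by blast
  have inj: "S = T" if "S \<in> Alg L1" "T \<in> Alg L1" "\<phi> S = \<phi> T" for S T
  proof -
    have "S = T + (S - T)" by simp
    then have "\<phi> S = \<phi> T + \<phi> (S - T)" using add that Asub(4) by metis
    then show ?thesis using nrm[OF Asub(4)[OF that(1,2)]] that(3) by simp
  qed
  have one: "\<phi> id_blinfun = id_blinfun"
  proof -
    obtain T where "T \<in> Alg L1" "\<phi> T = id_blinfun" using surj B.Alg_id by (metis imageE)
    then show ?thesis using mult[OF A.Alg_id, of T] by (simp add: compose_id)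
  qed
  have idp: "id_blinfun \<in> projections" by (intro projectionsI is_adjoint_id) (simp add: compose_id)
  have norm_eq: "norm (id_blinfun + c *\<^sub>C T) = norm (id_blinfun + c *\<^sub>C \<phi> T)" if "T \<in> Alg L1" for c T
    using nrm[OF Asub(2)[OF A.Alg_id Asub(3)[OF that]]] add[OF A.Alg_id Asub(3)[OF that]] scale[OF that]
    by (simp add: one)
  have sa1: "is_adjoint (\<phi> T) (\<phi> T)" if T: "T \<in> Alg L1" "is_adjoint T T" for T
    using norm_bound_if_selfadjoint[OF idp T(2)] mem[OF T(1)]
    by (intro selfadjoint_if_norm_bound[OF idp]) (auto simp: compose_id Alg_iff simp flip: norm_eq[OF T(1)])
  have sa2: "is_adjoint T T" if T: "T \<in> Alg L1" "is_adjoint (\<phi> T) (\<phi> T)" for T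
    using norm_bound_if_selfadjoint[OF idp T(2)] T(1)
    by (intro selfadjoint_if_norm_bound[OF idp]) (auto simp: compose_id Alg_iff norm_eq[OF T(1)])
  define R where "R d c \<longleftrightarrow> d \<in> A.D \<and> c \<in> B.D \<and> \<phi> d = c" for d c
  have left: "\<phi> d \<in> B.D" if d: "d \<in> A.D" for d
  proof -
    obtain e where e: "e \<in> A.D" "is_adjoint d e" using d by (rule A.D.ex_adj)
    obtain h k where hk: "is_adjoint h h" "is_adjoint k k" "d = h + \<i> *\<^sub>C k"
      "h = (1/2) *\<^sub>C (d + e)" "k = (- \<i> / 2) *\<^sub>C (d - e)" using selfadjoint_parts[OF e(2)] by metis
    have h: "h \<in> A.D" "k \<in> A.D" by (simp_all add: hk(4,5) d e A.D.closed_under)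
    then have hA: "h \<in> Alg L1" "k \<in> Alg L1" using A.D_subset_Alg by auto
    then have "\<phi> h \<in> B.D" "\<phi> k \<in> B.D" using hk sa1 mem B.diagonal_mem by blast+
    moreover have "\<phi> d = \<phi> h + \<i> *\<^sub>C \<phi> k" unfolding hk(3) using hA Asub by (simp add: add scale)
    ultimately show ?thesis by (simp only:) (intro B.D.closed_under)
  qed
  have right: "\<exists>d\<in>A.D. \<phi> d = c" if c: "c \<in> B.D" for c
  proof -
    obtain e where e: "e \<in> B.D" "is_adjoint c e" using c by (rule B.D.ex_adj)
    obtain h k where hk: "is_adjoint h h" "is_adjoint k k" "c = h + \<i> *\<^sub>C k"
      "h = (1/2) *\<^sub>C (c + e)" "k = (- \<i> / 2) *\<^sub>C (c - e)" using selfadjoint_parts[OF e(2)] by metis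
    have "h \<in> B.D" "k \<in> B.D" by (simp_all add: hk(4,5) c e B.D.closed_under)
    then have "h \<in> Alg L2" "k \<in> Alg L2" using B.D_subset_Alg by auto
    then obtain h' k' where h': "h' \<in> Alg L1" "\<phi> h' = h" "k' \<in> Alg L1" "\<phi> k' = k"
      using surj by (metis imageE)
    then have "h' \<in> A.D" "k' \<in> A.D" using hk sa2 A.diagonal_mem by blast+
    then have "h' + \<i> *\<^sub>C k' \<in> A.D" by (intro A.D.closed_under)
    moreover have "\<phi> (h' + \<i> *\<^sub>C k') = c" unfolding hk(3) using h' Asub by (simp add: add scale)
    ultimately show ?thesis by blast
  qed
  note D1A = A.D_subset_Alg
  show ?thesis
  proof (rule unitarily_equivalent_Alg[OF L1 L2, where R = R])
    fix P Q assume "R P Q"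
    then have P: "P \<in> Alg L1" and Q: "\<phi> P = Q" using D1A by (auto simp: R_def)
    have inv: "P o\<^sub>L (T o\<^sub>L P) = T o\<^sub>L P \<longleftrightarrow> Q o\<^sub>L (\<phi> T o\<^sub>L Q) = \<phi> T o\<^sub>L Q" if T: "T \<in> Alg L1" for T
    proof -
      have "\<phi> (P o\<^sub>L (T o\<^sub>L P)) = Q o\<^sub>L (\<phi> T o\<^sub>L Q)" "\<phi> (T o\<^sub>L P) = \<phi> T o\<^sub>L Q"
        using P T A.Alg_compose by (simp_all add: mult Q)
      then show ?thesis using inj P T A.Alg_compose by metis
    qed
    have "P \<in> projections \<longleftrightarrow> Q \<in> projections"
      using sa1[OF P] sa2[OF P] mult[OF P P] inj[OF A.Alg_compose[OF P P] P]
      by (auto simp: Q projectionsD intro!: projectionsI)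
    then show "P \<in> invariant_projections (Alg L1) \<longleftrightarrow> Q \<in> invariant_projections (Alg L2)"
      unfolding invariant_projections_def using inv by (auto simp flip: surj)
  next
    show "\<And>d c. R d c \<Longrightarrow> is_adjoint d d \<Longrightarrow> is_adjoint c c" using sa1 D1A by (auto simp: R_def)
    show "\<And>d d' c. R d c \<Longrightarrow> R d' c \<Longrightarrow> d = d'" using inj D1A by (auto simp: R_def)
  qed (use left right add mult scale D1A A.D.closed_under B.D.closed_under in \<open>auto simp: R_def\<close>)
qed

section \<open>Hilbert space tensor products\<close>

locale hilbert_tensor_product =
  fixes t :: "'h::chilbert_space \<Rightarrow> 'k::chilbert_space \<Rightarrow> 't::chilbert_space"
  assumes tensor: "hilbert_tensor t"
begin

lemma tensor_linear:
  "t (x + x') y = t x y + t x' y" "t (c *\<^sub>C x) y = c *\<^sub>C t x y"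
  "t x (y + y') = t x y + t x y'" "t x (c *\<^sub>C y) = c *\<^sub>C t x y"
  using tensor by (auto simp: hilbert_tensor_def cbilinear_def Vector_Spaces.linear_iff)

lemma tensor_zero [simp]: "t 0 y = 0" "t x 0 = 0"
  using tensor_linear(2)[of 0 0 y] tensor_linear(4)[of x 0 0] by auto

lemma cinner_tensor: "cinner (t x y) (t x' y') = cinner x x' * cinner y y'"
  using tensor by (simp add: hilbert_tensor_def)

lemma norm_tensor: "norm (t x y) = norm x * norm y"
proof -
  have "complex_of_real ((norm (t x y))\<^sup>2) = complex_of_real ((norm x * norm y)\<^sup>2)"
    using cinner_tensor[of x y x y] by (simp add: cinner_self power_mult_distrib)
  then have "(norm (t x y))\<^sup>2 = (norm x * norm y)\<^sup>2" by (simp only: of_real_eq_iff)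
  then show ?thesis by simp
qed

lemma dense_csubspace:
  assumes "csubspace M" "\<And>x y. t x y \<in> M"
  shows "closure M = UNIV"
proof -
  have "cspan {t x y | x y. True} \<subseteq> M"
    using assms by (intro complex_vector.span_minimal) auto
  then have "closure (cspan {t x y | x y. True}) \<subseteq> closure M" by (rule closure_mono)
  then show ?thesis using tensor by (auto simp: hilbert_tensor_def)
qed

lemma op_eqI:
  assumes A: "A \<in> bounded_ops" and B: "B \<in> bounded_ops"
    and eq: "\<And>x y. blinfun_apply A (t x y) = blinfun_apply B (t x y)"
  shows "A = B"
proof (rule blinfun_eq_dense[OF dense_csubspace])
  show "csubspace {z. blinfun_apply A z = blinfun_apply B z}"
    by (rule csubspaceI) (auto simp: op_apply bounded_ops_scaleC A B)
qed (use eq in auto)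

lemma vec_eq_0I:
  assumes "\<And>x y. cinner z (t x y) = 0"
  shows "z = 0"
proof -
  have "csubspace {w. cinner w z = 0}" by (rule csubspaceI) (auto simp: cinner_simps)
  then have "closure {w. cinner w z = 0} = UNIV"
    using assms cinner_eq_0_commute by (intro dense_csubspace) auto
  then have "z \<in> {w. cinner w z = 0}" using closure_closed[OF closed_orthogonal[of z]] by simp
  then show ?thesis by simp
qed

section \<open>Legs, slices and tensors with rank one operators\<close>

definition leg :: "'k \<Rightarrow> 'h \<Rightarrow>\<^sub>L 't" where
  "leg u = Blinfun (\<lambda>x. t x u)"

lemma leg_apply [simp]: "leg u x = t x u"
proof -
  have "bounded_linear (\<lambda>x. t x u)"
    by (rule bounded_linear_intro[where K = "norm u"])
      (auto simp: tensor_linear scaleR_scaleC norm_tensor)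
  then show ?thesis by (simp add: leg_def bounded_linear_Blinfun_apply)
qed

lemma leg_bounded: "leg u \<in> bounded_ops"
  by (rule bounded_opsI) (simp add: tensor_linear)

text \<open>The partial inner product x \<otimes> y \<mapsto> <y,u> x. Placing an operator between
  \<open>leg_adj v\<close> and \<open>leg u\<close> yields its slice, one entry of its operator
  matrix.\<close>

definition leg_adj :: "'k \<Rightarrow> 't \<Rightarrow>\<^sub>L 'h" where
  "leg_adj u = (SOME S. is_adjoint (leg u) S)"

lemma leg_adj: "is_adjoint (leg u) (leg_adj u)"
  unfolding leg_adj_def using ex_adjoint[OF leg_bounded] by (metis someI)

lemma leg_adj_bounded: "leg_adj u \<in> bounded_ops"
  using is_adjoint_bounded_ops(2)[OF leg_adj] .

lemma leg_adj_tensor [simp]: "leg_adj v (t x y) = cinner y v *\<^sub>C x"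
  by (rule cinner_ext) (simp add: is_adjointD(2)[OF leg_adj] cinner_tensor cinner_scaleC_left)

lemma leg_adj_leg: "leg_adj v o\<^sub>L leg u = cinner u v *\<^sub>C id_blinfun"
  by (rule blinfun_eqI) (simp add: scaleC_blinfun.rep_eq)

text \<open>\<open>elem S u v\<close> is the tensor product of \<open>S\<close> with the rank one operator \<open>y \<mapsto> \<langle>y, v\<rangle> u\<close>.\<close>

definition elem :: "('h \<Rightarrow>\<^sub>L 'h) \<Rightarrow> 'k \<Rightarrow> 'k \<Rightarrow> 't \<Rightarrow>\<^sub>L 't" where
  "elem S u v = leg u o\<^sub>L (S o\<^sub>L leg_adj v)"

lemma elem_bounded: "S \<in> bounded_ops \<Longrightarrow> elem S u v \<in> bounded_ops"
  by (simp add: elem_def leg_bounded leg_adj_bounded)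

lemma elem_tensor: "S \<in> bounded_ops \<Longrightarrow> elem S u v (t x y) = cinner y v *\<^sub>C t (S x) u"
  by (simp add: elem_def bounded_ops_scaleC tensor_linear)

lemma elem_compose: "S \<in> bounded_ops \<Longrightarrow> elem S u v o\<^sub>L elem S' u' v' = cinner u' v *\<^sub>C elem (S o\<^sub>L S') u v'"
proof -
  assume S: "S \<in> bounded_ops"
  have "elem S u v o\<^sub>L elem S' u' v' = leg u o\<^sub>L (S o\<^sub>L ((leg_adj v o\<^sub>L leg u') o\<^sub>L (S' o\<^sub>L leg_adj v')))"
    by (simp add: elem_def compose_assoc)
  also have "\<dots> = cinner u' v *\<^sub>C elem (S o\<^sub>L S') u v'"
    by (simp add: leg_adj_leg compose_scaleC compose_id compose_scaleC_right S leg_bounded elem_def compose_assoc)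
  finally show ?thesis .
qed

lemma elem_adjoint: "is_adjoint S S' \<Longrightarrow> is_adjoint (elem S u v) (elem S' v u)"
  unfolding elem_def compose_assoc[symmetric, of _ S']
  using leg_adj is_adjoint_commute by (intro is_adjoint_compose) blast+

lemma elem_linear:
  assumes S: "S \<in> bounded_ops"
  shows "elem S (u + u') v = elem S u v + elem S u' v" "elem S (c *\<^sub>C u) v = c *\<^sub>C elem S u v"
    "elem S u (v + v') = elem S u v + elem S u v'" "elem S u (c *\<^sub>C v) = cnj c *\<^sub>C elem S u v"
  by (rule op_eqI; simp add: elem_bounded elem_tensor S op_apply tensor_linear cinner_simps
      scaleC_add_left scaleC_add_right scaleC_scaleC mult.commute)+

text \<open>A substitute for multiplication by a unit: \<open>leg u\<close> is injective for u
  \<noteq> 0, so all \<open>leg_adj v (x z)\<close> vanish, and these test x z against every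
  elementary tensor.\<close>

lemma elem_id_separating:
  assumes x: "\<And>u v. elem id_blinfun u v o\<^sub>L x = 0" and u: "(u :: 'k) \<noteq> 0"
  shows "x = 0"
proof (rule blinfun_eqI)
  fix z
  have "x z = 0"
  proof (rule vec_eq_0I)
    fix a v
    have "leg u (leg_adj v (x z)) = 0"
      using x[of u v] by (metis elem_def compose_id(2) blinfun_apply_blinfun_compose blinfun.zero_left)
    then have "norm (leg_adj v (x z)) * norm u = 0" by (metis leg_apply norm_tensor norm_zero)
    then have "leg_adj v (x z) = 0" using u by simp
    then show "cinner (x z) (t a v) = 0"
      using is_adjointD(2)[OF leg_adj, of v "x z" a] by simp
  qed
  then show "blinfun_apply x z = blinfun_apply 0 z" by simp
qed

end

lemma csubspace_sesquilinear_zero: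
  fixes F :: "'a::complex_normed_vector \<Rightarrow> 'a \<Rightarrow> complex"
  assumes "\<And>x y z. F (x + y) z = F x z + F y z" "\<And>x y z. F z (x + y) = F z x + F z y"
    and "\<And>c x y. F (c *\<^sub>C x) y = c * F x y" "\<And>c x y. F x (c *\<^sub>C y) = cnj c * F x y"
    and B: "\<And>p q. p \<in> B \<Longrightarrow> q \<in> B \<Longrightarrow> F p q = 0"
    and pq: "p \<in> cspan B" "q \<in> cspan B"
  shows "F p q = 0"
proof -
  have z: "F 0 x = 0" "F x 0 = 0" for x using assms(3)[of 0 0 x] assms(4)[of x 0 0] by auto
  have 1: "F p q = 0" if "q \<in> B" for q
  proof -
    have "cspan B \<subseteq> {p. F p q = 0}"
      using that by (intro complex_vector.span_minimal csubspaceI) (auto simp: assms(1,3) z B)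
    then show ?thesis using pq by blast
  qed
  have "cspan B \<subseteq> {q. F p q = 0}"
    using 1 by (intro complex_vector.span_minimal csubspaceI) (auto simp: assms(2,4) z)
  then show ?thesis using pq by blast
qed

text \<open>
  Boundedness of \<open>S \<otimes> 1\<close>: with \<open>k\<^sup>2 = C\<^sup>2 - S*S\<close> one has
  \<open>\<parallel>(S \<otimes> 1) z\<parallel>\<^sup>2 + \<parallel>(k \<otimes> 1) z\<parallel>\<^sup>2 = C\<^sup>2 \<parallel>z\<parallel>\<^sup>2\<close> for algebraic tensors \<open>z\<close>.
\<close>

lemma ex_ampliation:
  fixes t1 :: "'a::chilbert_space \<Rightarrow> 'k::chilbert_space \<Rightarrow> 's::chilbert_space"
    and t2 :: "'b::chilbert_space \<Rightarrow> 'k \<Rightarrow> 't::chilbert_space"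
  assumes t1: "hilbert_tensor t1" and t2: "hilbert_tensor t2" and S: "S \<in> bounded_ops"
  obtains R where "R \<in> bounded_ops" "\<And>x y. blinfun_apply R (t1 x y) = t2 (blinfun_apply S x) y"
proof -
  interpret A: hilbert_tensor_product t1 by standard (rule t1)
  interpret B: hilbert_tensor_product t2 by standard (rule t2)
  obtain S' where S': "is_adjoint S S'" using ex_adjoint[OF S] by blast
  \<comment> \<open>\<open>C\<close> is the square of the bound, that is, of the norm of S.\<close>
  define C where "C = complex_of_real ((norm S)\<^sup>2)"
  define h where "h = C *\<^sub>C id_blinfun - (S' o\<^sub>L S)"
  have "cnj C = C" by (simp add: C_def)
  then have "is_adjoint (C *\<^sub>C id_blinfun) (C *\<^sub>C id_blinfun :: 'a \<Rightarrow>\<^sub>L 'a)"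
    using is_adjoint_scaleC[OF is_adjoint_id, of C] by simp
  moreover have "is_adjoint S' S" using S' is_adjoint_commute by blast
  ultimately have h: "is_adjoint h h" unfolding h_def
    using S' by (intro is_adjoint_diff is_adjoint_compose)
  have hh: "cinner (h x) y = C * cinner x y - cinner (S x) (S y)" for x y
    by (simp add: h_def op_apply cinner_simps is_adjointD(2)[OF S'])
  have "0 \<le> Re (cinner (h x) x)" for x
  proof -
    have "(norm (S x))\<^sup>2 \<le> (norm S * norm x)\<^sup>2" by (intro power_mono norm_blinfun norm_ge_zero)
    then show ?thesis by (simp add: hh cinner_self C_def power_mult_distrib)
  qed
  then obtain k where k: "is_adjoint k k" "k o\<^sub>L k = h" using ex_sqrt[OF h] by metis
  have kk: "cinner (k x) (k y) = C * cinner x y - cinner (S x) (S y)" for x y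
    using is_adjointD(1)[OF k(1), of "k x" y] k(2) hh[of x y]
    by (metis blinfun_apply_blinfun_compose)
  \<comment> \<open>The third coordinate records (k \<otimes> 1)z. The identity between the three
    squared norms becomes the vanishing of the form \<open>F\<close> on generators, hence on their
    span; this bounds the second coordinate by the first without defining S \<otimes> 1 on algebraic
    tensors.\<close>
  define X where "X = {(t1 x y, t2 (S x) y, t1 (k x) y) | x y. True}"
  define F where "F = (\<lambda>p q :: 's \<times> 't \<times> 's. cinner (fst (snd p)) (fst (snd q))
    + cinner (snd (snd p)) (snd (snd q)) - C * cinner (fst p) (fst q))"
  have F: "F p q = 0" if "p \<in> cspan X" "q \<in> cspan X" for p q
  proof (rule csubspace_sesquilinear_zero[of F, OF _ _ _ _ _ that])
    fix p q assume "p \<in> X" "q \<in> X"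
    then show "F p q = 0"
      by (auto simp: F_def X_def A.cinner_tensor B.cinner_tensor kk algebra_simps)
  qed (auto simp: F_def cinner_simps algebra_simps)
  define G where "G = (\<lambda>p. (fst p, fst (snd p))) ` cspan X"
  have "csubspace (cspan X)" by (rule complex_vector.subspace_span)
  then have G: "csubspace G" unfolding G_def
    by (rule csubspace_image) (auto simp: scaleC_prod)
  have XG: "(t1 x y, t2 (S x) y) \<in> G" for x y
  proof -
    have "(t1 x y, t2 (S x) y, t1 (k x) y) \<in> cspan X"
      by (rule complex_vector.span_base) (auto simp: X_def)
    then show ?thesis unfolding G_def by force
  qed
  have bnd: "norm v \<le> norm S * norm u" if uv: "(u, v) \<in> G" for u v
  proof -
    obtain w where w: "(u, v, w) \<in> cspan X" using uv by (auto simp: G_def)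
    have "complex_of_real ((norm v)\<^sup>2 + (norm w)\<^sup>2) = complex_of_real ((norm S * norm u)\<^sup>2)"
      using F[OF w w] by (simp add: F_def cinner_self C_def power_mult_distrib)
    then have "(norm v)\<^sup>2 + (norm w)\<^sup>2 = (norm S * norm u)\<^sup>2" by (simp only: of_real_eq_iff)
    moreover have "0 \<le> (norm w)\<^sup>2" by simp
    ultimately have "(norm v)\<^sup>2 \<le> (norm S * norm u)\<^sup>2" by linarith
    then show ?thesis by (rule power2_le_imp_le) simp
  qed
  have "csubspace (fst ` G)" using G by (rule csubspace_image) auto
  moreover have "t1 x y \<in> fst ` G" for x y using imageI[OF XG[of x y], of fst] by simp
  ultimately have "closure (fst ` G) = UNIV" by (rule A.dense_csubspace)
  then obtain R where "R \<in> bounded_ops" "\<And>u v. (u, v) \<in> G \<Longrightarrow> blinfun_apply R u = v"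
    using ex_bounded_op_graph[OF G bnd] by metis
  then show thesis using that[of R] XG by blast
qed

lemma ex_unitary_ampliation:
  fixes t1 :: "'a::chilbert_space \<Rightarrow> 'k::chilbert_space \<Rightarrow> 's::chilbert_space"
    and t2 :: "'b::chilbert_space \<Rightarrow> 'k \<Rightarrow> 't::chilbert_space"
  assumes t1: "hilbert_tensor t1" and t2: "hilbert_tensor t2"
    and V: "is_adjoint V W" "V o\<^sub>L W = id_blinfun" "W o\<^sub>L V = id_blinfun"
  obtains V' W' where "is_adjoint V' W'" "V' o\<^sub>L W' = id_blinfun" "W' o\<^sub>L V' = id_blinfun"
    "\<And>x y. blinfun_apply V' (t1 x y) = t2 (blinfun_apply V x) y"
    "\<And>x y. blinfun_apply W' (t2 x y) = t1 (blinfun_apply W x) y"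
proof -
  interpret A: hilbert_tensor_product t1 by standard (rule t1)
  interpret B: hilbert_tensor_product t2 by standard (rule t2)
  note b = is_adjoint_bounded_ops[OF V(1)]
  obtain V' where V': "V' \<in> bounded_ops" "\<And>x y. blinfun_apply V' (t1 x y) = t2 (V x) y"
    using ex_ampliation[OF t1 t2 b(1)] by blast
  obtain W' where W': "W' \<in> bounded_ops" "\<And>x y. blinfun_apply W' (t2 x y) = t1 (W x) y"
    using ex_ampliation[OF t2 t1 b(2)] by blast
  obtain W'' where W'': "W'' \<in> bounded_ops" "is_adjoint V' W''" using ex_adjoint[OF V'(1)] by blast
  have "W'' = W'"
  proof (rule B.op_eqI[OF W''(1) W'(1)])
    fix x y
    have "W'' (t2 x y) - W' (t2 x y) = 0"
      by (rule A.vec_eq_0I)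
        (simp add: cinner_diff is_adjointD(2)[OF W''(2)] V' W' A.cinner_tensor B.cinner_tensor
          is_adjointD(2)[OF V(1)])
    then show "W'' (t2 x y) = W' (t2 x y)" by simp
  qed
  moreover have "V (W x) = x" "W (V y) = y" for x y
    using V(2,3) by (metis blinfun_apply_blinfun_compose id_blinfun.rep_eq)+
  then have "V' o\<^sub>L W' = id_blinfun" "W' o\<^sub>L V' = id_blinfun"
    by (auto intro!: A.op_eqI B.op_eqI simp: V' W')
  ultimately show thesis using that[of V' W'] V' W' W'' by blast
qed


section \<open>Stabilized algebras\<close>

lemma compact_ops_compose:
  assumes S: "S \<in> compact_ops" and T: "T \<in> compact_ops"
  shows "S o\<^sub>L T \<in> compact_ops"
proof -
  have cT: "compact (closure (blinfun_apply T ` cball 0 1))" using T by (simp add: compact_ops_def)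
  let ?K = "blinfun_apply S ` closure (blinfun_apply T ` cball 0 1)"
  have cK: "compact ?K" by (rule compact_continuous_image[OF _ cT]) (intro continuous_intros)
  have "blinfun_apply (S o\<^sub>L T) ` cball 0 1 \<subseteq> ?K" using closure_subset by fastforce
  then have "closure (blinfun_apply (S o\<^sub>L T) ` cball 0 1) \<subseteq> ?K"
    using cK by (intro closure_minimal compact_imp_closed)
  then have "compact (closure (blinfun_apply (S o\<^sub>L T) ` cball 0 1))"
    using cK by (metis closed_closure compact_Int_closed inf.absorb_iff2)
  then show ?thesis using S T by (simp add: compact_ops_def)
qed

lemma ex_rank_one:
  obtains F where "F \<in> compact_ops" "\<And>y. blinfun_apply F y = cinner y v *\<^sub>C (u :: 'k::chilbert_space)"
proof -
  have add: "cinner (x + y) v *\<^sub>C u = cinner x v *\<^sub>C u + cinner y v *\<^sub>C u" for x y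
    by (simp add: cinner_simps scaleC_add_left)
  have scale: "cinner (c *\<^sub>C x) v *\<^sub>C u = c *\<^sub>C (cinner x v *\<^sub>C u)" for c x
    by (simp add: cinner_simps scaleC_scaleC)
  have bnd: "norm (cinner x v *\<^sub>C u) \<le> (norm v * norm u) * norm x" for x
    using mult_right_mono[OF Cauchy_Schwarz_cinner[of x v] norm_ge_zero[of u]]
    by (simp add: norm_scaleC mult_ac)
  obtain F where F: "F \<in> bounded_ops" "\<And>y. blinfun_apply F y = cinner y v *\<^sub>C u"
    using ex_bounded_op[OF add scale bnd] by blast
  let ?K = "(\<lambda>c. c *\<^sub>C u) ` cball 0 (norm v)"
  have "bounded_linear (\<lambda>c. c *\<^sub>C u)"
    by (rule bounded_linear_intro[where K = "norm u"])
      (auto simp: scaleC_add_left scaleR_scaleC scaleC_scaleC scaleR_conv_of_real norm_scaleC)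
  then have cK: "compact ?K"
    by (intro compact_continuous_image linear_continuous_on compact_cball)
  have "blinfun_apply F ` cball 0 1 \<subseteq> ?K"
  proof
    fix z assume "z \<in> blinfun_apply F ` cball 0 1"
    then obtain y where y: "norm y \<le> 1" "z = cinner y v *\<^sub>C u" using F by auto
    have "cmod (cinner y v) \<le> 1 * norm v"
      using Cauchy_Schwarz_cinner[of y v] mult_right_mono[OF y(1) norm_ge_zero[of v]] by linarith
    then show "z \<in> ?K" using y by auto
  qed
  then have "closure (blinfun_apply F ` cball 0 1) \<subseteq> ?K"
    using cK by (intro closure_minimal compact_imp_closed)
  then have "compact (closure (blinfun_apply F ` cball 0 1))"
    using cK by (metis closed_closure compact_Int_closed inf.absorb_iff2)
  then show thesis using that[of F] F by (simp add: compact_ops_def)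
qed

text \<open>The induction principle for \<open>min_tensor\<close>: a continuous linear map into a
  closed subspace has to be inspected on generators only.\<close>

lemma closure_cspan_subset:
  fixes f :: "'a::complex_normed_vector \<Rightarrow> 'b::complex_normed_vector"
  assumes "csubspace M" "closed M" "continuous_on UNIV f" "\<And>x y. f (x + y) = f x + f y"
    "\<And>c x. f (c *\<^sub>C x) = c *\<^sub>C f x" "\<And>x. x \<in> X \<Longrightarrow> f x \<in> M" "x \<in> closure (cspan X)"
  shows "f x \<in> M"
proof -
  have "cspan X \<subseteq> f -` M"
  proof (rule complex_vector.span_minimal)
    have "f 0 = 0" using assms(5)[of 0 0] by simp
    then show "csubspace (f -` M)"
      using csubspaceD[OF assms(1)] by (intro csubspaceI) (auto simp: assms(4,5))
  qed (use assms(6) in auto)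
  moreover have "closed (f -` M)" using assms(2,3) by (simp add: continuous_on_closed_vimage)
  ultimately show ?thesis using assms(7) closure_minimal by blast
qed

lemma blinfun_compose_continuous: "continuous_on UNIV (\<lambda>x. A o\<^sub>L x)" "continuous_on UNIV (\<lambda>x. x o\<^sub>L A)"
  by (intro bounded_bilinear.continuous_on[OF bounded_bilinear_blinfun_compose]
      continuous_on_const continuous_on_id)+

section \<open>The stabilized algebra: generators, multipliers and slices\<close>

locale stabilized_csl = multiplicity_free_csl L + hilbert_tensor_product t
  for L :: "('h::chilbert_space \<Rightarrow>\<^sub>L 'h) set"
    and t :: "'h \<Rightarrow> 'k::chilbert_space \<Rightarrow> 't::chilbert_space" +
  fixes w :: 'k
  assumes w: "norm w = 1"
begin

definition A where "A = min_tensor t (Alg L) compact_ops"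

lemma w_simps [simp]: "cinner w w = 1" "w \<noteq> 0"
  using w by (auto simp: cinner_self)

lemma generators:
  assumes "csubspace M" "closed M" "continuous_on UNIV f" "\<And>x y. f (x + y) = f x + f y"
    "\<And>c x. f (c *\<^sub>C x) = c *\<^sub>C f x"
    "\<And>R S T. S \<in> Alg L \<Longrightarrow> T \<in> compact_ops \<Longrightarrow> is_op_tensor t S T R \<Longrightarrow> f R \<in> M"
    "a \<in> A"
  shows "f a \<in> M"
proof (rule closure_cspan_subset[OF assms(1-5)])
  show "a \<in> closure (cspan {R. \<exists>S\<in>Alg L. \<exists>T\<in>compact_ops. is_op_tensor t S T R})"
    using assms(7) by (simp add: A_def min_tensor_def)
qed (use assms(6) in blast)

lemma generator_mem: "S \<in> Alg L \<Longrightarrow> T \<in> compact_ops \<Longrightarrow> is_op_tensor t S T R \<Longrightarrow> R \<in> A"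
  unfolding A_def min_tensor_def
  by (rule subsetD[OF closure_subset], rule complex_vector.span_base) auto

lemma A_csubspace: "csubspace A" and A_closed: "closed A"
  unfolding A_def min_tensor_def
  by (intro csubspace_closure complex_vector.subspace_span closed_closure)+

lemma A_bounded: "a \<in> A \<Longrightarrow> a \<in> bounded_ops"
proof (rule generators[where f = "\<lambda>x. x"])
  show "csubspace (bounded_ops :: ('t \<Rightarrow>\<^sub>L 't) set)" by (rule csubspaceI) auto
qed (auto simp: closed_bounded_ops is_op_tensor_def intro: continuous_on_id)

lemma A_compose:
  assumes a: "a \<in> A" and b: "b \<in> A" shows "a o\<^sub>L b \<in> A"
proof (rule generators[where f = "\<lambda>x. x o\<^sub>L b", OF A_csubspace A_closed _ _ _ _ a])
  fix R S T assume R: "S \<in> Alg L" "T \<in> compact_ops" "is_op_tensor t S T R"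
  show "R o\<^sub>L b \<in> A"
  proof (rule generators[where f = "\<lambda>x. R o\<^sub>L x", OF A_csubspace A_closed _ _ _ _ b])
    fix R' S' T' assume R': "S' \<in> Alg L" "T' \<in> compact_ops" "is_op_tensor t S' T' R'"
    have "is_op_tensor t (S o\<^sub>L S') (T o\<^sub>L T') (R o\<^sub>L R')"
      using R(3) R'(3) by (simp add: is_op_tensor_def)
    then show "R o\<^sub>L R' \<in> A"
      using Alg_compose[OF R(1) R'(1)] compact_ops_compose[OF R(2) R'(2)] generator_mem by blast
  qed (use R(3) in \<open>auto simp: blinfun_compose_continuous compose_add compose_scaleC_right is_op_tensor_def\<close>)
qed (auto simp: blinfun_compose_continuous compose_add compose_scaleC)

lemma Alg_bounded: "S \<in> Alg L \<Longrightarrow> S \<in> bounded_ops"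
  by (simp add: Alg_iff)

lemma elem_mem: assumes S: "S \<in> Alg L" shows "elem S u v \<in> A"
proof -
  obtain F where F: "F \<in> compact_ops" "\<And>y. blinfun_apply F y = cinner y v *\<^sub>C u"
    using ex_rank_one by metis
  have "is_op_tensor t S F (elem S u v)"
    using Alg_bounded[OF S] by (simp add: is_op_tensor_def elem_bounded elem_tensor F tensor_linear)
  then show ?thesis using S F generator_mem by blast
qed

text \<open>S \<otimes> 1, which acts on the stabilized algebra as a multiplier and is usually not
  an element of it.\<close>

definition amp :: "('h \<Rightarrow>\<^sub>L 'h) \<Rightarrow> 't \<Rightarrow>\<^sub>L 't" where
  "amp S = (SOME R. R \<in> bounded_ops \<and> (\<forall>x y. blinfun_apply R (t x y) = t (S x) y))"

lemma amp: assumes S: "S \<in> bounded_ops"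
  shows "amp S \<in> bounded_ops" "amp S (t x y) = t (S x) y"
proof -
  have "\<exists>R. R \<in> bounded_ops \<and> (\<forall>x y. blinfun_apply R (t x y) = t (S x) y)"
    using ex_ampliation[OF tensor tensor S] by metis
  from someI_ex[OF this] show "amp S \<in> bounded_ops" "amp S (t x y) = t (S x) y"
    unfolding amp_def by auto
qed

lemma amp_add: "S \<in> bounded_ops \<Longrightarrow> T \<in> bounded_ops \<Longrightarrow> amp (S + T) = amp S + amp T"
  and amp_compose: "S \<in> bounded_ops \<Longrightarrow> T \<in> bounded_ops \<Longrightarrow> amp (S o\<^sub>L T) = amp S o\<^sub>L amp T"
  and amp_scale: "S \<in> bounded_ops \<Longrightarrow> amp (c *\<^sub>C S) = c *\<^sub>C amp S"
  by (rule op_eqI; simp add: amp op_apply tensor_linear)+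

lemma amp_adjoint: assumes S: "is_adjoint S S'" shows "is_adjoint (amp S) (amp S')"
proof -
  note b = is_adjoint_bounded_ops[OF S]
  obtain R where R: "R \<in> bounded_ops" "is_adjoint (amp S) R" using ex_adjoint[OF amp(1)[OF b(1)]] by blast
  have "R = amp S'"
  proof (rule op_eqI[OF R(1) amp(1)[OF b(2)]])
    fix x y
    have "R (t x y) - amp S' (t x y) = 0"
      by (rule vec_eq_0I)
        (simp add: cinner_diff is_adjointD(2)[OF R(2)] amp b cinner_tensor is_adjointD(2)[OF S])
    then show "R (t x y) = amp S' (t x y)" by simp
  qed
  then show ?thesis using R by simp
qed

lemma amp_elem: "S \<in> bounded_ops \<Longrightarrow> T \<in> bounded_ops \<Longrightarrow> amp S o\<^sub>L elem T u v = elem (S o\<^sub>L T) u v"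
  and elem_amp: "S \<in> bounded_ops \<Longrightarrow> T \<in> bounded_ops \<Longrightarrow> elem T u v o\<^sub>L amp S = elem (T o\<^sub>L S) u v"
  by (rule op_eqI; simp add: amp elem_bounded elem_tensor bounded_ops_scaleC)+

lemma amp_mem: assumes S: "S \<in> Alg L" and a: "a \<in> A" shows "amp S o\<^sub>L a \<in> A"
proof (rule generators[where f = "\<lambda>x. amp S o\<^sub>L x", OF A_csubspace A_closed _ _ _ _ a])
  fix R S' T assume R: "S' \<in> Alg L" "T \<in> compact_ops" "is_op_tensor t S' T R"
  have "is_op_tensor t (S o\<^sub>L S') T (amp S o\<^sub>L R)"
    using R(3) amp[OF Alg_bounded[OF S]] by (simp add: is_op_tensor_def)
  then show "amp S o\<^sub>L R \<in> A" using Alg_compose[OF S R(1)] R(2) generator_mem by blast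
qed (auto simp: blinfun_compose_continuous compose_add compose_scaleC_right amp Alg_bounded[OF S])

text \<open>Slicing is continuous and sends the generator S \<otimes> T to <Tu,v> S;
  \<open>Alg L\<close> is a closed subspace.\<close>

lemma slice_mem: assumes a: "a \<in> A" shows "leg_adj v o\<^sub>L (a o\<^sub>L leg u) \<in> Alg L"
proof (rule generators[where f = "\<lambda>x. leg_adj v o\<^sub>L (x o\<^sub>L leg u)", OF Alg_csubspace Alg_closed _ _ _ _ a])
  fix R S T assume R: "S \<in> Alg L" "T \<in> compact_ops" "is_op_tensor t S T R"
  have "leg_adj v o\<^sub>L (R o\<^sub>L leg u) = cinner (T u) v *\<^sub>C S"
    using R(3) by (intro blinfun_eqI) (simp add: is_op_tensor_def scaleC_blinfun.rep_eq)
  then show "leg_adj v o\<^sub>L (R o\<^sub>L leg u) \<in> Alg L" using R(1) csubspaceD(3)[OF Alg_csubspace] by simp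
next
  show "continuous_on UNIV (\<lambda>x. leg_adj v o\<^sub>L (x o\<^sub>L leg u))"
    by (intro bounded_bilinear.continuous_on[OF bounded_bilinear_blinfun_compose]
        continuous_on_const continuous_on_id)
qed (auto simp: compose_add compose_scaleC compose_scaleC_right leg_adj_bounded)

lemma slice_ext:
  assumes a: "a \<in> bounded_ops" and b: "b \<in> bounded_ops"
    and eq: "\<And>u v. leg_adj v o\<^sub>L (a o\<^sub>L leg u) = leg_adj v o\<^sub>L (b o\<^sub>L leg u)"
  shows "a = b"
proof (rule op_eqI[OF a b])
  fix x y
  have "a (t x y) - b (t x y) = 0"
  proof (rule vec_eq_0I)
    fix x' y'
    have "leg_adj y' (a (t x y)) = leg_adj y' (b (t x y))"
      using eq[of y' y] by (metis blinfun_apply_blinfun_compose leg_apply)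
    then show "cinner (a (t x y) - b (t x y)) (t x' y') = 0"
      using is_adjointD(2)[OF leg_adj, of y' "a (t x y)" x'] is_adjointD(2)[OF leg_adj, of y' "b (t x y)" x']
      by (simp add: cinner_diff)
  qed
  then show "a (t x y) = b (t x y)" by simp
qed

lemma leg_adj_amp: "S \<in> bounded_ops \<Longrightarrow> leg_adj v o\<^sub>L amp S = S o\<^sub>L leg_adj v"
  and amp_leg: "S \<in> bounded_ops \<Longrightarrow> amp S o\<^sub>L leg u = leg u o\<^sub>L S"
proof -
  assume S: "S \<in> bounded_ops"
  show "amp S o\<^sub>L leg u = leg u o\<^sub>L S" by (rule blinfun_eqI) (simp add: amp S)
  show "leg_adj v o\<^sub>L amp S = S o\<^sub>L leg_adj v"
  proof (rule blinfun_eq_dense[OF dense_csubspace])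
    show "csubspace {z. blinfun_apply (leg_adj v o\<^sub>L amp S) z = blinfun_apply (S o\<^sub>L leg_adj v) z}"
      by (rule csubspaceI) (auto simp: op_apply bounded_ops_scaleC amp S leg_adj_bounded)
  qed (auto simp: amp S bounded_ops_scaleC)
qed

text \<open>The adjoint of a slice of a self-adjoint element is the slice with u and v exchanged,
  and both lie in \<open>Alg L\<close>. So every slice is in D and commutes with c. This is how the
  self-adjoint part is compared with D \<otimes> K.\<close>

lemma selfadjoint_commutes_amp:
  assumes a: "a \<in> A" "is_adjoint a a" and c: "c \<in> D"
  shows "a o\<^sub>L amp c = amp c o\<^sub>L a"
proof (rule slice_ext)
  note cb = D.bounded[OF c]
  show "a o\<^sub>L amp c \<in> bounded_ops" "amp c o\<^sub>L a \<in> bounded_ops" using A_bounded[OF a(1)] amp cb by auto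
  fix u v
  let ?s = "leg_adj v o\<^sub>L (a o\<^sub>L leg u)" and ?s' = "leg_adj u o\<^sub>L (a o\<^sub>L leg v)"
  have "is_adjoint ?s ((leg_adj u o\<^sub>L a) o\<^sub>L leg v)"
    using leg_adj is_adjoint_commute a(2) by (intro is_adjoint_compose) blast+
  then have "?s \<in> D"
    by (intro diagonal_mem[of ?s ?s'] slice_mem a(1)) (simp add: compose_assoc)
  then have "?s o\<^sub>L c = c o\<^sub>L ?s" using D.commute[OF _ c] by simp
  moreover have "leg_adj v o\<^sub>L ((a o\<^sub>L amp c) o\<^sub>L leg u) = ?s o\<^sub>L c"
    by (simp add: compose_assoc amp_leg[OF cb])
  moreover have "leg_adj v o\<^sub>L ((amp c o\<^sub>L a) o\<^sub>L leg u) = c o\<^sub>L ?s"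
    by (simp add: leg_adj_amp[OF cb] flip: compose_assoc)
  ultimately show "leg_adj v o\<^sub>L ((a o\<^sub>L amp c) o\<^sub>L leg u) = leg_adj v o\<^sub>L ((amp c o\<^sub>L a) o\<^sub>L leg u)"
    by simp
qed

text \<open>Elements fixed by compression to 1 \<otimes> |w><w| are S \<otimes> |w><w|, with S the
  slice at w. This corner is where statements about the original algebra are recovered.\<close>

lemma corner:
  assumes "elem id_blinfun w w o\<^sub>L (a o\<^sub>L elem id_blinfun w w) = a"
  shows "a = elem (leg_adj w o\<^sub>L (a o\<^sub>L leg w)) w w"
  using assms by (simp add: elem_def compose_id compose_assoc)

lemma elem_w_inj:
  assumes "S \<in> bounded_ops" "T \<in> bounded_ops" "elem S w w = elem T w w" shows "S = T"
proof (rule blinfun_eqI)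
  fix x
  have "leg_adj w (elem S w w (t x w)) = leg_adj w (elem T w w (t x w))" by (simp only: assms(3))
  then show "S x = T x" by (simp add: elem_tensor assms(1,2))
qed

text \<open>The defect is linear and continuous in \<open>a\<close>, so it is tested on generators S
  \<otimes> T, where it vanishes by PSP = SP. The closed subspace in the induction is {0}.\<close>

lemma invariant_amp:
  assumes P: "P \<in> invariant_projections (Alg L)" and a: "a \<in> A"
  shows "amp P o\<^sub>L (a o\<^sub>L amp P) = a o\<^sub>L amp P"
proof -
  have Pb: "P \<in> bounded_ops" using P projectionsD by (auto simp: invariant_projections_def)
  have "(amp P o\<^sub>L (a o\<^sub>L amp P)) - (a o\<^sub>L amp P) \<in> {0}"
  proof (rule generators[where f = "\<lambda>a. (amp P o\<^sub>L (a o\<^sub>L amp P)) - (a o\<^sub>L amp P)", OF _ _ _ _ _ _ a])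
    fix R S T assume R: "S \<in> Alg L" "T \<in> compact_ops" "is_op_tensor t S T R"
    have "P (S (P x)) = S (P x)" for x
      using P R(1) by (auto simp: invariant_projections_def) (metis blinfun_apply_blinfun_compose)
    then have "amp P o\<^sub>L (R o\<^sub>L amp P) = R o\<^sub>L amp P"
      using R(3) by (intro op_eqI) (auto simp: amp Pb is_op_tensor_def)
    then show "(amp P o\<^sub>L (R o\<^sub>L amp P)) - (R o\<^sub>L amp P) \<in> {0}" by simp
  next
    show "continuous_on UNIV (\<lambda>a. (amp P o\<^sub>L (a o\<^sub>L amp P)) - (a o\<^sub>L amp P))"
      by (intro continuous_on_diff bounded_bilinear.continuous_on[OF bounded_bilinear_blinfun_compose]
          continuous_on_const continuous_on_id)
  qed (auto intro: csubspaceI simp: compose_add compose_scaleC compose_scaleC_right amp Pb scaleC_diff_right)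
  then show ?thesis by simp
qed

end

section \<open>Matching the diagonals through an isomorphism of stabilized algebras\<close>

locale stabilized_iso =
  X: stabilized_csl L1 t1 w + Y: stabilized_csl L2 t2 w
  for L1 :: "('a::chilbert_space \<Rightarrow>\<^sub>L 'a) set" and L2 :: "('b::chilbert_space \<Rightarrow>\<^sub>L 'b) set"
    and t1 :: "'a \<Rightarrow> 'k::chilbert_space \<Rightarrow> 's::chilbert_space"
    and t2 :: "'b \<Rightarrow> 'k \<Rightarrow> 't::chilbert_space" and w :: 'k +
  fixes \<phi> :: "('s \<Rightarrow>\<^sub>L 's) \<Rightarrow> ('t \<Rightarrow>\<^sub>L 't)"
  assumes hom: "algebra_hom_on X.A \<phi>" and surj: "\<phi> ` X.A = Y.A" and isom: "isometric_on X.A \<phi>"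
begin

lemma add: "S \<in> X.A \<Longrightarrow> T \<in> X.A \<Longrightarrow> \<phi> (S + T) = \<phi> S + \<phi> T"
  and mult: "S \<in> X.A \<Longrightarrow> T \<in> X.A \<Longrightarrow> \<phi> (S o\<^sub>L T) = \<phi> S o\<^sub>L \<phi> T"
  and scale: "S \<in> X.A \<Longrightarrow> \<phi> (c *\<^sub>C S) = c *\<^sub>C \<phi> S"
  using hom by (auto simp: algebra_hom_on_def)

lemma norm_eq: "S \<in> X.A \<Longrightarrow> norm (\<phi> S) = norm S"
  using isom unfolding isometric_on_def by blast

lemma mem: "S \<in> X.A \<Longrightarrow> \<phi> S \<in> Y.A"
  using surj by blast

lemma preimage: assumes "T \<in> Y.A" obtains S where "S \<in> X.A" "\<phi> S = T"
proof -
  have "T \<in> \<phi> ` X.A" using assms by (simp only: surj)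
  then show thesis using that by blast
qed

lemmas X_sub = csubspaceD[OF X.A_csubspace]
lemmas Y_sub = csubspaceD[OF Y.A_csubspace]

lemma zero: "\<phi> 0 = 0"
  using scale[OF X_sub(1), of 0] by simp

lemma diff: "S \<in> X.A \<Longrightarrow> T \<in> X.A \<Longrightarrow> \<phi> (S - T) = \<phi> S - \<phi> T"
  using add[OF X_sub(4), of S T T] by simp

lemma inj: assumes "S \<in> X.A" "T \<in> X.A" "\<phi> S = \<phi> T" shows "S = T"
  using norm_eq[OF X_sub(4)[OF assms(1,2)]] diff[OF assms(1,2)] assms(3) by simp

lemma e_mem: "X.elem id_blinfun u v \<in> X.A"
  by (rule X.elem_mem[OF X.Alg_id])

lemma unit_projection:
  assumes u: "norm u = 1"
  shows "X.elem id_blinfun u u \<in> projections" "\<phi> (X.elem id_blinfun u u) \<in> projections"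
proof -
  let ?e = "X.elem id_blinfun u u"
  have "cinner u u = 1" using u by (simp add: cinner_self)
  then have ee: "?e o\<^sub>L ?e = ?e" by (simp add: X.elem_compose compose_id)
  have "is_adjoint ?e ?e" by (rule X.elem_adjoint[OF is_adjoint_id])
  then show p: "?e \<in> projections" using ee by (intro projectionsI)
  have "norm ?e \<le> 1" using norm_projection[OF p] by (intro norm_blinfun_bound) auto
  then show "\<phi> ?e \<in> projections"
    using Y.A_bounded[OF mem[OF e_mem]] mult[OF e_mem e_mem] ee norm_eq[OF e_mem]
    by (intro contractive_idempotent_projection) metis+
qed

text \<open>For a unit vector the image is a projection, thus a self-adjoint element of the target
  algebra; other vectors follow by scaling.\<close>

lemma elem_diagonal_commutes_amp:
  assumes c: "c \<in> Y.D"
  shows "\<phi> (X.elem id_blinfun u u) o\<^sub>L Y.amp c = Y.amp c o\<^sub>L \<phi> (X.elem id_blinfun u u)"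
proof (cases "u = 0")
  case True
  then have "X.elem id_blinfun u u = 0" using X.elem_linear(2)[of id_blinfun 0 u u] by simp
  then show ?thesis by (simp add: zero compose_zero)
next
  case False
  define v where "v = complex_of_real (1 / norm u) *\<^sub>C u"
  have v: "norm v = 1" using False by (simp add: v_def norm_scaleC norm_divide)
  have uv: "u = complex_of_real (norm u) *\<^sub>C v" using False by (simp add: v_def scaleC_scaleC)
  let ?e = "X.elem id_blinfun v v"
  have "X.elem id_blinfun u u = complex_of_real (norm u * norm u) *\<^sub>C ?e"
    by (subst uv, subst (2) uv) (simp add: X.elem_linear scaleC_scaleC)
  moreover have "\<phi> ?e o\<^sub>L Y.amp c = Y.amp c o\<^sub>L \<phi> ?e"
    using Y.selfadjoint_commutes_amp[OF mem[OF e_mem] _ c] unit_projection[OF v] projectionsD(3) by blast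
  ultimately show ?thesis
    using Y.amp(1)[OF Y.D.bounded[OF c]] by (simp add: scale e_mem compose_scaleC compose_scaleC_right)
qed

text \<open>For u \<noteq> v the image need not be self-adjoint, but the commutator with
  \<open>Y.amp c\<close> is sesquilinear in (u, v) and vanishes for u = v.\<close>

lemma elem_commutes_amp:
  assumes c: "c \<in> Y.D"
  shows "\<phi> (X.elem id_blinfun u v) o\<^sub>L Y.amp c = Y.amp c o\<^sub>L \<phi> (X.elem id_blinfun u v)"
proof (rule blinfun_eqI)
  fix z
  note b = bounded_ops_scaleC[OF Y.amp(1)[OF Y.D.bounded[OF c]]]
  have *: "cinner ((\<phi> (X.elem id_blinfun u v) o\<^sub>L Y.amp c) z
    - (Y.amp c o\<^sub>L \<phi> (X.elem id_blinfun u v)) z) y = 0" for y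
  proof (rule polarization[of "\<lambda>u v. cinner ((\<phi> (X.elem id_blinfun u v) o\<^sub>L Y.amp c) z
      - (Y.amp c o\<^sub>L \<phi> (X.elem id_blinfun u v)) z) y"])
    show "cinner ((\<phi> (X.elem id_blinfun u u) o\<^sub>L Y.amp c) z
      - (Y.amp c o\<^sub>L \<phi> (X.elem id_blinfun u u)) z) y = 0" for u
      by (simp only: elem_diagonal_commutes_amp[OF c]) simp
  qed (simp_all add: X.elem_linear add scale e_mem op_apply b cinner_simps algebra_simps)
  show "(\<phi> (X.elem id_blinfun u v) o\<^sub>L Y.amp c) z = (Y.amp c o\<^sub>L \<phi> (X.elem id_blinfun u v)) z"
    using *[of "(\<phi> (X.elem id_blinfun u v) o\<^sub>L Y.amp c) z - (Y.amp c o\<^sub>L \<phi> (X.elem id_blinfun u v)) z"]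
    by (simp only: cinner_self_eq_0 right_minus_eq)
qed

text \<open>A relation instead of a map: read for the inverse isomorphism it becomes its own
  converse, so each one-sided lemma serves both directions.\<close>

definition corresponds :: "('a \<Rightarrow>\<^sub>L 'a) \<Rightarrow> ('b \<Rightarrow>\<^sub>L 'b) \<Rightarrow> bool" where
  "corresponds d c \<longleftrightarrow> d \<in> X.D \<and> c \<in> Y.D \<and> (\<forall>a\<in>X.A. \<phi> (X.amp d o\<^sub>L a) = Y.amp c o\<^sub>L \<phi> a)"

text \<open>
  Multiplying \<open>c \<otimes> 1\<close> with the image \<open>f\<close> of \<open>1 \<otimes> q\<close>, \<open>q\<close> the rank one projection on \<open>w\<close>, lands in
  the corner of \<open>f\<close>, which is the image of \<open>Alg L1 \<otimes> q\<close>; this yields \<open>d\<close>.  The matrix units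
  \<open>1 \<otimes> |u\<rangle>\<langle>v|\<close> transport the relation from this corner to the whole algebra.
\<close>

lemma corresponds_exists:
  assumes c: "c \<in> Y.D" "is_adjoint c c"
  obtains d where "corresponds d c" "is_adjoint d d"
proof -
  let ?e = "X.elem id_blinfun w w"
  define f where "f = \<phi> ?e"
  note cb = Y.D.bounded[OF c(1)]
  have e: "?e \<in> projections" and f: "f \<in> projections" using unit_projection[OF X.w] by (auto simp: f_def)
  define g where "g = Y.amp c o\<^sub>L f"
  have cf: "f o\<^sub>L Y.amp c = Y.amp c o\<^sub>L f" unfolding f_def by (rule elem_commutes_amp[OF c(1)])
  have gA: "g \<in> Y.A" unfolding g_def f_def by (intro Y.amp_mem Y.D_subset_Alg c mem e_mem)
  have gadj: "is_adjoint g g"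
    using is_adjoint_compose[OF Y.amp_adjoint[OF c(2)] projectionsD(3)[OF f]] cf by (simp add: g_def)
  have "f o\<^sub>L (f o\<^sub>L x) = f o\<^sub>L x" for x using projectionsD(2)[OF f] by (metis compose_assoc)
  then have fg: "f o\<^sub>L g = g" by (simp add: g_def flip: cf)
  have gf: "g o\<^sub>L f = g" by (simp add: g_def compose_assoc projectionsD(2)[OF f])
  obtain m where m: "m \<in> X.A" "\<phi> m = g" using gA by (rule preimage)
  have em: "?e o\<^sub>L m = m" "m o\<^sub>L ?e = m"
    using fg gf m by (auto intro!: inj X.A_compose e_mem simp: mult e_mem simp flip: f_def)
  \<comment> \<open>The projections \<open>?e\<close> and \<open>f\<close> replace the missing
    units: \<phi> maps e + am to f + ag, so the norm criterion carries self-adjointness from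
    \<open>g\<close> back to \<open>m\<close>.\<close>
  have "norm (?e + a *\<^sub>C m) = norm (f + a *\<^sub>C g)" for a
    using norm_eq[OF X_sub(2)[OF e_mem X_sub(3)[OF m(1)]]]
    by (simp add: add e_mem X_sub(3)[OF m(1)] scale m f_def)
  then have madj: "is_adjoint m m"
    using norm_bound_if_selfadjoint[OF f gadj fg]
    by (intro selfadjoint_if_norm_bound[OF e X.A_bounded[OF m(1)] em]) auto
  define d where "d = X.leg_adj w o\<^sub>L (m o\<^sub>L X.leg w)"
  have md: "m = X.elem d w w" unfolding d_def by (rule X.corner) (simp add: em)
  have dA: "d \<in> Alg L1" unfolding d_def by (rule X.slice_mem[OF m(1)])
  have "is_adjoint d ((X.leg_adj w o\<^sub>L m) o\<^sub>L X.leg w)" unfolding d_def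
    using X.leg_adj is_adjoint_commute madj by (intro is_adjoint_compose) blast+
  then have dadj: "is_adjoint d d" by (simp add: d_def compose_assoc)
  have dD: "d \<in> X.D" by (rule X.diagonal_mem[OF dA dA dadj])
  note db = X.D.bounded[OF dD]
  have elem_d: "Y.amp c o\<^sub>L \<phi> (X.elem id_blinfun u v) = \<phi> (X.elem d u v)" for u v
  proof -
    let ?u = "X.elem id_blinfun u w" and ?v = "X.elem id_blinfun w v"
    have "X.elem id_blinfun u v = ?u o\<^sub>L (?e o\<^sub>L ?v)"
      by (simp add: X.elem_compose compose_id)
    then have "Y.amp c o\<^sub>L \<phi> (X.elem id_blinfun u v) = Y.amp c o\<^sub>L (\<phi> ?u o\<^sub>L (f o\<^sub>L \<phi> ?v))"
      by (simp only: mult e_mem X.A_compose f_def)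
    also have "\<dots> = (Y.amp c o\<^sub>L \<phi> ?u) o\<^sub>L (f o\<^sub>L \<phi> ?v)" by (simp add: compose_assoc)
    also have "\<dots> = (\<phi> ?u o\<^sub>L Y.amp c) o\<^sub>L (f o\<^sub>L \<phi> ?v)" by (simp only: elem_commutes_amp[OF c(1)])
    also have "\<dots> = \<phi> ?u o\<^sub>L (g o\<^sub>L \<phi> ?v)" by (simp add: g_def compose_assoc)
    also have "\<dots> = \<phi> (?u o\<^sub>L (m o\<^sub>L ?v))" by (simp add: mult e_mem X.A_compose m)
    also have "?u o\<^sub>L (m o\<^sub>L ?v) = X.elem d u v" by (simp add: md X.elem_compose compose_id db)
    finally show ?thesis .
  qed
  have "\<phi> (X.amp d o\<^sub>L a) = Y.amp c o\<^sub>L \<phi> a" if a: "a \<in> X.A" for a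
  proof -
    note daA = X.amp_mem[OF dA a] and caA = Y.amp_mem[OF Y.D_subset_Alg[OF c(1)] mem[OF a]]
    \<comment> \<open>The difference of the two sides is pulled back to the first algebra, where
      left multiplication by all 1 \<otimes> |u><v| decides whether it is 0.\<close>
    obtain x where x: "x \<in> X.A" "\<phi> x = (Y.amp c o\<^sub>L \<phi> a) - \<phi> (X.amp d o\<^sub>L a)"
      using Y_sub(4)[OF caA mem[OF daA]] by (rule preimage)
    have "X.elem id_blinfun u v o\<^sub>L x = 0" for u v
    proof -
      let ?e = "X.elem id_blinfun u v"
      have "\<phi> (?e o\<^sub>L x) = (\<phi> ?e o\<^sub>L (Y.amp c o\<^sub>L \<phi> a)) - (\<phi> ?e o\<^sub>L \<phi> (X.amp d o\<^sub>L a))"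
        using x by (simp add: mult e_mem compose_diff)
      also have "\<phi> ?e o\<^sub>L (Y.amp c o\<^sub>L \<phi> a) = \<phi> (X.elem d u v) o\<^sub>L \<phi> a"
        by (simp add: elem_commutes_amp[OF c(1)] elem_d flip: compose_assoc)
      also have "\<dots> = \<phi> (X.elem d u v o\<^sub>L a)" by (simp add: mult X.elem_mem dA a)
      also have "X.elem d u v o\<^sub>L a = ?e o\<^sub>L (X.amp d o\<^sub>L a)"
        by (simp add: X.elem_amp db compose_id flip: compose_assoc)
      also have "\<phi> (?e o\<^sub>L (X.amp d o\<^sub>L a)) - (\<phi> ?e o\<^sub>L \<phi> (X.amp d o\<^sub>L a)) = 0"
        by (simp add: mult e_mem daA)
      finally show ?thesis using inj[OF X.A_compose[OF e_mem x(1)] X_sub(1)] zero by simp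
    qed
    then have "x = 0" using X.elem_id_separating X.w_simps(2) by blast
    then show ?thesis using x(2) zero by simp
  qed
  then have "corresponds d c" using dD c by (simp add: corresponds_def)
  then show thesis using dadj that by blast
qed

lemma corresponds_add: "corresponds d c \<Longrightarrow> corresponds d' c' \<Longrightarrow> corresponds (d + d') (c + c')"
  unfolding corresponds_def
  by (auto simp: X.amp_add Y.amp_add X.D.bounded Y.D.bounded compose_add add X.amp_mem X.D_subset_Alg
      X.D.closed_under Y.D.closed_under)

lemma corresponds_scale: "corresponds d c \<Longrightarrow> corresponds (z *\<^sub>C d) (z *\<^sub>C c)"
  unfolding corresponds_def
  by (auto simp: X.amp_scale Y.amp_scale X.D.bounded Y.D.bounded compose_scaleC scale X.amp_mem
      X.D_subset_Alg X.D.closed_under Y.D.closed_under)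

lemma corresponds_mult: "corresponds d c \<Longrightarrow> corresponds d' c' \<Longrightarrow> corresponds (d o\<^sub>L d') (c o\<^sub>L c')"
  unfolding corresponds_def
  by (auto simp: X.amp_compose Y.amp_compose X.D.bounded Y.D.bounded compose_assoc X.amp_mem
      X.D_subset_Alg X.D.closed_under Y.D.closed_under)

lemma corresponds_total:
  assumes c: "c \<in> Y.D" shows "\<exists>d. corresponds d c"
proof -
  obtain e where e: "e \<in> Y.D" "is_adjoint c e" using c by (rule Y.D.ex_adj)
  obtain h k where hk: "is_adjoint h h" "is_adjoint k k" "c = h + \<i> *\<^sub>C k"
    "h = (1/2) *\<^sub>C (c + e)" "k = (- \<i> / 2) *\<^sub>C (c - e)" using selfadjoint_parts[OF e(2)] by metis
  have h: "h \<in> Y.D" "k \<in> Y.D" by (simp_all add: hk(4,5) c e Y.D.closed_under)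
  obtain h' k' where "corresponds h' h" "corresponds k' k"
    using corresponds_exists[OF h(1) hk(1)] corresponds_exists[OF h(2) hk(2)] by metis
  then show ?thesis unfolding hk(3) using corresponds_add corresponds_scale by blast
qed

lemma corresponds_left_unique:
  assumes "corresponds d c" "corresponds d' c" shows "d = d'"
proof -
  have d: "d \<in> X.D" "d' \<in> X.D" using assms by (auto simp: corresponds_def)
  note dA = d[THEN X.D_subset_Alg] and b = d[THEN X.D.bounded]
  have "X.amp d o\<^sub>L X.elem id_blinfun w w = X.amp d' o\<^sub>L X.elem id_blinfun w w"
    using assms e_mem dA by (intro inj X.amp_mem) (auto simp: corresponds_def)
  then show ?thesis by (intro X.elem_w_inj b) (simp add: X.amp_elem b compose_id)
qed

lemma corresponds_right_unique:
  assumes "corresponds d c" "corresponds d c'" shows "c = c'"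
proof -
  have c: "c \<in> Y.D" "c' \<in> Y.D" using assms by (auto simp: corresponds_def)
  note b = c[THEN Y.D.bounded]
  obtain a where a: "a \<in> X.A" "\<phi> a = Y.elem id_blinfun w w"
    using Y.elem_mem[OF Y.Alg_id] preimage by metis
  have "Y.amp c o\<^sub>L \<phi> a = Y.amp c' o\<^sub>L \<phi> a" using assms a(1) by (metis corresponds_def)
  then show ?thesis by (intro Y.elem_w_inj b) (simp add: a(2) Y.amp_elem b compose_id)
qed

text \<open>In the corner at w, S \<otimes> q and Q \<otimes> q have preimages a and b with b = (P
  \<otimes> 1)a'. Invariance under P \<otimes> 1 gives (P \<otimes> 1)ab = ab, whose image is QSQ
  \<otimes> q = SQ \<otimes> q.\<close>

lemma corresponds_invariant:
  assumes PQ: "corresponds P Q" and P: "P \<in> invariant_projections (Alg L1)" and Q: "Q \<in> projections"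
  shows "Q \<in> invariant_projections (Alg L2)"
  unfolding invariant_projections_def
proof (intro CollectI conjI Q ballI)
  fix S assume S: "S \<in> Alg L2"
  have D: "P \<in> X.D" "Q \<in> Y.D" and eq: "\<And>a. a \<in> X.A \<Longrightarrow> \<phi> (X.amp P o\<^sub>L a) = Y.amp Q o\<^sub>L \<phi> a"
    using PQ by (auto simp: corresponds_def)
  note QA = Y.D_subset_Alg[OF D(2)] and Qb = Y.D.bounded[OF D(2)] and Sb = Y.Alg_bounded[OF S]
  obtain a where a: "a \<in> X.A" "\<phi> a = Y.elem S w w" using Y.elem_mem[OF S] preimage by metis
  obtain a' where a': "a' \<in> X.A" "\<phi> a' = Y.elem id_blinfun w w"
    using Y.elem_mem[OF Y.Alg_id] preimage by metis
  define b where "b = X.amp P o\<^sub>L a'"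
  have b: "b \<in> X.A" unfolding b_def by (intro X.amp_mem X.D_subset_Alg D a')
  have "\<phi> b = Y.elem Q w w"
    unfolding b_def by (simp add: eq a' Y.amp_elem Qb compose_id)
  then have ab: "\<phi> (a o\<^sub>L b) = Y.elem (S o\<^sub>L Q) w w"
    by (simp add: mult a b Y.elem_compose Sb)
  have "X.amp P o\<^sub>L (a o\<^sub>L b) = (X.amp P o\<^sub>L (a o\<^sub>L X.amp P)) o\<^sub>L a'" by (simp add: b_def compose_assoc)
  also have "\<dots> = a o\<^sub>L b" by (simp add: X.invariant_amp[OF P a(1)] b_def compose_assoc)
  finally have "Y.amp Q o\<^sub>L \<phi> (a o\<^sub>L b) = \<phi> (a o\<^sub>L b)" using eq[OF X.A_compose[OF a(1) b]] by simp
  then show "Q o\<^sub>L (S o\<^sub>L Q) = S o\<^sub>L Q"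
    by (intro Y.elem_w_inj) (simp_all add: ab Y.amp_elem Qb Sb)
qed

text \<open>The existence proof produces a self-adjoint partner of c, and uniqueness identifies it
  with d.\<close>

lemma corresponds_selfadjoint:
  assumes "corresponds d c" "is_adjoint c c" shows "is_adjoint d d"
  using corresponds_exists[of c] corresponds_left_unique assms by (metis corresponds_def)

lemma inverse_iso: "stabilized_iso L2 L1 t2 t1 w (the_inv_into X.A \<phi>)"
proof -
  let ?\<psi> = "the_inv_into X.A \<phi>"
  have inj_on: "inj_on \<phi> X.A" using inj by (rule inj_onI)
  have \<psi>: "?\<psi> (\<phi> a) = a" if "a \<in> X.A" for a using that by (rule the_inv_into_f_f[OF inj_on])
  show ?thesis
  proof
    show "algebra_hom_on Y.A ?\<psi>"
      unfolding algebra_hom_on_def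
    proof (intro conjI ballI allI)
      fix S T and c :: complex assume T: "T \<in> Y.A"
      obtain b where b: "b \<in> X.A" "\<phi> b = T" using T by (rule preimage)
      show "?\<psi> (c *\<^sub>C T) = c *\<^sub>C ?\<psi> T"
        using \<psi>[OF X_sub(3)[OF b(1)], of c] \<psi>[OF b(1)] by (simp add: scale b)
      assume S: "S \<in> Y.A"
      obtain a where a: "a \<in> X.A" "\<phi> a = S" using S by (rule preimage)
      show "?\<psi> (S + T) = ?\<psi> S + ?\<psi> T"
        using \<psi>[OF X_sub(2)[OF a(1) b(1)]] \<psi>[OF a(1)] \<psi>[OF b(1)] by (simp add: add a b)
      show "?\<psi> (S o\<^sub>L T) = ?\<psi> S o\<^sub>L ?\<psi> T"
        using \<psi>[OF X.A_compose[OF a(1) b(1)]] \<psi>[OF a(1)] \<psi>[OF b(1)] by (simp add: mult a b)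
    qed
    have "?\<psi> ` \<phi> ` X.A = X.A" by (simp add: image_image \<psi> cong: image_cong)
    then show "?\<psi> ` Y.A = X.A" by (simp only: surj)
    show "isometric_on Y.A ?\<psi>"
      unfolding isometric_on_def using \<psi> norm_eq preimage by metis
  qed
qed

end

text \<open>Since the relation of the inverse isomorphism is the converse one, totality,
  self-adjointness and invariance in the other direction come from the same lemmas applied to the
  inverse.\<close>

lemma unitarily_equivalent_if_stabilizations_isometrically_isomorphic:
  assumes "stabilized_csl L1 t1 w" and "stabilized_csl L2 t2 w"
    and "isometrically_isomorphic (min_tensor t1 (Alg L1) compact_ops) (min_tensor t2 (Alg L2) compact_ops)"
  shows "unitarily_equivalent (Alg L1) (Alg L2)"
proof -
  interpret X: stabilized_csl L1 t1 w by fact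
  interpret Y: stabilized_csl L2 t2 w by fact
  obtain \<phi> where "algebra_hom_on X.A \<phi>" "\<phi> ` X.A = Y.A" "isometric_on X.A \<phi>"
    using assms(3) unfolding isometrically_isomorphic_def X.A_def Y.A_def by blast
  then interpret F: stabilized_iso L1 L2 t1 t2 w \<phi> by unfold_locales
  let ?\<psi> = "the_inv_into X.A \<phi>"
  interpret G: stabilized_iso L2 L1 t2 t1 w ?\<psi> by (rule F.inverse_iso)
  have inv: "?\<psi> (\<phi> a) = a" if "a \<in> X.A" for a
    using that F.inj by (intro the_inv_into_f_f inj_onI)
  have sym: "G.corresponds c d \<longleftrightarrow> F.corresponds d c" for c d
  proof
    assume G: "G.corresponds c d"
    then have dc: "d \<in> X.D" "c \<in> Y.D" by (auto simp: G.corresponds_def)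
    have "\<phi> (X.amp d o\<^sub>L a) = Y.amp c o\<^sub>L \<phi> a" if a: "a \<in> X.A" for a
    proof -
      have 1: "?\<psi> (Y.amp c o\<^sub>L \<phi> a) = X.amp d o\<^sub>L a"
        using G F.mem[OF a] by (simp add: G.corresponds_def inv a)
      have "Y.amp c o\<^sub>L \<phi> a \<in> Y.A" using Y.amp_mem[OF Y.D_subset_Alg[OF dc(2)] F.mem[OF a]] .
      then obtain b where "b \<in> X.A" "\<phi> b = Y.amp c o\<^sub>L \<phi> a" by (rule F.preimage)
      then show ?thesis using 1 inv by metis
    qed
    then show "F.corresponds d c" using dc by (simp add: F.corresponds_def)
  next
    assume F: "F.corresponds d c"
    then have dc: "d \<in> X.D" "c \<in> Y.D" by (auto simp: F.corresponds_def)
    have "?\<psi> (Y.amp c o\<^sub>L b) = X.amp d o\<^sub>L ?\<psi> b" if b: "b \<in> Y.A" for b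
    proof -
      obtain a where a: "a \<in> X.A" "\<phi> a = b" using b by (rule F.preimage)
      have "\<phi> (X.amp d o\<^sub>L a) = Y.amp c o\<^sub>L b" using F a by (auto simp: F.corresponds_def)
      then show ?thesis using inv[OF X.amp_mem[OF X.D_subset_Alg[OF dc(1)] a(1)]] inv[OF a(1)] a(2) by simp
    qed
    then show "G.corresponds c d" using dc by (simp add: G.corresponds_def)
  qed
  have proj: "P \<in> projections \<longleftrightarrow> Q \<in> projections" if PQ: "F.corresponds P Q" for P Q
  proof -
    have "is_adjoint P P \<longleftrightarrow> is_adjoint Q Q"
      using F.corresponds_selfadjoint[OF PQ] G.corresponds_selfadjoint[of Q P] PQ sym by blast
    moreover have "P o\<^sub>L P = P \<longleftrightarrow> Q o\<^sub>L Q = Q"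
      using F.corresponds_mult[OF PQ PQ] PQ F.corresponds_left_unique F.corresponds_right_unique by metis
    ultimately show ?thesis using projectionsD projectionsI by metis
  qed
  show ?thesis
  proof (rule unitarily_equivalent_Alg[where R = F.corresponds])
    show "multiplicity_free_csl L1" "multiplicity_free_csl L2" by unfold_locales
    show "\<exists>c. F.corresponds d c" if "d \<in> X.D" for d using G.corresponds_total[OF that] sym by blast
    show "is_adjoint c c" if "F.corresponds d c" "is_adjoint d d" for d c
      using G.corresponds_selfadjoint[of c d] that sym by blast
    show "P \<in> invariant_projections (Alg L1) \<longleftrightarrow> Q \<in> invariant_projections (Alg L2)"
      if PQ: "F.corresponds P Q" for P Q
      using F.corresponds_invariant[OF PQ] G.corresponds_invariant[of Q P] PQ proj[OF PQ] sym
      by (auto simp: invariant_projections_def[of "Alg L1"] invariant_projections_def[of "Alg L2"])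
  next
    show "d \<in> X.D \<and> c \<in> Y.D" if "F.corresponds d c" for d c using that by (simp add: F.corresponds_def)
  qed (fact F.corresponds_total F.corresponds_add F.corresponds_scale F.corresponds_mult
      F.corresponds_left_unique F.corresponds_right_unique)+
qed


section \<open>Unitary equivalence implies complete isometric isomorphism\<close>

text \<open>Applying W in each coordinate is a bijection between the unit balls of the direct sums,
  and V preserves the norms of the outputs.\<close>

lemma matrix_norm_conjugate:
  fixes V :: "'a::complex_inner \<Rightarrow>\<^sub>L 'b::complex_inner"
  assumes V: "is_adjoint V W" "V o\<^sub>L W = id_blinfun" "W o\<^sub>L V = id_blinfun"
  shows "matrix_norm n (\<lambda>i j. V o\<^sub>L (T i j o\<^sub>L W)) = matrix_norm n T"
proof -
  have inv: "V (W x) = x" "W (V y) = y" for x y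
    using V(2,3) by (metis blinfun_apply_blinfun_compose id_blinfun.rep_eq)+
  have nV: "norm (V y) = norm y" for y
  proof -
    have "complex_of_real ((norm (V y))\<^sup>2) = complex_of_real ((norm y)\<^sup>2)"
      using is_adjointD(1)[OF V(1), of y "V y"] by (simp only: flip: cinner_self) (simp add: inv)
    then have "(norm (V y))\<^sup>2 = (norm y)\<^sup>2" by (simp only: of_real_eq_iff)
    then show ?thesis by simp
  qed
  have nW: "norm (W x) = norm x" for x using nV[of "W x"] by (simp add: inv)
  let ?X = "{x :: nat \<Rightarrow> 'b. L2_set (\<lambda>j. norm (x j)) {..<n} \<le> 1}"
  let ?Y = "{x :: nat \<Rightarrow> 'a. L2_set (\<lambda>j. norm (x j)) {..<n} \<le> 1}"
  have XY: "?Y = (\<lambda>x j. W (x j)) ` ?X"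
  proof
    show "(\<lambda>x j. W (x j)) ` ?X \<subseteq> ?Y" by (auto simp: nW)
    show "?Y \<subseteq> (\<lambda>x j. W (x j)) ` ?X"
    proof
      fix y assume "y \<in> ?Y"
      then show "y \<in> (\<lambda>x j. W (x j)) ` ?X"
        by (intro image_eqI[of _ _ "\<lambda>j. V (y j)"]) (simp_all add: inv nV)
    qed
  qed
  have "norm (\<Sum>j<n. (V o\<^sub>L (T i j o\<^sub>L W)) (x j)) = norm (\<Sum>j<n. T i j (W (x j)))" for i x
    using nV[of "\<Sum>j<n. T i j (W (x j))"] by (simp add: blinfun.sum_right)
  then show ?thesis unfolding matrix_norm_def XY by (simp add: image_image)
qed

lemma completely_isometrically_isomorphic_if_unitarily_equivalent:
  assumes "unitarily_equivalent A B"
  shows "completely_isometrically_isomorphic A B"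
proof -
  obtain V W where b: "V \<in> bounded_ops" "W \<in> bounded_ops" and V: "is_adjoint V W"
    "V o\<^sub>L W = id_blinfun" "W o\<^sub>L V = id_blinfun" and B: "B = {W o\<^sub>L T o\<^sub>L V | T. T \<in> A}"
    using assms unfolding unitarily_equivalent_def by blast
  have W: "is_adjoint W V" using V(1) is_adjoint_commute by blast
  define \<phi> where "\<phi> T = W o\<^sub>L (T o\<^sub>L V)" for T
  have "\<phi> S o\<^sub>L \<phi> T = W o\<^sub>L (S o\<^sub>L ((V o\<^sub>L W) o\<^sub>L (T o\<^sub>L V)))" for S T by (simp add: \<phi>_def compose_assoc)
  then have "\<phi> (S o\<^sub>L T) = \<phi> S o\<^sub>L \<phi> T" for S T by (simp add: V(2) compose_id) (simp add: \<phi>_def compose_assoc)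
  then have "algebra_hom_on A \<phi>"
    unfolding algebra_hom_on_def by (auto simp: \<phi>_def compose_add compose_scaleC compose_scaleC_right b)
  moreover have "\<phi> ` A = B" by (auto simp: B \<phi>_def compose_assoc)
  moreover have "completely_isometric_on A \<phi>"
    unfolding completely_isometric_on_def \<phi>_def using matrix_norm_conjugate[OF W V(3,2)] by blast
  ultimately show ?thesis unfolding completely_isometrically_isomorphic_def by blast
qed

text \<open>The vectors are total functions on nat constrained at index 0 only, so for n = 1 the
  supremum is the one over the unit ball.\<close>

lemma matrix_norm_1: "matrix_norm 1 T = norm (T 0 0 :: 'a::complex_normed_vector \<Rightarrow>\<^sub>L 'a)"
proof -
  let ?X = "{x :: nat \<Rightarrow> 'a. norm (x 0) \<le> 1}"
  have "{..<1} = {0 :: nat}" by auto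
  then have eq: "matrix_norm 1 T = (SUP x\<in>?X. norm (T 0 0 (x 0)))"
    by (simp add: matrix_norm_def L2_set_def)
  have bd: "norm (T 0 0 (x 0)) \<le> norm (T 0 0)" if "x \<in> ?X" for x :: "nat \<Rightarrow> 'a"
  proof -
    have "norm (T 0 0 (x 0)) \<le> norm (T 0 0) * norm (x 0)" by (rule norm_blinfun)
    also have "\<dots> \<le> norm (T 0 0) * 1" using that by (intro mult_left_mono) auto
    finally show ?thesis by simp
  qed
  have ne: "?X \<noteq> {}" by (auto intro: exI[of _ "\<lambda>_. 0"])
  have bdd: "bdd_above ((\<lambda>x. norm (T 0 0 (x 0))) ` ?X)" using bd by (intro bdd_aboveI2)
  let ?s = "SUP x\<in>?X. norm (T 0 0 (x 0))"
  have s: "norm (T 0 0 y) \<le> ?s" if "norm y \<le> 1" for y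
    using cSUP_upper[OF _ bdd, of "\<lambda>_. y"] that by simp
  have "norm (T 0 0) \<le> ?s"
  proof (rule norm_blinfun_bound)
    show "0 \<le> ?s" using s[of 0] by (simp add: blinfun.zero_right)
    fix y
    show "norm (T 0 0 y) \<le> ?s * norm y"
    proof (cases "y = 0")
      case False
      have "norm (T 0 0 ((1 / norm y) *\<^sub>R y)) \<le> ?s" using False by (intro s) simp
      then show ?thesis using False by (simp add: blinfun.scaleR_right field_simps)
    qed (simp add: blinfun.zero_right)
  qed
  moreover have "?s \<le> norm (T 0 0)" using ne bd by (intro cSUP_least) auto
  ultimately show ?thesis using eq by simp
qed

lemma isometrically_isomorphic_if_completely:
  assumes "completely_isometrically_isomorphic A B"
  shows "isometrically_isomorphic A B"
proof -
  obtain \<phi> where \<phi>: "algebra_hom_on A \<phi>" "\<phi> ` A = B" "completely_isometric_on A \<phi>"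
    using assms unfolding completely_isometrically_isomorphic_def by blast
  have "norm (\<phi> T) = norm T" if "T \<in> A" for T
  proof -
    have "matrix_norm 1 (\<lambda>i j. \<phi> T) = matrix_norm 1 (\<lambda>i j. T)"
      using \<phi>(3)[unfolded completely_isometric_on_def, rule_format, of 1 "\<lambda>i j. T"] that by simp
    then show ?thesis by (simp only: matrix_norm_1)
  qed
  then show ?thesis using \<phi> unfolding isometrically_isomorphic_def isometric_on_def by blast
qed

text \<open>Only an inclusion is stated, with the two tensor products and the roles of V and W free,
  so that it applies to a unitary and to its inverse alike.\<close>

lemma min_tensor_conjugate_subset:
  assumes V: "V \<in> bounded_ops" "V o\<^sub>L W = id_blinfun" and V': "V' \<in> bounded_ops" "W' \<in> bounded_ops"
    and V't: "\<And>x y. blinfun_apply V' (t1 x y) = t2 (blinfun_apply V x) y"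
    and W't: "\<And>x y. blinfun_apply W' (t2 x y) = t1 (blinfun_apply W x) y"
    and AB: "\<And>T. T \<in> A \<Longrightarrow> V o\<^sub>L (T o\<^sub>L W) \<in> B" and R: "R \<in> min_tensor t1 A K"
  shows "V' o\<^sub>L (R o\<^sub>L W') \<in> min_tensor t2 B K"
proof (rule closure_cspan_subset[of "min_tensor t2 B K" "\<lambda>R. V' o\<^sub>L (R o\<^sub>L W')"])
  show "csubspace (min_tensor t2 B K)" "closed (min_tensor t2 B K)"
    unfolding min_tensor_def by (intro csubspace_closure complex_vector.subspace_span closed_closure)+
  show "continuous_on UNIV (\<lambda>R. V' o\<^sub>L (R o\<^sub>L W'))"
    by (intro bounded_bilinear.continuous_on[OF bounded_bilinear_blinfun_compose]
        continuous_on_const continuous_on_id)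
  show "R \<in> closure (cspan {R. \<exists>S\<in>A. \<exists>T\<in>K. is_op_tensor t1 S T R})"
    using R by (simp add: min_tensor_def)
  fix R assume "R \<in> {R. \<exists>S\<in>A. \<exists>T\<in>K. is_op_tensor t1 S T R}"
  then obtain S T where S: "S \<in> A" "T \<in> K" "is_op_tensor t1 S T R" by blast
  then have "is_op_tensor t2 (V o\<^sub>L (S o\<^sub>L W)) T (V' o\<^sub>L (R o\<^sub>L W'))"
    using V' by (simp add: is_op_tensor_def V't W't)
  then show "V' o\<^sub>L (R o\<^sub>L W') \<in> min_tensor t2 B K"
    unfolding min_tensor_def using AB S
    by (intro subsetD[OF closure_subset] complex_vector.span_base) blast
qed (auto simp: compose_add compose_scaleC compose_scaleC_right V')

lemma unitarily_equivalent_min_tensor: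
  assumes t1: "hilbert_tensor t1" and t2: "hilbert_tensor t2" and AB: "unitarily_equivalent A B"
  shows "unitarily_equivalent (min_tensor t1 A K) (min_tensor t2 B K)"
proof -
  obtain V W where b: "V \<in> bounded_ops" "W \<in> bounded_ops" and V: "is_adjoint V W"
    "V o\<^sub>L W = id_blinfun" "W o\<^sub>L V = id_blinfun" and B: "B = {W o\<^sub>L T o\<^sub>L V | T. T \<in> A}"
    using AB unfolding unitarily_equivalent_def by blast
  obtain V' W' where V': "is_adjoint V' W'" "V' o\<^sub>L W' = id_blinfun" "W' o\<^sub>L V' = id_blinfun"
    "\<And>x y. blinfun_apply V' (t2 x y) = t1 (blinfun_apply V x) y"
    "\<And>x y. blinfun_apply W' (t1 x y) = t2 (blinfun_apply W x) y"
    using ex_unitary_ampliation[OF t2 t1 V] by metis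
  note b' = is_adjoint_bounded_ops[OF V'(1)]
  have 1: "W' o\<^sub>L (R o\<^sub>L V') \<in> min_tensor t2 B K" if "R \<in> min_tensor t1 A K" for R
    by (rule min_tensor_conjugate_subset[OF b(2) V(3) b'(2,1) V'(5,4) _ that])
      (auto simp: B compose_assoc)
  have "V o\<^sub>L (S o\<^sub>L W) \<in> A" if S: "S \<in> B" for S
  proof -
    obtain T where T: "T \<in> A" "S = W o\<^sub>L T o\<^sub>L V" using S B by blast
    have "V o\<^sub>L (S o\<^sub>L W) = (V o\<^sub>L W) o\<^sub>L (T o\<^sub>L (V o\<^sub>L W))" by (simp add: T(2) compose_assoc)
    then show ?thesis using T(1) by (simp add: V compose_id)
  qed
  then have 2: "V' o\<^sub>L (R o\<^sub>L W') \<in> min_tensor t1 A K" if "R \<in> min_tensor t2 B K" for R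
    using min_tensor_conjugate_subset[OF b(1) V(2) b' V'(4,5) _ that] by blast
  have 3: "R = W' o\<^sub>L ((V' o\<^sub>L (R o\<^sub>L W')) o\<^sub>L V')" for R
    using V'(2,3) by (metis compose_assoc compose_id)
  have "min_tensor t2 B K = {W' o\<^sub>L T o\<^sub>L V' | T. T \<in> min_tensor t1 A K}"
    unfolding compose_assoc using 1 2 3 by blast
  then show ?thesis unfolding unitarily_equivalent_def using b' V' by blast
qed

theorem corollary2p10:
  fixes L1 :: "('h1::chilbert_space \<Rightarrow>\<^sub>L 'h1) set"
    and L2 :: "('h2::chilbert_space \<Rightarrow>\<^sub>L 'h2) set"
    and t1 :: "'h1 \<Rightarrow> 'k::chilbert_space \<Rightarrow> 't1::chilbert_space"
    and t2 :: "'h2 \<Rightarrow> 'k \<Rightarrow> 't2::chilbert_space"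
  assumes "CSL L1" and "multiplicity_free L1"
    and "CSL L2" and "multiplicity_free L2"
    and "separable_space (euclidean :: 'k topology)" and "\<exists>v::'k. v \<noteq> 0"
    and "hilbert_tensor t1" and "hilbert_tensor t2"
  shows
    "(unitarily_equivalent (Alg L1) (Alg L2) \<longleftrightarrow>
        isometrically_isomorphic (Alg L1) (Alg L2)) \<and>
     (isometrically_isomorphic (Alg L1) (Alg L2) \<longleftrightarrow>
        isometrically_isomorphic
          (min_tensor t1 (Alg L1) compact_ops) (min_tensor t2 (Alg L2) compact_ops)) \<and>
     (unitarily_equivalent (Alg L1) (Alg L2) \<longleftrightarrow>
        completely_isometrically_isomorphic (Alg L1) (Alg L2)) \<and>
     (completely_isometrically_isomorphic (Alg L1) (Alg L2) \<longleftrightarrow>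
        completely_isometrically_isomorphic
          (min_tensor t1 (Alg L1) compact_ops) (min_tensor t2 (Alg L2) compact_ops))"
proof -
  have L: "multiplicity_free_csl L1" "multiplicity_free_csl L2"
    using assms(1-4) by unfold_locales
  obtain v :: 'k where v: "v \<noteq> 0" using assms(6) by blast
  define w where "w = (1 / norm v) *\<^sub>R v"
  have w: "norm w = 1" using v by (simp add: w_def)
  have "stabilized_csl L1 t1 w" "stabilized_csl L2 t2 w"
    using assms(7,8) w L
    by (auto intro!: stabilized_csl.intro hilbert_tensor_product.intro stabilized_csl_axioms.intro)
  note from_stable = unitarily_equivalent_if_stabilizations_isometrically_isomorphic[OF this]
  note from_iso = unitarily_equivalent_if_isometrically_isomorphic[OF L]
  \<comment> \<open>Everything lies on cycles through unitary equivalence of the original algebras: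
    it ascends to the stabilizations by ampliation, unitary conjugation is completely isometric,
    complete isometry implies isometry, and both isometric statements lead back.\<close>
  show ?thesis
    using from_stable from_iso isometrically_isomorphic_if_completely
      completely_isometrically_isomorphic_if_unitarily_equivalent
      unitarily_equivalent_min_tensor[OF assms(7,8)]
    by metis
qed

end
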